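(* Suppose that: (Assumption 1) for each $i\in\mathcal N$, $J_i(x_i;x_{-i})$ is a proper, lower semicontinuous, convex function of $x_i$ for any fixed $x_{-i}$; (Assumption 2) each $\Omega_i$ is nonempty, closed and convex, and $\mathcal X$ is nonempty and satisfies Slater's constraint qualification; (Assumption 3) the communication graph $\mathcal G$ is directed, weakly connected and has no self-loops; (Assumption 4) the game admits at least one v-GNE, and the operator $\mathcal R^T\mathcal F+\frac{\rho_\mu}{2}L_n$ on $\mathbb R^{nN}$ is maximally monotone. Suppose further that the positive step sizes satisfy $$\tau_{1i}^{-1}>\tfrac12\|A_i\|_1+(\tfrac12+\rho_\mu)d_i,\qquad \tau_{2i}^{-1}>\tfrac12\|A_i\|_\infty+(\tfrac12+\rho_z)d_i\quad\forall i\in\mathcal N,\qquad \tau_{3e}^{-1}>1,\quad\tau_{4e}^{-1}>1\quad\forall e\in\mathcal E_g.$$ Then, for any initialization, the sequences $\{\mathbf y^{(k)}\}_{k\in\mathbb N}$ and $\{\boldsymbol\lambda^{(k)}\}_{k\in\mathbb N}$ generated by the distributed GNE seeking algorithm (described in the context) satisfy $\lim_{k\to\infty}\mathbf y^{(k)}=\mathbf 1_N\otimes y^*$ and $\lim_{k\to\infty}\boldsymbol\lambda^{(k)}=\mathbf 1_N\otimes\lambda^*$, where $y^*\in\mathbb R^n$ is a v-GNE of the game and $(y^*,\lambda^* )$ together solves the v-GNE KKT conditions.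
   Context: Game. Players $\mathcal N=\{1,\dots,N\}$. Player $i$ has decision $x_i\in\Omega_i\subseteq\mathbb R^{n_i}$; $n=\sum_i n_i$, $x=[x_1;\dots;x_N]\in\mathbb R^n$, $x_{-i}$ is the stack of the other players' decisions. Given $x_{-i}$, player $i$ minimizes $J_i(x_i;x_{-i})$ (values in $\mathbb R\cup\{+\infty\}$) over $x_i\in\Omega_i$ subject to $A_ix_i\le b-\sum_{j\ne i}A_jx_j$, where $A_i\in\mathbb R^{m\times n_i}$, $b\in\mathbb R^m$. $A=[A_1,\dots,A_N]$, $\Omega=\prod_i\Omega_i$, $\mathcal X=\Omega\cap\{x: Ax-b\le\mathbf 0\}$. $N_S(x)$ is the normal cone of $S$ at $x$ (empty if $x\notin S$). The v-GNE KKT conditions for $(x,\lambda)$ are: $\mathbf 0\in\partial_{x_i}J_i(x_i;x_{-i})+A_i^T\lambda+N_{\Omega_i}(x_i)$ for all $i$, and $\mathbf 0\in-(Ax-b)+N_{\mathbb R_+^m}(\lambda)$; $x$ is a v-GNE (variational generalized Nash equilibrium) if some $\lambda$ makes them hold. Network. $\mathcal G=(\mathcal N,\mathcal E_g)$ is a directed graph on the players; $(j,i)$ denotes an edge with tail $j$ and head $i$. $\mathcal N_i^+=\{j:(j,i)\in\mathcal E_g\}$, $\mathcal N_i^-=\{j:(i,j)\in\mathcal E_g\}$; $\mathcal N_i$ is the collection of neighbors of $i$ (sums over $\mathcal N_i$ mean the sum over $\mathcal N_i^+$ plus the sum over $\mathcal N_i^-$); $d_i$ is the degree of $i$ (number of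 incident edges). $L=BB^T$ is the graph Laplacian, $B$ the incidence matrix ($+1$ at head, $-1$ at tail), $L_n=L\otimes I_n$. Notation. $y_i=(y_i^1,\dots,y_i^N)\in\mathbb R^n$, $y_i^j\in\mathbb R^{n_j}$, $y_i^{-i}$ is the stack of $y_i^j$, $j\ne i$; the same block notation $v^{i}$, $v^{-i}$ is used for any $v\in\mathbb R^n$. $\mathbf y=[y_1;\dots;y_N]$, $\boldsymbol\lambda=[\lambda_1;\dots;\lambda_N]$ with $\lambda_i\in\mathbb R^m$. $\mathcal R_iy_i=y_i^i$ (selection matrix), $\mathcal R=\mathrm{blkd}(\mathcal R_1,\dots,\mathcal R_N)$. Extended pseudogradient: $\mathcal F:\mathbb R^{nN}\rightrightarrows\mathbb R^n$, $\mathbf y\mapsto[\partial_{y_i^i}J_i(y_i^i;y_i^{-i})]_{i\in\mathcal N}$. $\|\cdot\|_1,\|\cdot\|_\infty$ on matrices are the induced norms (max column / row absolute sum). $\rho_\mu,\rho_z\ge0$ are constants; $\tau_{1i},\tau_{2i}>0$ ($i\in\mathcal N$), $\tau_{3e},\tau_{4e}>0$ ($e\in\mathcal E_g$) are step sizes; $b_i\in\mathbb R^m$ are arbitrary fixed vectors with $\sum_ib_i=b$. Distributed GNE seeking algorithm. Initialize $\tilde y_i^{(0)}\in\mathbb R^n,\tilde\lambda_i^{(0)}\in\mathbb R^m$ ($i\in\mathcal N$), $\tilde\mu_{ji}^{(0)}\in\mathbb R^n,\tilde z_{ji}^{(0)}\in\mathbb R^m$ ($(j,i)\in\mathcal E_g$).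 For $k=0,1,\dots$: 1. For each player $i$: $$y_i^{-i(k+1)}=\tilde y_i^{-i(k)}-\tau_{1i}\Big(\tfrac{\rho_\mu}2\sum_{j\in\mathcal N_i}(\tilde y_i^{-i(k)}-\tilde y_j^{-i(k)})+\tfrac12\big(\sum_{j\in\mathcal N_i^+}\tilde\mu_{ji}^{-i(k)}-\sum_{j\in\mathcal N_i^-}\tilde\mu_{ij}^{-i(k)}\big)\Big),$$ $$y_i^{i(k+1)}=\mathrm{argmin}_{v_i\in\Omega_i}\Big[J_i(v_i;y_i^{-i(k+1)})+\tfrac12(\tilde\lambda_i^{(k)})^TA_iv_i+\tfrac{\rho_\mu}2\sum_{j\in\mathcal N_i}(\tilde y_i^{i(k)}-\tilde y_j^{i(k)})^Tv_i+\tfrac1{2\tau_{1i}}\|v_i-\tilde y_i^{i(k)}\|^2+\tfrac12\big(\sum_{j\in\mathcal N_i^+}\tilde\mu_{ji}^{i(k)}-\sum_{j\in\mathcal N_i^-}\tilde\mu_{ij}^{i(k)}\big)^Tv_i\Big],$$ $$\lambda_i^{(k+1)}=\mathrm{Proj}_{\mathbb R_+^m}\Big[\tilde\lambda_i^{(k)}+\tau_{2i}\Big(A_i\mathcal R_iy_i^{(k+1)}-\tfrac12A_i\mathcal R_i\tilde y_i^{(k)}-\tfrac{\rho_z}2\sum_{j\in\mathcal N_i}(\tilde\lambda_i^{(k)}-\tilde\lambda_j^{(k)})-\tfrac12\big(\sum_{j\in\mathcal N_i^+}\tilde z_{ji}^{(k)}-\sum_{j\in\mathcal N_i^-}\tilde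 z_{ij}^{(k)}\big)-b_i\Big)\Big].$$ 2. For each edge $e=(j,i)$: $\mu_{ji}^{(k+1)}=\tilde\mu_{ji}^{(k)}+\tau_{3e}\big(y_i^{(k+1)}-y_j^{(k+1)}-\frac12(\tilde y_i^{(k)}-\tilde y_j^{(k)})\big)$ and $z_{ji}^{(k+1)}=\tilde z_{ji}^{(k)}+\tau_{4e}\big(\lambda_i^{(k+1)}-\lambda_j^{(k+1)}-\frac12(\tilde\lambda_i^{(k)}-\tilde\lambda_j^{(k)})\big)$. 3. For each player $i$: $$\tilde y_i^{(k+1)}=y_i^{(k+1)}-\tau_{1i}\Big(\mathcal R_i^TA_i^T(\lambda_i^{(k+1)}-\tfrac12\tilde\lambda_i^{(k)})+\rho_\mu\sum_{j\in\mathcal N_i}\big((y_i^{(k+1)}-y_j^{(k+1)})-\tfrac12(\tilde y_i^{(k)}-\tilde y_j^{(k)})\big)+\sum_{j\in\mathcal N_i^+}(\mu_{ji}^{(k+1)}-\tfrac12\tilde\mu_{ji}^{(k)})-\sum_{j\in\mathcal N_i^-}(\mu_{ij}^{(k+1)}-\tfrac12\tilde\mu_{ij}^{(k)})\Big),$$ $$\tilde\lambda_i^{(k+1)}=\lambda_i^{(k+1)}+\tau_{2i}\Big(A_i\mathcal R_i(\tilde y_i^{(k+1)}-\tfrac12\tilde y_i^{(k)})-\rho_z\sum_{j\in\mathcal N_i}\big((\lambda_i^{(k+1)}-\lambda_j^{(k+1)})-\tfrac12(\tilde\lambda_i^{(k)}-\tilde\lambda_j^{(k)})\big)-\sum_{j\in\mathcal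 N_i^+}(z_{ji}^{(k+1)}-\tfrac12\tilde z_{ji}^{(k)})+\sum_{j\in\mathcal N_i^-}(z_{ij}^{(k+1)}-\tfrac12\tilde z_{ij}^{(k)})\Big).$$ 4. For each edge $e=(j,i)$: $\tilde\mu_{ji}^{(k+1)}=\mu_{ji}^{(k+1)}+\tau_{3e}\big(\tilde y_i^{(k+1)}-\tilde y_j^{(k+1)}-\frac12(\tilde y_i^{(k)}-\tilde y_j^{(k)})\big)$ and $\tilde z_{ji}^{(k+1)}=z_{ji}^{(k+1)}+\tau_{4e}\big(\tilde\lambda_i^{(k+1)}-\tilde\lambda_j^{(k+1)}-\frac12(\tilde\lambda_i^{(k)}-\tilde\lambda_j^{(k)})\big)$.
   Formalization: Slater's condition is taken to require one point x with Ax < b such that each x_i lies in the relative interior of Ω_i and also of the effective domain of J_i(·; x_{-i}); without the latter the claim fails for extended-valued J_i. For finite J_i nothing is added. *)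

theory Defs
  imports "HOL-Analysis.Analysis"
begin

section \<open>Convex analysis with extended-real values, relative to a subspace\<close>

text \<open>The set \<open>V\<close> below is the (coordinate) subspace on which a function lives; it plays the role
  of the whole space, so subgradients and normals are taken inside \<open>V\<close>.\<close>

definition proper_on :: "'a set \<Rightarrow> ('a \<Rightarrow> ereal) \<Rightarrow> bool" where
  "proper_on V f \<longleftrightarrow> (\<forall>v\<in>V. f v \<noteq> -\<infinity>) \<and> (\<exists>v\<in>V. f v < \<infinity>)"

definition lsc_on :: "'a::topological_space set \<Rightarrow> ('a \<Rightarrow> ereal) \<Rightarrow> bool" where
  "lsc_on V f \<longleftrightarrow> (\<forall>v\<in>V. f v \<le> Liminf (at v within V) f)"

definition econvex_on :: "'a::real_vector set \<Rightarrow> ('a \<Rightarrow> ereal) \<Rightarrow> bool" where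
  "econvex_on V f \<longleftrightarrow> (\<forall>u\<in>V. \<forall>v\<in>V. \<forall>t\<in>{0<..<1::real}.
     f ((1 - t) *\<^sub>R u + t *\<^sub>R v) \<le> ereal (1 - t) * f u + ereal t * f v)"

definition subdifferential :: "'a::real_inner set \<Rightarrow> ('a \<Rightarrow> ereal) \<Rightarrow> 'a \<Rightarrow> 'a set" where
  "subdifferential V f x =
     {u \<in> V. \<bar>f x\<bar> \<noteq> \<infinity> \<and> (\<forall>z\<in>V. f x + ereal (u \<bullet> (z - x)) \<le> f z)}"

definition normal_cone :: "'a::real_inner set \<Rightarrow> 'a set \<Rightarrow> 'a \<Rightarrow> 'a set" where
  "normal_cone V S x = {u \<in> V. x \<in> S \<and> (\<forall>z\<in>S. u \<bullet> (z - x) \<le> 0)}"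

definition monotone_op :: "('a::real_inner \<Rightarrow> 'a set) \<Rightarrow> bool" where
  "monotone_op T \<longleftrightarrow> (\<forall>x y. \<forall>u\<in>T x. \<forall>v\<in>T y. 0 \<le> (u - v) \<bullet> (x - y))"

definition maximally_monotone_op :: "('a::real_inner \<Rightarrow> 'a set) \<Rightarrow> bool" where
  "maximally_monotone_op T \<longleftrightarrow>
     monotone_op T \<and> (\<forall>S. monotone_op S \<and> (\<forall>x. T x \<subseteq> S x) \<longrightarrow> S = T)"

definition nonneg_orthant :: "(real^'m::finite) set" where
  "nonneg_orthant = {l. \<forall>r. 0 \<le> l $ r}"

definition matrix_norm_1 :: "real^'n::finite^'m::finite \<Rightarrow> real" where
  "matrix_norm_1 M = Max (range (\<lambda>c. \<Sum>r\<in>UNIV. \<bar>M $ r $ c\<bar>))"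

definition matrix_norm_inf :: "real^'n::finite^'m::finite \<Rightarrow> real" where
  "matrix_norm_inf M = Max (range (\<lambda>r. \<Sum>c\<in>UNIV. \<bar>M $ r $ c\<bar>))"


section \<open>The game\<close>

text \<open>
  The players are the elements of the finite type \<open>'p\<close>, the coordinates of the joint decision
  space \<open>R^n\<close> the elements of \<open>'n\<close>, and \<open>owner\<close> assigns each coordinate to a player. So \<open>n_i\<close> is
  the number of coordinates owned by \<open>i\<close>, and \<open>R^{n_i}\<close> is represented isometrically by the
  subspace \<open>dspace G i\<close> of the vectors that vanish outside the coordinates of \<open>i\<close>.
  The cost \<open>J_i(x_i; x_{-i})\<close> is a function \<open>cost G i\<close> of the stacked vector.
\<close>

record ('p, 'n, 'm) game =
  owner :: "'n \<Rightarrow> 'p"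
  feas :: "'p \<Rightarrow> (real^'n) set"
  cost :: "'p \<Rightarrow> real^'n \<Rightarrow> ereal"
  cmat :: "real^'n^'m"
  crhs :: "real^'m"

definition dspace :: "('p, 'n::finite, 'm::finite) game \<Rightarrow> 'p \<Rightarrow> (real^'n) set" where
  "dspace G i = {v. \<forall>c. owner G c \<noteq> i \<longrightarrow> v $ c = 0}"

text \<open>The block \<open>x^i\<close> (also the selection \<open>R_i x\<close>), as an element of \<open>dspace G i\<close>.
  Under this representation the transpose of \<open>R_i\<close> is the inclusion of \<open>dspace G i\<close>.\<close>

definition blk :: "('p, 'n::finite, 'm::finite) game \<Rightarrow> 'p \<Rightarrow> real^'n \<Rightarrow> real^'n" where
  "blk G i x = (\<chi> c. if owner G c = i then x $ c else 0)"

text \<open>The stacked vector \<open>(v; x_{-i})\<close>.\<close>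

definition join :: "('p, 'n::finite, 'm::finite) game \<Rightarrow> 'p \<Rightarrow> real^'n \<Rightarrow> real^'n \<Rightarrow> real^'n" where
  "join G i v x = (\<chi> c. if owner G c = i then v $ c else x $ c)"

text \<open>The block \<open>A_i\<close> of \<open>A\<close>, padded with zero columns; the padding changes neither of the
  two induced norms.\<close>

definition cmat_blk :: "('p, 'n::finite, 'm::finite) game \<Rightarrow> 'p \<Rightarrow> real^'n^'m" where
  "cmat_blk G i = (\<chi> r c. if owner G c = i then cmat G $ r $ c else 0)"

definition own_cost :: "('p, 'n::finite, 'm::finite) game \<Rightarrow> 'p \<Rightarrow> real^'n \<Rightarrow> real^'n \<Rightarrow> ereal" where
  "own_cost G i x = (\<lambda>v. cost G i (join G i v x))"

definition partial_subdiff ::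
    "('p, 'n::finite, 'm::finite) game \<Rightarrow> 'p \<Rightarrow> real^'n \<Rightarrow> (real^'n) set" where
  "partial_subdiff G i x = subdifferential (dspace G i) (own_cost G i x) (blk G i x)"

definition feasible_set :: "('p, 'n::finite, 'm::finite) game \<Rightarrow> (real^'n) set" where
  "feasible_set G =
     {x. (\<forall>i. blk G i x \<in> feas G i) \<and> (\<forall>r. (cmat G *v x - crhs G) $ r \<le> 0)}"

definition kkt :: "('p, 'n::finite, 'm::finite) game \<Rightarrow> real^'n \<Rightarrow> real^'m \<Rightarrow> bool" where
  "kkt G x l \<longleftrightarrow>
     (\<forall>i. 0 \<in> {g + transpose (cmat_blk G i) *v l + v | g v.
                 g \<in> partial_subdiff G i x \<and>
                 v \<in> normal_cone (dspace G i) (feas G i) (blk G i x)}) \<and>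
     0 \<in> {- (cmat G *v x - crhs G) + v | v. v \<in> normal_cone UNIV nonneg_orthant l}"

definition v_gne :: "('p, 'n::finite, 'm::finite) game \<Rightarrow> real^'n \<Rightarrow> bool" where
  "v_gne G x \<longleftrightarrow> (\<exists>l. kkt G x l)"

text \<open>
  Slater's constraint qualification: a point that satisfies the coupling constraints strictly and
  lies in the relative interior of the domain of the players' problems. That domain is cut out both
  by the sets \<open>feas G i\<close> and by the effective domains of the extended-valued costs. The latter
  cannot be dropped: it is what makes the subdifferential of the cost plus the indicator function
  of \<open>feas G i\<close> equal to the sum of the subdifferential and the normal cone, as in \<open>kkt\<close>.
  For real-valued costs only \<open>feas G i\<close> matters, see \<open>slater_finite_cost\<close> below.
\<close>

definition slater :: "('p, 'n::finite, 'm::finite) game \<Rightarrow> bool" where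
  "slater G \<longleftrightarrow> (\<exists>x. (\<forall>r. (cmat G *v x) $ r < crhs G $ r) \<and>
     (\<forall>i. blk G i x \<in> rel_interior (feas G i) \<and>
          blk G i x \<in> rel_interior {v \<in> dspace G i. own_cost G i x v < \<infinity>}))"

lemma blk_in_dspace: "blk G i x \<in> dspace G i"
  by (simp add: blk_def dspace_def)

lemma subspace_dspace: "subspace (dspace G i)"
  by (auto simp: dspace_def subspace_def)

lemma slater_finite_cost:
  assumes "\<And>i x. cost G i x < \<infinity>"
  shows "slater G \<longleftrightarrow> (\<exists>x. (\<forall>r. (cmat G *v x) $ r < crhs G $ r) \<and>
     (\<forall>i. blk G i x \<in> rel_interior (feas G i)))"
proof -
  have "{v \<in> dspace G i. own_cost G i x v < \<infinity>} = dspace G i" for i x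
    using assms by (auto simp: own_cost_def)
  moreover have "rel_interior (dspace G i) = dspace G i" for i
    by (simp add: affine_rel_open rel_open_def[symmetric] subspace_dspace subspace_imp_affine)
  ultimately show ?thesis
    by (simp add: slater_def blk_in_dspace)
qed


section \<open>The communication graph\<close>

text \<open>An edge with tail \<open>j\<close> and head \<open>i\<close> is the pair \<open>(j, i)\<close>; all players are vertices.\<close>

definition weakly_connected :: "('p \<times> 'p) set \<Rightarrow> bool" where
  "weakly_connected E \<longleftrightarrow> (\<forall>i j. (i, j) \<in> (E \<union> E\<inverse>)\<^sup>*)"

definition nbr_in :: "('p \<times> 'p) set \<Rightarrow> 'p \<Rightarrow> 'p set" where
  "nbr_in E i = {j. (j, i) \<in> E}"

definition nbr_out :: "('p \<times> 'p) set \<Rightarrow> 'p \<Rightarrow> 'p set" where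
  "nbr_out E i = {j. (i, j) \<in> E}"

definition nbr_sum :: "('p \<times> 'p) set \<Rightarrow> 'p \<Rightarrow> ('p \<Rightarrow> 'a::real_vector) \<Rightarrow> 'a" where
  "nbr_sum E i f = (\<Sum>j\<in>nbr_in E i. f j) + (\<Sum>j\<in>nbr_out E i. f j)"

definition edge_balance :: "('p \<times> 'p) set \<Rightarrow> 'p \<Rightarrow> ('p \<times> 'p \<Rightarrow> 'a::real_vector) \<Rightarrow> 'a" where
  "edge_balance E i w = (\<Sum>j\<in>nbr_in E i. w (j, i)) - (\<Sum>j\<in>nbr_out E i. w (i, j))"

definition deg :: "('p \<times> 'p) set \<Rightarrow> 'p \<Rightarrow> nat" where
  "deg E i = card {e \<in> E. fst e = i \<or> snd e = i}"

definition incidence :: "'p \<Rightarrow> 'p \<times> 'p \<Rightarrow> real" where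
  "incidence i e = (if snd e = i then 1 else if fst e = i then - 1 else 0)"

definition laplacian :: "('p::finite \<times> 'p) set \<Rightarrow> real^'p^'p" where
  "laplacian E = (\<chi> i j. \<Sum>e\<in>E. incidence i e * incidence j e)"

text \<open>The action of the Kronecker product of the Laplacian with the identity matrix.\<close>

definition laplacian_n :: "('p::finite \<times> 'p) set \<Rightarrow> real^'n::finite^'p \<Rightarrow> real^'n^'p" where
  "laplacian_n E y = (\<chi> i. \<Sum>j\<in>UNIV. laplacian E $ i $ j *\<^sub>R y $ j)"

definition selection :: "('p::finite, 'n::finite, 'm::finite) game \<Rightarrow> real^'n^'p \<Rightarrow> real^'n" where
  "selection G y = (\<chi> c. y $ owner G c $ c)"

lemma adjoint_selection: "adjoint (selection G) g = (\<chi> i. blk G i g)"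
proof -
  have "adjoint (selection G) = (\<lambda>g. \<chi> i. blk G i g)"
  proof (rule adjoint_unique, intro allI)
    fix y g
    have "y \<bullet> (\<chi> i. blk G i g) = (\<Sum>i\<in>UNIV. \<Sum>c\<in>UNIV. y $ i $ c * (if owner G c = i then g $ c else 0))"
      by (simp add: inner_vec_def blk_def)
    also have "\<dots> = (\<Sum>c\<in>UNIV. \<Sum>i\<in>UNIV. y $ i $ c * (if owner G c = i then g $ c else 0))"
      by (rule sum.swap)
    also have "\<dots> = (\<Sum>c\<in>UNIV. y $ owner G c $ c * g $ c)"
      by (simp add: if_distrib cong: if_cong)
    finally show "selection G y \<bullet> g = y \<bullet> (\<chi> i. blk G i g)"
      by (simp add: inner_vec_def selection_def)
  qed
  then show ?thesis by simp
qed

definition ext_pseudograd ::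
    "('p::finite, 'n::finite, 'm::finite) game \<Rightarrow> real^'n^'p \<Rightarrow> (real^'n) set" where
  "ext_pseudograd G y = {g. \<forall>i. blk G i g \<in> partial_subdiff G i (y $ i)}"

definition reg_pseudograd ::
    "('p::finite, 'n::finite, 'm::finite) game \<Rightarrow> ('p \<times> 'p) set \<Rightarrow> real \<Rightarrow> real^'n^'p \<Rightarrow> (real^'n^'p) set" where
  "reg_pseudograd G E \<rho> y =
     {adjoint (selection G) g + (\<rho> / 2) *\<^sub>R laplacian_n E y | g. g \<in> ext_pseudograd G y}"


section \<open>The distributed algorithm\<close>

record ('p, 'm) network =
  edges :: "('p \<times> 'p) set"
  rho_mu :: real
  rho_z :: real
  tau1 :: "'p \<Rightarrow> real"
  tau2 :: "'p \<Rightarrow> real"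
  tau3 :: "'p \<times> 'p \<Rightarrow> real"
  tau4 :: "'p \<times> 'p \<Rightarrow> real"
  rhs_share :: "'p \<Rightarrow> real^'m"

text \<open>The variables carrying a tilde. The components of \<open>mu_t\<close> and \<open>z_t\<close> outside the edge set
  are never used.\<close>

record ('p, 'n, 'm) alg_state =
  y_t :: "real^'n^'p"
  lam_t :: "real^'m^'p"
  mu_t :: "'p \<times> 'p \<Rightarrow> real^'n"
  z_t :: "'p \<times> 'p \<Rightarrow> real^'m"

text \<open>Only the blocks other than \<open>i\<close> of \<open>y_explicit G P s i\<close> are used.\<close>

definition y_explicit ::
    "('p::finite, 'm::finite) network \<Rightarrow> ('p, 'n::finite, 'm) alg_state \<Rightarrow> 'p \<Rightarrow> real^'n" where
  "y_explicit P s i = y_t s $ i - tau1 P i *\<^sub>R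
     ((rho_mu P / 2) *\<^sub>R nbr_sum (edges P) i (\<lambda>j. y_t s $ i - y_t s $ j)
      + (1/2) *\<^sub>R edge_balance (edges P) i (mu_t s))"

definition y_objective ::
    "('p::finite, 'n::finite, 'm::finite) game \<Rightarrow> ('p, 'm) network \<Rightarrow> ('p, 'n, 'm) alg_state
      \<Rightarrow> 'p \<Rightarrow> real^'n \<Rightarrow> ereal" where
  "y_objective G P s i v = own_cost G i (y_explicit P s i) v + ereal (
     (1/2) * (lam_t s $ i \<bullet> (cmat_blk G i *v v))
     + (rho_mu P / 2) * (nbr_sum (edges P) i (\<lambda>j. blk G i (y_t s $ i) - blk G i (y_t s $ j)) \<bullet> v)
     + 1 / (2 * tau1 P i) * (norm (v - blk G i (y_t s $ i)))\<^sup>2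
     + (1/2) * (blk G i (edge_balance (edges P) i (mu_t s)) \<bullet> v))"

definition y_new ::
    "('p::finite, 'n::finite, 'm::finite) game \<Rightarrow> ('p, 'm) network \<Rightarrow> ('p, 'n, 'm) alg_state
      \<Rightarrow> real^'n^'p" where
  "y_new G P s = (\<chi> i. join G i (arg_min (y_objective G P s i) (\<lambda>v. v \<in> feas G i)) (y_explicit P s i))"

definition lam_new ::
    "('p::finite, 'n::finite, 'm::finite) game \<Rightarrow> ('p, 'm) network \<Rightarrow> ('p, 'n, 'm) alg_state
      \<Rightarrow> real^'m^'p" where
  "lam_new G P s = (\<chi> i. closest_point nonneg_orthant (lam_t s $ i + tau2 P i *\<^sub>R
     (cmat_blk G i *v blk G i (y_new G P s $ i)
      - (1/2) *\<^sub>R (cmat_blk G i *v blk G i (y_t s $ i))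
      - (rho_z P / 2) *\<^sub>R nbr_sum (edges P) i (\<lambda>j. lam_t s $ i - lam_t s $ j)
      - (1/2) *\<^sub>R edge_balance (edges P) i (z_t s)
      - rhs_share P i)))"

definition mu_new ::
    "('p::finite, 'n::finite, 'm::finite) game \<Rightarrow> ('p, 'm) network \<Rightarrow> ('p, 'n, 'm) alg_state
      \<Rightarrow> 'p \<times> 'p \<Rightarrow> real^'n" where
  "mu_new G P s = (\<lambda>(j, i). mu_t s (j, i) + tau3 P (j, i) *\<^sub>R
     (y_new G P s $ i - y_new G P s $ j - (1/2) *\<^sub>R (y_t s $ i - y_t s $ j)))"

definition z_new ::
    "('p::finite, 'n::finite, 'm::finite) game \<Rightarrow> ('p, 'm) network \<Rightarrow> ('p, 'n, 'm) alg_state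
      \<Rightarrow> 'p \<times> 'p \<Rightarrow> real^'m" where
  "z_new G P s = (\<lambda>(j, i). z_t s (j, i) + tau4 P (j, i) *\<^sub>R
     (lam_new G P s $ i - lam_new G P s $ j - (1/2) *\<^sub>R (lam_t s $ i - lam_t s $ j)))"

definition y_t_new ::
    "('p::finite, 'n::finite, 'm::finite) game \<Rightarrow> ('p, 'm) network \<Rightarrow> ('p, 'n, 'm) alg_state
      \<Rightarrow> real^'n^'p" where
  "y_t_new G P s = (\<chi> i. y_new G P s $ i - tau1 P i *\<^sub>R
     (transpose (cmat_blk G i) *v (lam_new G P s $ i - (1/2) *\<^sub>R lam_t s $ i)
      + rho_mu P *\<^sub>R nbr_sum (edges P) i
          (\<lambda>j. (y_new G P s $ i - y_new G P s $ j) - (1/2) *\<^sub>R (y_t s $ i - y_t s $ j))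
      + edge_balance (edges P) i (\<lambda>e. mu_new G P s e - (1/2) *\<^sub>R mu_t s e)))"

definition lam_t_new ::
    "('p::finite, 'n::finite, 'm::finite) game \<Rightarrow> ('p, 'm) network \<Rightarrow> ('p, 'n, 'm) alg_state
      \<Rightarrow> real^'m^'p" where
  "lam_t_new G P s = (\<chi> i. lam_new G P s $ i + tau2 P i *\<^sub>R
     (cmat_blk G i *v blk G i (y_t_new G P s $ i - (1/2) *\<^sub>R y_t s $ i)
      - rho_z P *\<^sub>R nbr_sum (edges P) i
          (\<lambda>j. (lam_new G P s $ i - lam_new G P s $ j) - (1/2) *\<^sub>R (lam_t s $ i - lam_t s $ j))
      - edge_balance (edges P) i (\<lambda>e. z_new G P s e - (1/2) *\<^sub>R z_t s e)))"

definition mu_t_new ::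
    "('p::finite, 'n::finite, 'm::finite) game \<Rightarrow> ('p, 'm) network \<Rightarrow> ('p, 'n, 'm) alg_state
      \<Rightarrow> 'p \<times> 'p \<Rightarrow> real^'n" where
  "mu_t_new G P s = (\<lambda>(j, i). mu_new G P s (j, i) + tau3 P (j, i) *\<^sub>R
     (y_t_new G P s $ i - y_t_new G P s $ j - (1/2) *\<^sub>R (y_t s $ i - y_t s $ j)))"

definition z_t_new ::
    "('p::finite, 'n::finite, 'm::finite) game \<Rightarrow> ('p, 'm) network \<Rightarrow> ('p, 'n, 'm) alg_state
      \<Rightarrow> 'p \<times> 'p \<Rightarrow> real^'m" where
  "z_t_new G P s = (\<lambda>(j, i). z_new G P s (j, i) + tau4 P (j, i) *\<^sub>R
     (lam_t_new G P s $ i - lam_t_new G P s $ j - (1/2) *\<^sub>R (lam_t s $ i - lam_t s $ j)))"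

definition alg_next ::
    "('p::finite, 'n::finite, 'm::finite) game \<Rightarrow> ('p, 'm) network \<Rightarrow> ('p, 'n, 'm) alg_state
      \<Rightarrow> ('p, 'n, 'm) alg_state" where
  "alg_next G P s = \<lparr>y_t = y_t_new G P s, lam_t = lam_t_new G P s,
                     mu_t = mu_t_new G P s, z_t = z_t_new G P s\<rparr>"

text \<open>The iterates without a tilde start at index 1, so the entry \<open>k\<close> of each sequence below is
  the iterate of index \<open>k + 1\<close>; \<open>s0\<close> is the initialization.\<close>

definition y_seq ::
    "('p::finite, 'n::finite, 'm::finite) game \<Rightarrow> ('p, 'm) network \<Rightarrow> ('p, 'n, 'm) alg_state
      \<Rightarrow> nat \<Rightarrow> real^'n^'p" where
  "y_seq G P s0 k = y_new G P ((alg_next G P ^^ k) s0)"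

definition lam_seq ::
    "('p::finite, 'n::finite, 'm::finite) game \<Rightarrow> ('p, 'm) network \<Rightarrow> ('p, 'n, 'm) alg_state
      \<Rightarrow> nat \<Rightarrow> real^'m^'p" where
  "lam_seq G P s0 k = lam_new G P ((alg_next G P ^^ k) s0)"

end

theory Submission
  imports Defs
begin

text \<open>
  The algorithm is a Douglas--Rachford iteration for \<open>0 \<in> A x + B x\<close> in the metric of a positive
  definite matrix, where \<open>x = (y, \<lambda>, \<mu>, z)\<close> collects the local copies of the decisions and of the
  multiplier together with the edge variables that enforce consensus among these copies.
  The operator \<open>A\<close> (\<open>kkt_op\<close>) consists of the extended pseudogradient, the normal cones and the
  affine data; \<open>B\<close> (\<open>coupling_op\<close>) is linear. The Laplacian terms and the skew couplings through
  the constraint matrices and the incidence matrix are shared half and half between the two.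
  The preconditioner (\<open>precond\<close>) has the inverse step sizes, reduced by the Laplacian terms of
  \<open>A\<close>, on its diagonal; its off-diagonal blocks are, up to signs that make it symmetric, the coupling
  blocks of \<open>A\<close>. In \<open>precond (x - w) \<in> A w\<close> they cancel the
  Laplacians and the couplings to unknowns that are not yet available, so that the inclusion can be solved block
  by block, in the order in which the players and the edges update. Thus the variables without a
  tilde are the \<open>A\<close>-resolvent of the tilde variables (\<open>first_half_step\<close>), and the tilde variables
  are then moved by the reflected \<open>B\<close>-resolvent (\<open>second_half_step\<close>). The step size conditions
  state that the preconditioner is strictly diagonally dominant, hence positive definite
  (\<open>precond_pos\<close>).

  Both operators are monotone, and for them \<open>douglas_rachford_convergence\<close> gives a limit at a zero
  of \<open>A + B\<close>. The third and fourth block row of a zero say that all copies agree; summing the other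
  two rows over the players removes the edge variables and leaves the KKT conditions
  (\<open>kkt_of_zero\<close>). Conversely, a solution of the KKT conditions becomes a zero once the edge
  variables \<open>z\<close> are chosen to absorb the differences between the players' shares of the coupling
  constraint, which is possible because the graph is connected (\<open>zero_of_kkt\<close>).

  The delicate point is that the minimization of a player has a solution at which the
  subgradient of the cost and a normal vector of the feasible set can be separated. This needs a
  common relative interior point of the feasible set and of the domain of
  \<open>J_i(\<cdot>; y_{-i})\<close> for the decisions \<open>y_{-i}\<close> that the iteration happens to produce, whereas Slater's
  condition provides such a point for a single choice of the rivals' decisions. But monotonicity
  of the regularized pseudogradient forces the closure of that domain to be
  independent of the rivals: otherwise a proximal point of \<open>J_i(\<cdot>; w)\<close> with a tiny step would carry
  a huge subgradient that points in the wrong direction when compared with a subgradient of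
  \<open>J_i(\<cdot>; x)\<close> at a point away from the domain of \<open>J_i(\<cdot>; w)\<close> (\<open>own_cost_domain_approx\<close>). Convex sets with the
  same closure have the same relative interior (\<open>rel_interior_own_cost_domain\<close>).
\<close>

section \<open>Convex minimization with extended-real values\<close>

lemma econvex_onD:
  assumes "econvex_on V f" "u \<in> V" "v \<in> V" "0 < t" "t < 1"
  shows "f ((1 - t) *\<^sub>R u + t *\<^sub>R v) \<le> ereal (1 - t) * f u + ereal t * f v"
  using assms unfolding econvex_on_def by (meson greaterThanLessThan_iff)

lemma lsc_onD:
  assumes "lsc_on V f" "v \<in> V" "a < f v"
  shows "\<forall>\<^sub>F u in at v within V. a < f u"
  using assms by (auto simp: lsc_on_def intro!: less_LiminfD intro: less_le_trans)

lemma lsc_on_subset: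
  assumes "lsc_on V f" "S \<subseteq> V"
  shows "lsc_on S f"
  unfolding lsc_on_def
proof
  fix v assume "v \<in> S"
  show "f v \<le> Liminf (at v within S) f"
    unfolding le_Liminf_iff
  proof (intro allI impI)
    fix a assume "a < f v"
    then have "\<forall>\<^sub>F u in at v within V. a < f u" using assms \<open>v \<in> S\<close> lsc_onD by blast
    then show "\<forall>\<^sub>F u in at v within S. a < f u"
      using at_le[OF assms(2)] filter_leD by blast
  qed
qed

lemma lsc_on_add_continuous:
  assumes lsc: "lsc_on V f" and cont: "continuous_on V h"
  shows "lsc_on V (\<lambda>v. f v + ereal (h v))"
  unfolding lsc_on_def
proof
  fix v assume v: "v \<in> V"
  show "f v + ereal (h v) \<le> Liminf (at v within V) (\<lambda>v. f v + ereal (h v))"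
    unfolding le_Liminf_iff
  proof (intro allI impI)
    fix a assume a: "a < f v + ereal (h v)"
    obtain c where c: "a - ereal (h v) < ereal c" "ereal c < f v"
      using a ereal_dense2[of "a - ereal (h v)" "f v"] by (auto simp: ereal_minus_less)
    have "((\<lambda>u. ereal (c + h u)) \<longlongrightarrow> ereal (c + h v)) (at v within V)"
      using cont v by (intro tendsto_intros) (auto simp: continuous_on_def)
    moreover have "a < ereal (c + h v)" using c(1) by (simp add: ereal_minus_less)
    ultimately have "\<forall>\<^sub>F u in at v within V. a < ereal (c + h u)"
      by (rule order_tendstoD)
    moreover have "\<forall>\<^sub>F u in at v within V. ereal c < f u"
      using lsc v c(2) by (rule lsc_onD)
    ultimately show "\<forall>\<^sub>F u in at v within V. a < f u + ereal (h u)"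
    proof eventually_elim
      case (elim u)
      then have "ereal c + ereal (h u) \<le> f u + ereal (h u)" by (intro add_mono) auto
      with elim show ?case by simp
    qed
  qed
qed

text \<open>Otherwise every point of \<open>K\<close> lies in an open set on which \<open>f\<close> exceeds one of its values \<open>f z\<close>.
  Finitely many of these sets cover \<open>K\<close>, and the smallest of the finitely many values \<open>f z\<close> would
  then exceed another one of them.\<close>

lemma lsc_on_attains_min:
  fixes f :: "'a::topological_space \<Rightarrow> ereal"
  assumes K: "compact K" "K \<noteq> {}" and lsc: "lsc_on K f"
  shows "\<exists>x\<in>K. \<forall>z\<in>K. f x \<le> f z"
proof (rule ccontr)
  assume "\<not> ?thesis"
  then have less: "\<exists>z\<in>K. f z < f x" if "x \<in> K" for x using that by (meson not_le)
  define \<C> where "\<C> = {S. open S \<and> (\<exists>z\<in>K. \<forall>v\<in>K \<inter> S. f z < f v)}"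
  have cover: "K \<subseteq> \<Union>\<C>"
  proof
    fix x assume x: "x \<in> K"
    then obtain z where z: "z \<in> K" "f z < f x" using less by blast
    from lsc_onD[OF lsc x z(2)] obtain S where
      "open S" "x \<in> S" "\<forall>v\<in>S. v \<noteq> x \<longrightarrow> v \<in> K \<longrightarrow> f z < f v"
      unfolding eventually_at_topological by blast
    then have "S \<in> \<C>" unfolding \<C>_def using z by (intro CollectI conjI bexI[of _ z]) auto
    with \<open>x \<in> S\<close> show "x \<in> \<Union>\<C>" by blast
  qed
  obtain D where D: "D \<subseteq> \<C>" "finite D" "K \<subseteq> \<Union>D"
    by (rule compactE[OF K(1) cover]) (simp add: \<C>_def)
  have "\<exists>z. z \<in> K \<and> (\<forall>v\<in>K \<inter> S. f z < f v)" if "S \<in> D" for S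
    using subsetD[OF D(1) that] by (auto simp: \<C>_def)
  then obtain g where g: "\<And>S. S \<in> D \<Longrightarrow> g S \<in> K" "\<And>S v. S \<in> D \<Longrightarrow> v \<in> K \<inter> S \<Longrightarrow> f (g S) < f v"
    by metis
  have "D \<noteq> {}" using D(3) K(2) by auto
  define S0 where "S0 = arg_min_on (f \<circ> g) D"
  have S0: "S0 \<in> D" "\<And>S. S \<in> D \<Longrightarrow> f (g S0) \<le> f (g S)"
    using arg_min_if_finite(1)[OF D(2) \<open>D \<noteq> {}\<close>, of "f \<circ> g"]
      arg_min_least[OF D(2) \<open>D \<noteq> {}\<close>, of _ "f \<circ> g"] by (auto simp: S0_def)
  obtain S1 where "S1 \<in> D" "g S0 \<in> S1" using D(3) g(1)[OF S0(1)] by blast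
  then have "f (g S1) < f (g S0)" using g S0(1) by blast
  with S0(2)[OF \<open>S1 \<in> D\<close>] show False by simp
qed

lemma econvex_domain_convex:
  assumes V: "subspace V" and cvx: "econvex_on V J"
  shows "convex {v \<in> V. J v < \<infinity>}"
  unfolding convex_alt
proof (intro ballI allI impI)
  fix x y and u :: real
  assume xy: "x \<in> {v \<in> V. J v < \<infinity>}" "y \<in> {v \<in> V. J v < \<infinity>}" and u: "0 \<le> u \<and> u \<le> 1"
  show "(1 - u) *\<^sub>R x + u *\<^sub>R y \<in> {v \<in> V. J v < \<infinity>}"
  proof (cases "u = 0 \<or> u = 1")
    case False
    then have "J ((1 - u) *\<^sub>R x + u *\<^sub>R y) \<le> ereal (1 - u) * J x + ereal u * J y"
      using econvex_onD[OF cvx] xy u by auto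
    also have "\<dots> < \<infinity>" using xy u False by auto
    finally show ?thesis using V xy by (auto simp: subspace_add subspace_scale)
  qed (use xy in auto)
qed

text \<open>The function is bounded below on the unit ball around \<open>p\<close> by compactness, and convexity along the
  ray from \<open>p\<close> through \<open>v\<close> extrapolates this bound linearly. The bound plays the part of an
  affine minorant in making quadratic perturbations coercive.\<close>

lemma convex_lsc_linear_lower_bound:
  fixes J :: "'a::euclidean_space \<Rightarrow> ereal"
  assumes V: "subspace V" and proper: "proper_on V J" and lsc: "lsc_on V J" and cvx: "econvex_on V J"
    and p: "p \<in> V" "J p = ereal j"
  obtains C where "0 \<le> C" "\<And>v. v \<in> V \<Longrightarrow> ereal (- C * (1 + norm (v - p))) \<le> J v"
proof -
  have "compact (V \<inter> cball p 1)" using V by (simp add: closed_Int_compact closed_subspace)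
  moreover have "p \<in> V \<inter> cball p 1" using p by simp
  ultimately obtain x where x: "x \<in> V \<inter> cball p 1" "\<And>z. z \<in> V \<inter> cball p 1 \<Longrightarrow> J x \<le> J z"
    using lsc_on_attains_min[of "V \<inter> cball p 1" J] lsc_on_subset[OF lsc, of "V \<inter> cball p 1"] by blast
  have "J x \<noteq> -\<infinity>" using proper x by (auto simp: proper_on_def)
  moreover have "J x \<noteq> \<infinity>" using x(2)[OF \<open>p \<in> V \<inter> cball p 1\<close>] p(2) by auto
  ultimately obtain m where m: "J x = ereal m" by (cases "J x") auto
  show thesis
  proof (rule that)
    show "0 \<le> \<bar>m\<bar> + \<bar>j\<bar>" by simp
    fix v assume v: "v \<in> V"
    define r where "r = norm (v - p)"
    have "r \<ge> 0" by (simp add: r_def)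
    show "ereal (- (\<bar>m\<bar> + \<bar>j\<bar>) * (1 + norm (v - p))) \<le> J v"
    proof (cases "r \<le> 1")
      case True
      then have "ereal m \<le> J v" using x(2)[of v] v m by (simp add: r_def dist_norm norm_minus_commute)
      moreover have "- (\<bar>m\<bar> + \<bar>j\<bar>) * (1 + r) \<le> m"
      proof -
        have "0 \<le> (\<bar>m\<bar> + \<bar>j\<bar>) * r" using \<open>r \<ge> 0\<close> by simp
        then show ?thesis unfolding distrib_left mult_1_right by linarith
      qed
      ultimately show ?thesis unfolding r_def by (meson ereal_less_eq(3) order_trans)
    next
      case False
      define t where "t = 1 / r"
      have t: "0 < t" "t < 1" "t * r = 1" using False by (auto simp: t_def)
      define z where "z = (1 - t) *\<^sub>R p + t *\<^sub>R v"
      have "z - p = t *\<^sub>R (v - p)" by (simp add: z_def algebra_simps)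
      then have "norm (z - p) = 1" using t by (simp add: r_def)
      moreover have "z \<in> V" using V p v by (simp add: z_def subspace_add subspace_scale)
      ultimately have "ereal m \<le> J z"
        using x(2)[of z] m by (simp add: dist_norm norm_minus_commute)
      also have "J z \<le> ereal (1 - t) * J p + ereal t * J v"
        unfolding z_def using econvex_onD[OF cvx p(1) v] t by blast
      finally have le: "ereal m \<le> ereal (1 - t) * J p + ereal t * J v" .
      have "J v \<noteq> -\<infinity>" using proper v by (auto simp: proper_on_def)
      show ?thesis
      proof (cases "J v")
        case (real b)
        then have "m \<le> (1 - t) * j + t * b" using le p(2) by simp
        then have "r * m \<le> r * ((1 - t) * j + t * b)" using \<open>r \<ge> 0\<close> by (rule mult_left_mono)
        also have "\<dots> = (r - (t * r)) * j + (t * r) * b" by (simp add: algebra_simps)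
        also have "\<dots> = (r - 1) * j + b" using t by simp
        finally have "r * m - (r - 1) * j \<le> b" by simp
        moreover have "- r * \<bar>m\<bar> \<le> r * m" using \<open>r \<ge> 0\<close>
          using mult_left_mono[of "-\<bar>m\<bar>" m r] by simp
        moreover have "(r - 1) * j \<le> r * \<bar>j\<bar>"
        proof -
          have "(r - 1) * j \<le> (r - 1) * \<bar>j\<bar>" using False by (intro mult_left_mono) auto
          then show ?thesis by (simp add: algebra_simps)
        qed
        ultimately have "- (\<bar>m\<bar> + \<bar>j\<bar>) * (1 + r) \<le> b" by (simp add: algebra_simps)
        then show ?thesis by (simp add: real r_def)
      qed (use \<open>J v \<noteq> -\<infinity>\<close> in auto)
    qed
  qed
qed

text \<open>The identity for \<open>h\<close> describes exactly the quadratic functions with Hessian \<open>2 \<kappa> I\<close> and gradient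
  \<open>grad\<close>. The quadratic growth beats the linear lower bound of \<open>J\<close>, so that the search can be
  restricted to a ball.\<close>

lemma strongly_convex_attains_min:
  fixes J :: "'a::euclidean_space \<Rightarrow> ereal"
  assumes V: "subspace V" and proper: "proper_on V J" and lsc: "lsc_on V J" and cvx: "econvex_on V J"
    and K: "closed K" "K \<subseteq> V" and p: "p \<in> K" "J p < \<infinity>"
    and h: "\<And>u v. h v = h u + grad u \<bullet> (v - u) + \<kappa> * (norm (v - u))\<^sup>2" and \<kappa>: "0 < \<kappa>"
  shows "\<exists>v\<in>K. \<forall>z\<in>K. J v + ereal (h v) \<le> J z + ereal (h z)"
proof -
  have "J p \<noteq> -\<infinity>" using proper p K by (auto simp: proper_on_def)
  then obtain j where j: "J p = ereal j" using p by (cases "J p") auto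
  obtain C where C: "0 \<le> C" "\<And>v. v \<in> V \<Longrightarrow> ereal (- C * (1 + norm (v - p))) \<le> J v"
    using convex_lsc_linear_lower_bound[OF V proper lsc cvx _ j] p K by blast
  define M where "M = 2 * C + \<bar>j\<bar> + norm (grad p)"
  \<comment> \<open>At distance \<open>r > R\<close> from \<open>p\<close> the quadratic term exceeds \<open>M r\<close>, and this is more than
    the linear losses and the value at \<open>p\<close> together, as \<open>r \<ge> 1\<close>.\<close>
  define R where "R = 1 + M / \<kappa>"
  have "0 \<le> M" using C by (simp add: M_def)
  then have R1: "1 \<le> R" using \<kappa> by (simp add: R_def)
  define K' where "K' = K \<inter> cball p R"
  have K': "compact K'" "p \<in> K'" "K' \<subseteq> V"
    using K p R1 by (auto simp: K'_def closed_Int_compact)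
  have h_eq: "h = (\<lambda>v. h p + grad p \<bullet> (v - p) + \<kappa> * (norm (v - p))\<^sup>2)"
    by (rule ext) (rule h)
  have "continuous_on V h"
    by (subst h_eq) (intro continuous_intros)
  then have "lsc_on K' (\<lambda>v. J v + ereal (h v))"
    using lsc_on_subset[OF lsc_on_add_continuous[OF lsc]] K' by blast
  then obtain v where v: "v \<in> K'" "\<And>z. z \<in> K' \<Longrightarrow> J v + ereal (h v) \<le> J z + ereal (h z)"
    using lsc_on_attains_min[OF K'(1)] K'(2) by blast
  have "J v + ereal (h v) \<le> J z + ereal (h z)" if z: "z \<in> K" for z
  proof (cases "z \<in> K'")
    case False
    define r where "r = norm (z - p)"
    have r: "R < r" using False z by (auto simp: K'_def r_def dist_norm norm_minus_commute)
    have "\<kappa> * R = \<kappa> + M" using \<kappa> by (simp add: R_def algebra_simps)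
    moreover have "\<kappa> * R \<le> \<kappa> * r" using r \<kappa> by simp
    ultimately have "M \<le> \<kappa> * r" using \<kappa> by simp
    then have "M * r \<le> \<kappa> * r * r" using r R1 by (intro mult_right_mono) auto
    moreover have "2 * C * 1 \<le> 2 * C * r" using C r R1 by (intro mult_left_mono) auto
    moreover have "\<bar>j\<bar> * 1 \<le> \<bar>j\<bar> * r" using r R1 by (intro mult_left_mono) auto
    moreover have "- (norm (grad p) * r) \<le> grad p \<bullet> (z - p)"
      using Cauchy_Schwarz_ineq2[of "grad p" "z - p"] by (auto simp: r_def)
    moreover have "h z = h p + grad p \<bullet> (z - p) + \<kappa> * r * r"
      by (subst h[of z p]) (simp add: r_def power2_eq_square)
    moreover have "C * 1 \<le> C * r" using C r R1 by (intro mult_left_mono) auto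
    ultimately have "j + h p \<le> - C * (1 + r) + h z"
      by (simp add: M_def algebra_simps)
    then have "J p + ereal (h p) \<le> ereal (- C * (1 + r)) + ereal (h z)" by (simp add: j)
    also have "\<dots> \<le> J z + ereal (h z)"
      using C(2)[of z] z K by (intro add_right_mono) (auto simp: r_def)
    finally show ?thesis using v(2)[OF K'(2)] by simp
  qed (use v in blast)
  then show ?thesis using v(1) by (auto simp: K'_def)
qed

text \<open>Moving from \<open>v\<close> towards \<open>z\<close> by a step \<open>t\<close> changes the quadratic part by
  \<open>t (grad v \<bullet> (z - v)) + O(t^2)\<close>; division by \<open>t\<close> and \<open>t \<rightarrow> 0\<close> leave the first order condition.\<close>

lemma minimizer_linearized:
  fixes J :: "'a::real_inner \<Rightarrow> ereal"
  assumes cvx: "econvex_on V J" and K: "convex K" "K \<subseteq> V"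
    and h: "\<And>u v. h v = h u + grad u \<bullet> (v - u) + \<kappa> * (norm (v - u))\<^sup>2"
    and v: "v \<in> K" "J v = ereal j"
    and min: "\<And>z. z \<in> K \<Longrightarrow> J v + ereal (h v) \<le> J z + ereal (h z)"
    and z: "z \<in> K"
  shows "J v \<le> J z + ereal (grad v \<bullet> (z - v))"
proof (cases "J z")
  case (real b)
  define N where "N = \<kappa> * (norm (z - v))\<^sup>2"
  have step: "0 \<le> b - j + grad v \<bullet> (z - v) + t * N" if t: "0 < t" "t < 1" for t
  proof -
    define y where "y = (1 - t) *\<^sub>R v + t *\<^sub>R z"
    have yv: "y - v = t *\<^sub>R (z - v)" by (simp add: y_def algebra_simps)
    have "y \<in> K" unfolding y_def using K v z t by (intro convexD) auto
    then have "J v + ereal (h v) \<le> J y + ereal (h y)" by (rule min)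
    also have "J y \<le> ereal (1 - t) * J v + ereal t * J z"
      unfolding y_def using econvex_onD[OF cvx] v(1) z K(2) t by blast
    finally have "j + h v \<le> (1 - t) * j + t * b + h y" by (simp add: real v add_right_mono)
    moreover have "h y = h v + t * (grad v \<bullet> (z - v)) + t * (t * N)"
      using h[of y v] t unfolding yv N_def
      by (simp only: norm_scaleR inner_scaleR_right abs_of_pos power_mult_distrib) (simp add: power2_eq_square)
    ultimately have "0 \<le> t * (b - j + grad v \<bullet> (z - v) + t * N)" by (simp add: algebra_simps)
    then show ?thesis using t by (simp add: zero_le_mult_iff)
  qed
  have "((\<lambda>t. b - j + grad v \<bullet> (z - v) + t * N) \<longlongrightarrow> b - j + grad v \<bullet> (z - v) + 0 * N) (at_right 0)"
    by (intro tendsto_intros)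
  moreover have "\<forall>\<^sub>F t in at_right 0. 0 \<le> b - j + grad v \<bullet> (z - v) + t * N"
    using step eventually_at_right_less[of "0::real"]
    by (auto simp: eventually_at_right_field intro: exI[of _ 1])
  ultimately have "0 \<le> b - j + grad v \<bullet> (z - v) + 0 * N"
    by (intro tendsto_lowerbound[where F = "at_right (0::real)"]) auto
  then show ?thesis by (simp add: real v)
next
  case MInf
  then show ?thesis using min[OF z] v by simp
qed simp

text \<open>This is the sum rule for the subdifferentials of \<open>J\<close> and of the indicator function of \<open>K\<close>. The
  epigraph of \<open>J\<close> plus the linear term is separated from the hypograph of the indicator function,
  that is, \<open>0\<close> is separated from the set \<open>S\<close> of differences. Taking the separating vector in the
  span of \<open>S\<close> is what rules out a vertical hyperplane: such a vector would be constant on the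
  domain of \<open>J\<close> and on \<open>K\<close> because of the common relative interior point \<open>p\<close>, hence orthogonal to
  its own span.\<close>

lemma subdifferential_normal_cone_decomposition:
  fixes J :: "'a::euclidean_space \<Rightarrow> ereal"
  assumes V: "subspace V" and proper: "proper_on V J" and cvx: "econvex_on V J"
    and K: "convex K" "K \<subseteq> V"
    and p: "p \<in> rel_interior K" "p \<in> rel_interior {v \<in> V. J v < \<infinity>}"
    and v: "v \<in> K" "J v = ereal j" and d: "d \<in> V"
    and min: "\<And>z. z \<in> K \<Longrightarrow> J v \<le> J z + ereal (d \<bullet> (z - v))"
  shows "\<exists>g\<in>subdifferential V J v. \<exists>n\<in>normal_cone V K v. g + n + d = 0"
proof -
  define S where "S = {(z - z', t) | z z' t. z \<in> V \<and> z' \<in> K \<and> J z + ereal (d \<bullet> (z - v)) < ereal (t + j)}"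
  have fin: "\<exists>b. J z = ereal b \<and> b + d \<bullet> (z - v) < t + j"
    if "z \<in> V" "J z + ereal (d \<bullet> (z - v)) < ereal (t + j)" for z t
    using proper that by (cases "J z") (auto simp: proper_on_def)
  note dom_convex = econvex_domain_convex[OF V cvx]
  have "convex S"
    unfolding convex_alt
  proof (intro ballI allI impI)
    fix x y and u :: real
    assume xy: "x \<in> S" "y \<in> S" and u: "0 \<le> u \<and> u \<le> 1"
    show "(1 - u) *\<^sub>R x + u *\<^sub>R y \<in> S"
    proof (cases "u = 0 \<or> u = 1")
      case False
      then have u: "0 < u" "u < 1" using u by auto
      from xy(1) obtain z1 z1' t1 where 1: "x = (z1 - z1', t1)" "z1 \<in> V" "z1' \<in> K"
        "J z1 + ereal (d \<bullet> (z1 - v)) < ereal (t1 + j)" unfolding S_def by blast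
      from xy(2) obtain z2 z2' t2 where 2: "y = (z2 - z2', t2)" "z2 \<in> V" "z2' \<in> K"
        "J z2 + ereal (d \<bullet> (z2 - v)) < ereal (t2 + j)" unfolding S_def by blast
      obtain b1 b2 where b: "J z1 = ereal b1" "b1 + d \<bullet> (z1 - v) < t1 + j"
          "J z2 = ereal b2" "b2 + d \<bullet> (z2 - v) < t2 + j"
        using fin 1 2 by metis
      define z where "z = (1 - u) *\<^sub>R z1 + u *\<^sub>R z2"
      define z' where "z' = (1 - u) *\<^sub>R z1' + u *\<^sub>R z2'"
      have "z \<in> V" using V 1 2 by (simp add: z_def subspace_add subspace_scale)
      have "z' \<in> K" unfolding z'_def using K 1 2 u by (intro convexD) auto
      have "J z \<le> ereal (1 - u) * J z1 + ereal u * J z2"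
        unfolding z_def using econvex_onD[OF cvx] 1 2 u by blast
      then have "J z \<le> ereal ((1 - u) * b1 + u * b2)" by (simp add: b)
      then have "J z + ereal (d \<bullet> (z - v)) \<le> ereal ((1 - u) * b1 + u * b2) + ereal (d \<bullet> (z - v))"
        by (rule add_right_mono)
      also have "\<dots> = ereal ((1 - u) * (b1 + d \<bullet> (z1 - v)) + u * (b2 + d \<bullet> (z2 - v)))"
        by (simp add: z_def inner_simps algebra_simps)
      also have "\<dots> < ereal ((1 - u) * (t1 + j) + u * (t2 + j))"
        using b u by (simp add: add_strict_mono)
      also have "\<dots> = ereal ((1 - u) * t1 + u * t2 + j)" by (simp add: algebra_simps)
      finally have "(z - z', (1 - u) * t1 + u * t2) \<in> S"
        unfolding S_def using \<open>z \<in> V\<close> \<open>z' \<in> K\<close> by blast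
      moreover have "(1 - u) *\<^sub>R x + u *\<^sub>R y = (z - z', (1 - u) * t1 + u * t2)"
        by (simp add: 1 2 z_def z'_def algebra_simps)
      ultimately show ?thesis by simp
    qed (use xy in auto)
  qed
  have vV: "v \<in> V" using v K by blast
  have "(v - v, 1) \<in> S"
    unfolding S_def using v vV by (intro CollectI exI[of _ v] exI[of _ 1]) simp
  then have "S \<noteq> {}" by blast
  have "0 \<notin> S"
    using min v by (force simp: S_def zero_prod_def not_less[symmetric])
  obtain a where a: "a \<in> span S" "a \<noteq> 0" "\<And>x. x \<in> S \<Longrightarrow> 0 \<le> a \<bullet> x"
    using separating_hyperplane_set_0_inspan[OF \<open>convex S\<close> \<open>S \<noteq> {}\<close> \<open>0 \<notin> S\<close>] by blast
  obtain \<alpha> \<beta> where ab: "a = (\<alpha>, \<beta>)" by (cases a)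
  have "S \<subseteq> V \<times> UNIV" using V K by (auto simp: S_def intro!: subspace_diff)
  then have "span S \<subseteq> V \<times> UNIV" by (intro span_minimal subspace_Times V subspace_UNIV)
  then have \<alpha>V: "\<alpha> \<in> V" using a ab by auto
  have sep: "0 \<le> \<alpha> \<bullet> (z - z') + \<beta> * t"
    if "z \<in> V" "z' \<in> K" "J z + ereal (d \<bullet> (z - v)) < ereal (t + j)" for z z' t
  proof -
    have "(z - z', t) \<in> S" using that unfolding S_def by blast
    then show ?thesis using a(3) ab by fastforce
  qed
  have "0 \<le> \<beta>" using sep[of v v 1] v vV by simp
  \<comment> \<open>The hyperplane is not vertical.\<close>
  have "\<beta> \<noteq> 0"
  proof
    assume \<beta>: "\<beta> = 0"
    define D where "D = {v \<in> V. J v < \<infinity>}"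
    have le: "0 \<le> \<alpha> \<bullet> (z - z')" if z: "z \<in> D" "z' \<in> K" for z z'
    proof -
      have "\<exists>t. J z + ereal (d \<bullet> (z - v)) < ereal (t + j)"
      proof (cases "J z")
        case (real b)
        then show ?thesis by (intro exI[of _ "b + d \<bullet> (z - v) - j + 1"]) simp
      qed (use z proper in \<open>auto simp: D_def proper_on_def\<close>)
      then show ?thesis using sep[of z z'] z \<beta> by (auto simp: D_def)
    qed
    have pD: "p \<in> D" and pK: "p \<in> K" using p rel_interior_subset by (auto simp: D_def)
    have D0: "\<alpha> \<bullet> (z - p) = 0" if z: "z \<in> D" for z
    proof -
      obtain e where e: "1 < e" "(1 - e) *\<^sub>R z + e *\<^sub>R p \<in> D"
        using convex_rel_interior_iff[of D p] dom_convex p(2) z unfolding D_def by blast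
      have "0 \<le> \<alpha> \<bullet> (((1 - e) *\<^sub>R z + e *\<^sub>R p) - p)" using le e pK by blast
      also have "((1 - e) *\<^sub>R z + e *\<^sub>R p) - p = (1 - e) *\<^sub>R (z - p)" by (simp add: algebra_simps)
      finally have "\<alpha> \<bullet> (z - p) \<le> 0" using e by (simp add: zero_le_mult_iff)
      with le[OF z pK] show ?thesis by simp
    qed
    have K0: "\<alpha> \<bullet> (z - p) = 0" if z: "z \<in> K" for z
    proof -
      obtain e where e: "1 < e" "(1 - e) *\<^sub>R z + e *\<^sub>R p \<in> K"
        using convex_rel_interior_iff[of K p] K p(1) z by blast
      have "0 \<le> \<alpha> \<bullet> (p - ((1 - e) *\<^sub>R z + e *\<^sub>R p))" using le e pD by blast
      also have "p - ((1 - e) *\<^sub>R z + e *\<^sub>R p) = (e - 1) *\<^sub>R (z - p)" by (simp add: algebra_simps)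
      finally have "0 \<le> \<alpha> \<bullet> (z - p)" using e by (simp add: zero_le_mult_iff)
      with le[OF pD z] show ?thesis by (simp add: inner_simps)
    qed
    have "S \<subseteq> {x. a \<bullet> x = 0}"
    proof
      fix x assume "x \<in> S"
      then obtain z z' t where x: "x = (z - z', t)" "z \<in> V" "z' \<in> K"
        "J z + ereal (d \<bullet> (z - v)) < ereal (t + j)" unfolding S_def by blast
      then have "z \<in> D" using fin by (fastforce simp: D_def)
      then have "\<alpha> \<bullet> (z - z') = 0" using D0[of z] K0[of z'] x by (simp add: inner_simps)
      then show "x \<in> {x. a \<bullet> x = 0}" by (simp add: x ab \<beta>)
    qed
    then have "span S \<subseteq> {x. a \<bullet> x = 0}" by (intro span_minimal subspace_hyperplane)
    with a show False by auto
  qed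
  with \<open>0 \<le> \<beta>\<close> have \<beta>: "0 < \<beta>" by simp
  define n where "n = (1 / \<beta>) *\<^sub>R \<alpha>"
  have nV: "n \<in> V" using V \<alpha>V by (simp add: n_def subspace_scale)
  have sep': "0 \<le> n \<bullet> (z - z') + b + d \<bullet> (z - v) - j"
    if "z \<in> V" "z' \<in> K" "J z = ereal b" for z z' b
  proof (rule field_le_epsilon)
    fix e :: real assume "0 < e"
    then have "0 \<le> \<alpha> \<bullet> (z - z') + \<beta> * (b + d \<bullet> (z - v) - j + e)"
      using that by (intro sep) auto
    then have "0 \<le> (1 / \<beta>) * (\<alpha> \<bullet> (z - z') + \<beta> * (b + d \<bullet> (z - v) - j + e))"
      using \<beta> by simp
    also have "\<dots> = n \<bullet> (z - z') + b + d \<bullet> (z - v) - j + e"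
      using \<beta> by (simp add: n_def field_simps)
    finally show "0 \<le> n \<bullet> (z - z') + b + d \<bullet> (z - v) - j + e" .
  qed
  have "n \<in> normal_cone V K v"
    using sep'[of v _ j] nV v vV by (auto simp: normal_cone_def inner_simps)
  moreover have "- (d + n) \<in> subdifferential V J v"
  proof -
    have "ereal j + ereal (- (d + n) \<bullet> (z - v)) \<le> J z" if z: "z \<in> V" for z
    proof (cases "J z")
      case (real b)
      then show ?thesis using sep'[OF z v(1) real] by (simp add: inner_simps)
    qed (use z proper in \<open>auto simp: proper_on_def\<close>)
    then show ?thesis
      using V d nV by (auto simp: subdifferential_def v subspace_add subspace_neg simp del: minus_add_distrib)
  qed
  ultimately show ?thesis by (intro bexI[of _ "- (d + n)"] bexI[of _ n]) auto
qed

text \<open>The optimality condition of the players' minimization, stated for the Hilbert choice \<open>arg_min\<close>,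
  whose value is meaningful only because a minimizer exists.\<close>

lemma proximal_step_inclusion:
  fixes J :: "'a::euclidean_space \<Rightarrow> ereal"
  assumes V: "subspace V" and proper: "proper_on V J" and lsc: "lsc_on V J" and cvx: "econvex_on V J"
    and K: "closed K" "convex K" "K \<subseteq> V"
    and p: "p \<in> rel_interior K" "p \<in> rel_interior {v \<in> V. J v < \<infinity>}"
    and h: "\<And>u v. h v = h u + grad u \<bullet> (v - u) + \<kappa> * (norm (v - u))\<^sup>2" and \<kappa>: "0 < \<kappa>"
    and grad: "\<And>v. v \<in> V \<Longrightarrow> grad v \<in> V"
    and v: "v = arg_min (\<lambda>v. J v + ereal (h v)) (\<lambda>v. v \<in> K)"
  shows "v \<in> K" and "\<exists>g\<in>subdifferential V J v. \<exists>n\<in>normal_cone V K v. g + n + grad v = 0"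
proof -
  have pK: "p \<in> K" "J p < \<infinity>" using p rel_interior_subset by auto
  have "\<exists>v\<in>K. \<forall>z\<in>K. J v + ereal (h v) \<le> J z + ereal (h z)"
    by (rule strongly_convex_attains_min[OF V proper lsc cvx K(1,3) pK h \<kappa>])
  then have "\<exists>v. is_arg_min (\<lambda>v. J v + ereal (h v)) (\<lambda>v. v \<in> K) v"
    by (auto simp: is_arg_min_def not_less)
  then have "is_arg_min (\<lambda>v. J v + ereal (h v)) (\<lambda>v. v \<in> K) v"
    unfolding v arg_min_def by (rule someI_ex)
  then have "v \<in> K" and min: "\<And>z. z \<in> K \<Longrightarrow> J v + ereal (h v) \<le> J z + ereal (h z)"
    by (auto simp: is_arg_min_def not_less)
  show "v \<in> K" by fact
  have vV: "v \<in> V" using \<open>v \<in> K\<close> K by blast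
  have "J v + ereal (h v) \<le> J p + ereal (h p)" using min pK by blast
  then have "J v \<noteq> \<infinity>" using pK by (cases "J p") auto
  moreover have "J v \<noteq> -\<infinity>" using proper vV by (auto simp: proper_on_def)
  ultimately obtain j where j: "J v = ereal j" by (cases "J v") auto
  show "\<exists>g\<in>subdifferential V J v. \<exists>n\<in>normal_cone V K v. g + n + grad v = 0"
    by (rule subdifferential_normal_cone_decomposition[OF V proper cvx K(2,3) p \<open>v \<in> K\<close> j grad[OF vV]])
       (rule minimizer_linearized[OF cvx K(2,3) h \<open>v \<in> K\<close> j min])
qed

lemma proximal_point_exists:
  fixes J :: "'a::euclidean_space \<Rightarrow> ereal"
  assumes V: "subspace V" and proper: "proper_on V J" and lsc: "lsc_on V J" and cvx: "econvex_on V J"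
    and q: "q \<in> V" and t: "0 < t"
  shows "\<exists>v\<in>V. (1 / t) *\<^sub>R (q - v) \<in> subdifferential V J v"
proof -
  have "{v \<in> V. J v < \<infinity>} \<noteq> {}" using proper by (auto simp: proper_on_def)
  then obtain p where p: "p \<in> rel_interior {v \<in> V. J v < \<infinity>}"
    using rel_interior_eq_empty[OF econvex_domain_convex[OF V cvx]] by blast
  then have "p \<in> V" using rel_interior_subset by blast
  then have pV: "p \<in> rel_interior V"
    using V by (simp add: affine_rel_open rel_open_def[symmetric] subspace_imp_affine
        rel_open_def[THEN iffD1])
  define h where "h v = 1 / (2 * t) * (norm (v - q))\<^sup>2" for v
  define grad where "grad u = (1 / t) *\<^sub>R (u - q)" for u
  have h: "h v = h u + grad u \<bullet> (v - u) + 1 / (2 * t) * (norm (v - u))\<^sup>2" for u v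
  proof -
    have sq: "(norm (a + b))\<^sup>2 = (norm a)\<^sup>2 + 2 * (b \<bullet> a) + (norm b)\<^sup>2" for a b :: 'a
      by (simp add: power2_norm_eq_inner inner_add_left inner_add_right inner_commute[of a b])
    show ?thesis
      using sq[of "v - u" "u - q"] t unfolding h_def grad_def inner_scaleR_left
      by (simp add: divide_simps)
  qed
  have gradV: "grad v \<in> V" if "v \<in> V" for v
    using V q that by (simp add: grad_def subspace_diff subspace_scale)
  define v where "v = arg_min (\<lambda>v. J v + ereal (h v)) (\<lambda>v. v \<in> V)"
  note step = proximal_step_inclusion[OF V proper lsc cvx closed_subspace[OF V]
      subspace_imp_convex[OF V] order_refl pV p h _ gradV v_def]
  have vV: "v \<in> V" using step(1) t by simp
  obtain g n where g: "g \<in> subdifferential V J v" and n: "n \<in> normal_cone V V v"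
    and eq: "g + n + grad v = 0" using step(2) t by auto
  have "n \<in> V" using n by (simp add: normal_cone_def)
  then have "v + n \<in> V" using V vV by (simp add: subspace_add)
  then have "n \<bullet> n \<le> 0" using n by (auto simp: normal_cone_def)
  then have "n = 0" by (metis inner_gt_zero_iff not_le)
  then have "g = (1 / t) *\<^sub>R (q - v)" using eq by (simp add: grad_def algebra_simps add_eq_0_iff)
  then show ?thesis using g vV by blast
qed

text \<open>Dividing the quadratic inequality by \<open>s\<^sup>2\<close> shows that \<open>s\<close> can stay above \<open>e\<close> only for steps \<open>t\<close>
  that are bounded away from \<open>0\<close>. Both density arguments below use this to show that proximal points
  with small steps are close to their centre.\<close>

lemma inverse_step_bound:
  fixes s t e :: real
  assumes "0 < e" "e \<le> s" "0 < t" "0 \<le> a" "0 \<le> b" "0 \<le> c" and "s\<^sup>2 / t \<le> a + b * s + c * s\<^sup>2"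
  shows "1 / t \<le> a / e\<^sup>2 + b / e + c"
proof -
  have s: "0 < s" using assms by simp
  have "1 / t = (s\<^sup>2 / t) / s\<^sup>2" using s by simp
  also have "\<dots> \<le> (a + b * s + c * s\<^sup>2) / s\<^sup>2" using assms by (intro divide_right_mono) auto
  also have "\<dots> = a / s\<^sup>2 + b / s + c" using s by (simp add: field_simps power2_eq_square)
  also have "\<dots> \<le> a / e\<^sup>2 + b / e + c"
    using assms s by (intro add_mono divide_left_mono power_mono mult_pos_pos) auto
  finally show ?thesis .
qed

lemma small_step_near:
  fixes s :: "real \<Rightarrow> real"
  assumes "0 < e" "0 \<le> a" "0 \<le> b" "0 \<le> c"
    and s: "\<And>t. 0 < t \<Longrightarrow> (s t)\<^sup>2 / t \<le> a + b * s t + c * (s t)\<^sup>2"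
  shows "\<exists>t>0. s t < e"
proof (rule ccontr)
  assume "\<not> ?thesis"
  then have le: "e \<le> s t" if "0 < t" for t using that by (meson not_less)
  define M where "M = a / e\<^sup>2 + b / e + c"
  have "0 \<le> M" using assms by (simp add: M_def)
  then have t: "0 < 1 / (M + 1)" by simp
  have "1 / (1 / (M + 1)) \<le> M"
    unfolding M_def by (rule inverse_step_bound[OF assms(1) le _ assms(2-4) s]) (use t in \<open>simp_all add: M_def\<close>)
  then show False by simp
qed

lemma subdifferential_finite:
  assumes "g \<in> subdifferential V J v"
  obtains j where "J v = ereal j" "\<And>z. z \<in> V \<Longrightarrow> ereal (j + g \<bullet> (z - v)) \<le> J z"
  using assms by (cases "J v") (auto simp: subdifferential_def)

text \<open>The proximal point of \<open>q\<close> with step \<open>t\<close> has a subgradient and tends to \<open>q\<close> as \<open>t \<rightarrow> 0\<close>: a single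
  subgradient, at some \<open>v1\<close>, bounds \<open>J\<close> from below by an affine function, and so prevents the
  proximal points from staying away from \<open>q\<close>.\<close>

lemma subdifferentiable_dense:
  fixes J :: "'a::euclidean_space \<Rightarrow> ereal"
  assumes V: "subspace V" and proper: "proper_on V J" and lsc: "lsc_on V J" and cvx: "econvex_on V J"
    and q: "q \<in> V" "J q < \<infinity>" and e: "0 < e"
  shows "\<exists>v\<in>V. subdifferential V J v \<noteq> {} \<and> norm (q - v) < e"
proof -
  have "J q \<noteq> -\<infinity>" using proper q by (auto simp: proper_on_def)
  then obtain jq where jq: "J q = ereal jq" using q by (cases "J q") auto
  obtain v1 g1 where "g1 \<in> subdifferential V J v1"
    using proximal_point_exists[OF V proper lsc cvx q(1), of 1] by auto
  then obtain j1 where j1: "\<And>z. z \<in> V \<Longrightarrow> ereal (j1 + g1 \<bullet> (z - v1)) \<le> J z"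
    by (rule subdifferential_finite) blast
  obtain prox where prox: "\<And>t. 0 < t \<Longrightarrow> prox t \<in> V"
      "\<And>t. 0 < t \<Longrightarrow> (1 / t) *\<^sub>R (q - prox t) \<in> subdifferential V J (prox t)"
    using proximal_point_exists[OF V proper lsc cvx q(1)] by metis
  have "\<exists>t>0. norm (q - prox t) < e"
  proof (rule small_step_near[OF e, of "\<bar>jq - j1 - g1 \<bullet> (q - v1)\<bar>" "norm g1" 0])
    fix t :: real assume t: "0 < t"
    define s where "s = norm (q - prox t)"
    obtain jt where jt: "J (prox t) = ereal jt"
      "\<And>z. z \<in> V \<Longrightarrow> ereal (jt + ((1 / t) *\<^sub>R (q - prox t)) \<bullet> (z - prox t)) \<le> J z"
      using prox(2)[OF t] by (rule subdifferential_finite) blast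
    have "jt + s\<^sup>2 / t \<le> jq"
      using jt(2)[OF q(1)] by (simp add: jq s_def power2_norm_eq_inner)
    moreover have "j1 + g1 \<bullet> (prox t - v1) \<le> jt" using j1[OF prox(1)[OF t]] by (simp add: jt)
    moreover have "g1 \<bullet> (prox t - v1) = g1 \<bullet> (q - v1) - g1 \<bullet> (q - prox t)" by (simp add: inner_simps)
    moreover have "g1 \<bullet> (q - prox t) \<le> norm g1 * s" unfolding s_def by (rule norm_cauchy_schwarz)
    ultimately have "s\<^sup>2 / t \<le> \<bar>jq - j1 - g1 \<bullet> (q - v1)\<bar> + norm g1 * s" by linarith
    then show "(norm (q - prox t))\<^sup>2 / t \<le>
        \<bar>jq - j1 - g1 \<bullet> (q - v1)\<bar> + norm g1 * norm (q - prox t) + 0 * (norm (q - prox t))\<^sup>2"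
      by (simp add: s_def)
  qed auto
  then show ?thesis using prox by blast
qed

section \<open>Preconditioned Douglas--Rachford iteration\<close>

text \<open>The quadratic form attains a positive minimum on the unit sphere.\<close>

lemma positive_definite_coercive:
  fixes Phi :: "'a::euclidean_space \<Rightarrow> 'a"
  assumes lin: "linear Phi" and pd: "\<And>x. x \<noteq> 0 \<Longrightarrow> 0 < Phi x \<bullet> x"
  obtains c where "0 < c" and "\<And>x. c * (norm x)\<^sup>2 \<le> Phi x \<bullet> x"
proof -
  have cont: "continuous_on (sphere 0 1) (\<lambda>x. Phi x \<bullet> x)"
    by (intro continuous_intros linear_continuous_on linear_conv_bounded_linear[THEN iffD1] lin)
  obtain b :: 'a where "b \<in> Basis" using nonempty_Basis by blast
  then have "sphere (0::'a) 1 \<noteq> {}" by auto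
  then obtain u where u: "u \<in> sphere 0 1" and min: "\<And>x. x \<in> sphere 0 1 \<Longrightarrow> Phi u \<bullet> u \<le> Phi x \<bullet> x"
    using continuous_attains_inf[OF compact_sphere _ cont] by blast
  show thesis
  proof (rule that)
    show "0 < Phi u \<bullet> u" using u by (intro pd) auto
    fix x :: 'a
    show "(Phi u \<bullet> u) * (norm x)\<^sup>2 \<le> Phi x \<bullet> x"
    proof (cases "x = 0")
      case False
      define e where "e = x /\<^sub>R norm x"
      have x: "x = norm x *\<^sub>R e" using False by (simp add: e_def)
      have "Phi u \<bullet> u \<le> Phi e \<bullet> e" using False by (intro min) (simp add: e_def)
      moreover have "Phi x \<bullet> x = (norm x)\<^sup>2 * (Phi e \<bullet> e)"
        by (subst (1 2) x) (simp add: linear_scale[OF lin] power2_eq_square)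
      ultimately show ?thesis by (simp add: mult.commute[of _ "(norm x)\<^sup>2"] mult_left_mono)
    qed (simp add: linear_0[OF lin])
  qed
qed

text \<open>Here \<open>x\<close>, \<open>w\<close>, \<open>u\<close> stand for differences of two iterates, of their \<open>A\<close>-resolvents and of the
  \<open>B\<close>-resolvents at the reflected points, and the hypotheses are the monotonicity of \<open>A\<close> and \<open>B\<close>.
  The difference of the two sides of the conclusion is exactly twice the sum of the hypotheses.\<close>

lemma douglas_rachford_firm:
  fixes Phi :: "'a::real_inner \<Rightarrow> 'a"
  assumes lin: "linear Phi" and sym: "\<And>x y. Phi x \<bullet> y = x \<bullet> Phi y"
    and A: "0 \<le> Phi (x - w) \<bullet> w" and B: "0 \<le> Phi (2 *\<^sub>R w - x - u) \<bullet> u"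
  shows "Phi (x + u - w) \<bullet> (x + u - w) + Phi (w - u) \<bullet> (w - u) \<le> Phi x \<bullet> x"
proof -
  have c: "Phi a \<bullet> b = Phi b \<bullet> a" for a b by (metis sym inner_commute)
  show ?thesis
    using A B
    by (simp add: linear_add[OF lin] linear_diff[OF lin] linear_scale[OF lin] inner_simps
        c[of u x] c[of w x] c[of u w])
qed

lemma resolvent_nonexpansive:
  fixes Phi :: "'a::real_inner \<Rightarrow> 'a"
  assumes lin: "linear Phi" and sym: "\<And>x y. Phi x \<bullet> y = x \<bullet> Phi y"
    and psd: "\<And>x. 0 \<le> Phi x \<bullet> x"
    and A: "0 \<le> Phi (x - w) \<bullet> w"
  shows "Phi w \<bullet> w \<le> Phi x \<bullet> x"
proof -
  have c: "Phi a \<bullet> b = Phi b \<bullet> a" for a b by (metis sym inner_commute)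
  show ?thesis
    using A psd[of "x - w"]
    by (simp add: linear_add[OF lin] linear_diff[OF lin] inner_simps c[of w x])
qed

text \<open>The iteration acts on states \<open>s\<close> that are seen only through their encoding \<open>enc s\<close>; the points
  \<open>W s\<close> and \<open>U s\<close> are the two resolvents. Different states may have the same encoding. As the set of
  encodings is closed, a limit point \<open>x\<close> is the encoding of some state \<open>t\<close>, so that the resolvents
  exist at \<open>x\<close> as well; there they depend continuously on the point, because monotonicity
  makes them nonexpansive.

  A zero of \<open>A + B\<close> yields a fixed point of the iteration, to which the encodings stay within a
  bounded distance, and the differences \<open>W - U\<close> tend to \<open>0\<close>. Hence a limit point \<open>x\<close> is again a fixed
  point, and the distance to \<open>x\<close>, being nonincreasing and small along a subsequence, tends to \<open>0\<close>.\<close>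

theorem douglas_rachford_convergence:
  fixes Phi :: "'a::euclidean_space \<Rightarrow> 'a"
    and enc W U :: "'s \<Rightarrow> 'a" and step :: "'s \<Rightarrow> 's"
  assumes lin: "linear Phi" and sym: "\<And>x y. Phi x \<bullet> y = x \<bullet> Phi y"
    and pd: "\<And>x. x \<noteq> 0 \<Longrightarrow> 0 < Phi x \<bullet> x"
    and monA: "monotone_op A" and monB: "monotone_op B"
    and closed_enc: "closed (range enc)"
    and resA: "\<And>s. Phi (enc s - W s) \<in> A (W s)"
    and resB: "\<And>s. Phi (2 *\<^sub>R W s - enc s - U s) \<in> B (U s)"
    and step: "\<And>s. enc (step s) = enc s + U s - W s"
    and zero: "\<exists>w. \<exists>a\<in>A w. - a \<in> B w"
  shows "\<exists>w. (\<exists>a\<in>A w. - a \<in> B w) \<and> (\<lambda>k. W ((step ^^ k) s0)) \<longlonglongrightarrow> w"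
proof -
  define n where "n x = Phi x \<bullet> x" for x
  have n_nonneg: "0 \<le> n x" for x
    using pd[of x] by (cases "x = 0") (auto simp: n_def linear_0[OF lin] less_imp_le)
  obtain c where c: "0 < c" and coercive: "\<And>x. c * (norm x)\<^sup>2 \<le> n x"
    using positive_definite_coercive[OF lin pd] unfolding n_def by blast
  have Phi_tendsto: "((\<lambda>k. Phi (f k)) \<longlongrightarrow> Phi l) F" if "(f \<longlongrightarrow> l) F" for f :: "nat \<Rightarrow> 'a" and l F
    using bounded_linear.tendsto[OF linear_conv_bounded_linear[THEN iffD1, OF lin] that] .
  have n_tendsto: "((\<lambda>k. n (f k)) \<longlongrightarrow> n l) F" if "(f \<longlongrightarrow> l) F" for f :: "nat \<Rightarrow> 'a" and l F
    unfolding n_def by (intro tendsto_inner Phi_tendsto that)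
  have n_0: "n 0 = 0" by (simp add: n_def)
  have n_convergence: "f \<longlonglongrightarrow> l" if lim: "(\<lambda>k. n (f k - l)) \<longlonglongrightarrow> 0" for f :: "nat \<Rightarrow> 'a" and l
  proof -
    have le: "norm (f k - l) \<le> sqrt (n (f k - l) / c)" for k
      using coercive[of "f k - l"] c by (intro real_le_rsqrt) (simp add: field_simps)
    have "(\<lambda>k. sqrt (n (f k - l) / c)) \<longlonglongrightarrow> 0"
      using tendsto_real_sqrt[OF tendsto_divide[OF lim tendsto_const[of c]]] c by simp
    then have "(\<lambda>k. f k - l) \<longlonglongrightarrow> 0"
      by (rule Lim_null_comparison[rotated]) (simp add: le)
    then show ?thesis by (simp add: LIM_zero_iff)
  qed
  \<comment> \<open>All estimates compare two such triples; those of states and those of fixed points are treated alike.\<close>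
  define triple where
    "triple x w u \<longleftrightarrow> Phi (x - w) \<in> A w \<and> Phi (2 *\<^sub>R w - x - u) \<in> B u" for x w u
  have triple_state: "triple (enc s) (W s) (U s)" for s
    using resA resB by (simp add: triple_def)
  have triple_A: "0 \<le> Phi ((x1 - x2) - (w1 - w2)) \<bullet> (w1 - w2)"
    if "triple x1 w1 u1" "triple x2 w2 u2" for x1 x2 w1 w2 u1 u2
  proof -
    have "0 \<le> (Phi (x1 - w1) - Phi (x2 - w2)) \<bullet> (w1 - w2)"
      using monA that unfolding monotone_op_def triple_def by blast
    moreover have "Phi ((x1 - x2) - (w1 - w2)) = Phi (x1 - w1) - Phi (x2 - w2)"
      by (simp add: linear_diff[OF lin])
    ultimately show ?thesis by simp
  qed
  have triple_B: "0 \<le> Phi (2 *\<^sub>R (w1 - w2) - (x1 - x2) - (u1 - u2)) \<bullet> (u1 - u2)"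
    if "triple x1 w1 u1" "triple x2 w2 u2" for x1 x2 w1 w2 u1 u2
  proof -
    have "0 \<le> (Phi (2 *\<^sub>R w1 - x1 - u1) - Phi (2 *\<^sub>R w2 - x2 - u2)) \<bullet> (u1 - u2)"
      using monB that unfolding monotone_op_def triple_def by blast
    moreover have "Phi (2 *\<^sub>R (w1 - w2) - (x1 - x2) - (u1 - u2)) =
        Phi (2 *\<^sub>R w1 - x1 - u1) - Phi (2 *\<^sub>R w2 - x2 - u2)"
      by (simp add: linear_diff[OF lin] linear_scale[OF lin] scaleR_diff_right)
    ultimately show ?thesis by simp
  qed
  have firm: "n ((x1 + u1 - w1) - (x2 + u2 - w2)) + n ((w1 - u1) - (w2 - u2)) \<le> n (x1 - x2)"
    if "triple x1 w1 u1" "triple x2 w2 u2" for x1 x2 w1 w2 u1 u2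
    using douglas_rachford_firm[OF lin sym triple_A[OF that] triple_B[OF that]]
    by (simp add: n_def algebra_simps)
  have nonexp: "n (w1 - w2) \<le> n (x1 - x2)"
    if "triple x1 w1 u1" "triple x2 w2 u2" for x1 x2 w1 w2 u1 u2
    using resolvent_nonexpansive[OF lin sym _ triple_A[OF that]] n_nonneg by (simp add: n_def)
  define s where "s k = (step ^^ k) s0" for k
  have enc_Suc: "enc (s (Suc k)) = enc (s k) + U (s k) - W (s k)" for k
    by (simp add: s_def step)
  have fejer: "n (enc (s (Suc k)) - x) + n (W (s k) - U (s k)) \<le> n (enc (s k) - x)"
    if "triple x w w" for x w k
    using firm[OF triple_state[of "s k"] that] by (simp add: enc_Suc)
  have decreasing: "decseq (\<lambda>k. n (enc (s k) - x))" if "triple x w w" for x w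
    using fejer[OF that] n_nonneg
    by (intro decseq_SucI) (meson add_increasing2 order_trans add_le_cancel_left le_add_same_cancel1)
  obtain w0 a0 where "a0 \<in> A w0" "- a0 \<in> B w0" using zero by blast
  have "inj Phi"
    unfolding linear_injective_0[OF lin] using pd by (metis inner_zero_left less_irrefl)
  then have "surj Phi" using lin linear_injective_imp_surjective by blast
  then obtain p where p: "a0 = Phi p" by (metis surjD)
  \<comment> \<open>At a zero \<open>w0\<close> both resolvents coincide, for the point \<open>w0 + p\<close> with \<open>Phi p = a0\<close>.\<close>
  have fix0: "triple (w0 + p) w0 w0"
    using \<open>a0 \<in> A w0\<close> \<open>- a0 \<in> B w0\<close> p
    by (simp add: triple_def linear_neg[OF lin, symmetric] scaleR_2)
  define V where "V k = n (enc (s k) - (w0 + p))" for k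
  obtain L where L: "V \<longlonglongrightarrow> L"
    using decseq_convergent[OF decreasing[OF fix0], of 0] n_nonneg unfolding V_def by blast
  have "(\<lambda>k. V k - V (Suc k)) \<longlonglongrightarrow> 0"
    using tendsto_diff[OF L LIMSEQ_Suc[OF L]] by simp
  then have gap: "(\<lambda>k. n (W (s k) - U (s k))) \<longlonglongrightarrow> 0"
  proof (rule tendsto_sandwich[OF _ _ tendsto_const, rotated 2])
    show "\<forall>\<^sub>F k in sequentially. 0 \<le> n (W (s k) - U (s k))" by (simp add: n_nonneg)
    have "n (W (s k) - U (s k)) \<le> V k - V (Suc k)" for k
      using fejer[OF fix0, of k] by (simp add: V_def)
    then show "\<forall>\<^sub>F k in sequentially. n (W (s k) - U (s k)) \<le> V k - V (Suc k)" by simp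
  qed
  have bnd: "(norm (enc (s k) - (w0 + p)))\<^sup>2 \<le> V 0 / c" for k
    using coercive[of "enc (s k) - (w0 + p)"] decseqD[OF decreasing[OF fix0], of 0 k] c
    by (simp add: V_def field_simps)
  have "bounded (range (\<lambda>k. enc (s k)))"
  proof (rule bounded_subset[OF bounded_cball])
    show "range (\<lambda>k. enc (s k)) \<subseteq> cball (w0 + p) (sqrt (V 0 / c))"
      using bnd by (auto simp: dist_norm norm_minus_commute intro!: real_le_rsqrt)
  qed
  then obtain x r where r: "strict_mono (r :: nat \<Rightarrow> nat)" and x: "(\<lambda>k. enc (s (r k))) \<longlonglongrightarrow> x"
    using bounded_imp_convergent_subsequence[of "\<lambda>k. enc (s k)"] by (auto simp: o_def)
  have "x \<in> range enc"
    by (rule closed_sequentially[OF closed_enc _ x]) auto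
  then obtain t where t: "x = enc t" by blast
  have lim_x: "(\<lambda>k. n (enc (s (r k)) - x)) \<longlonglongrightarrow> 0"
    using n_tendsto[OF LIM_zero[OF x]] n_0 by simp
  have "(\<lambda>k. n ((W (s (r k)) - U (s (r k))) - (W t - U t))) \<longlonglongrightarrow> 0"
  proof (rule tendsto_sandwich[OF _ _ tendsto_const lim_x])
    show "\<forall>\<^sub>F k in sequentially. n ((W (s (r k)) - U (s (r k))) - (W t - U t)) \<le> n (enc (s (r k)) - x)"
    proof (intro always_eventually allI)
      fix k
      show "n ((W (s (r k)) - U (s (r k))) - (W t - U t)) \<le> n (enc (s (r k)) - x)"
        using firm[OF triple_state[of "s (r k)"] triple_state[of t]] n_nonneg t
        by (smt (verit))
    qed
  qed (use n_nonneg in auto)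
  then have "(\<lambda>k. W (s (r k)) - U (s (r k))) \<longlonglongrightarrow> W t - U t"
    by (rule n_convergence)
  moreover have "(\<lambda>k. W (s (r k)) - U (s (r k))) \<longlonglongrightarrow> 0"
    using n_convergence[of "\<lambda>k. W (s k) - U (s k)" 0] gap LIMSEQ_subseq_LIMSEQ[OF _ r]
    by (fastforce simp: o_def)
  ultimately have UW: "U t = W t"
    using LIMSEQ_unique by fastforce
  have fix_t: "triple x (W t) (W t)"
    using triple_state[of t] by (simp add: UW t)
  have "(\<lambda>k. n (enc (s k) - x)) \<longlonglongrightarrow> 0"
  proof -
    obtain M where M: "(\<lambda>k. n (enc (s k) - x)) \<longlonglongrightarrow> M"
      using decseq_convergent[OF decreasing[OF fix_t], of 0] n_nonneg by blast
    have "(\<lambda>k. n (enc (s (r k)) - x)) \<longlonglongrightarrow> M"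
      using LIMSEQ_subseq_LIMSEQ[OF M r] by (simp add: o_def)
    with lim_x have "M = 0" by (metis LIMSEQ_unique)
    with M show ?thesis by simp
  qed
  then have "(\<lambda>k. n (W (s k) - W t)) \<longlonglongrightarrow> 0"
  proof (rule tendsto_sandwich[OF _ _ tendsto_const, rotated 2])
    show "\<forall>\<^sub>F k in sequentially. 0 \<le> n (W (s k) - W t)" by (simp add: n_nonneg)
    show "\<forall>\<^sub>F k in sequentially. n (W (s k) - W t) \<le> n (enc (s k) - x)"
      using nonexp[OF triple_state fix_t] by simp
  qed
  then have "(\<lambda>k. W (s k)) \<longlonglongrightarrow> W t" by (rule n_convergence)
  moreover have "Phi (x - W t) \<in> A (W t)" "- Phi (x - W t) \<in> B (W t)"
    using fix_t by (auto simp: triple_def scaleR_2 linear_neg[OF lin, symmetric])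
  ultimately show ?thesis unfolding s_def by blast
qed

section \<open>Differences and divergences on a directed graph\<close>

text \<open>The action of the transposed incidence matrix; \<open>edge_div\<close> below is the action of the incidence
  matrix itself.\<close>

definition edge_diff :: "('p::finite \<times> 'p) set \<Rightarrow> 'a::euclidean_space^'p \<Rightarrow> 'a^('p \<times> 'p)" where
  "edge_diff E y = (\<chi> e. if e \<in> E then y $ snd e - y $ fst e else 0)"

definition edge_div :: "('p::finite \<times> 'p) set \<Rightarrow> 'a::euclidean_space^('p \<times> 'p) \<Rightarrow> 'a^'p" where
  "edge_div E w = (\<chi> i. edge_balance E i (($) w))"

definition graph_lap :: "('p::finite \<times> 'p) set \<Rightarrow> 'a::euclidean_space^'p \<Rightarrow> 'a^'p" where
  "graph_lap E y = (\<chi> i. nbr_sum E i (\<lambda>j. y $ i - y $ j))"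

lemma sum_edges_out:
  fixes E :: "('p::finite \<times> 'p) set"
  shows "(\<Sum>e\<in>E. F e) = (\<Sum>i\<in>UNIV. \<Sum>j\<in>nbr_out E i. F (i, j))"
proof -
  have "E = Sigma UNIV (nbr_out E)" by (auto simp: nbr_out_def)
  then have "(\<Sum>e\<in>E. F e) = (\<Sum>(i, j)\<in>Sigma UNIV (nbr_out E). F (i, j))" by simp
  also have "\<dots> = (\<Sum>i\<in>UNIV. \<Sum>j\<in>nbr_out E i. F (i, j))" by (intro sum.Sigma[symmetric]) auto
  finally show ?thesis .
qed

lemma sum_edges_in:
  fixes E :: "('p::finite \<times> 'p) set"
  shows "(\<Sum>e\<in>E. F e) = (\<Sum>i\<in>UNIV. \<Sum>j\<in>nbr_in E i. F (j, i))"
proof -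
  have "E = prod.swap ` E\<inverse>" by force
  then have "(\<Sum>e\<in>E. F e) = (\<Sum>e\<in>E\<inverse>. F (prod.swap e))"
    using sum.reindex[of prod.swap "E\<inverse>" F] by simp
  also have "\<dots> = (\<Sum>i\<in>UNIV. \<Sum>j\<in>nbr_out (E\<inverse>) i. F (j, i))" by (simp add: sum_edges_out)
  finally show ?thesis by (simp add: nbr_out_def nbr_in_def)
qed

lemma linear_edge_diff: "linear (edge_diff E)"
  by (rule linearI) (auto simp: edge_diff_def vec_eq_iff scaleR_diff_right)

lemma linear_edge_div: "linear (edge_div E)"
  by (rule linearI) (simp_all add: edge_div_def vec_eq_iff edge_balance_def sum.distrib
      scaleR_sum_right scaleR_diff_right)

lemma graph_lap_eq_div_diff: "graph_lap E y = edge_div E (edge_diff E y)"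
proof -
  have "nbr_sum E i (\<lambda>j. y $ i - y $ j) = edge_balance E i (($) (edge_diff E y))" for i
  proof -
    have "(\<Sum>j\<in>nbr_in E i. edge_diff E y $ (j, i)) = (\<Sum>j\<in>nbr_in E i. y $ i - y $ j)"
      by (intro sum.cong) (auto simp: edge_diff_def nbr_in_def)
    moreover have "(\<Sum>j\<in>nbr_out E i. edge_diff E y $ (i, j)) = (\<Sum>j\<in>nbr_out E i. - (y $ i - y $ j))"
      by (intro sum.cong) (auto simp: edge_diff_def nbr_out_def)
    ultimately show ?thesis
      by (simp add: nbr_sum_def edge_balance_def sum_negf del: minus_diff_eq)
  qed
  then show ?thesis by (simp add: graph_lap_def edge_div_def)
qed

lemma linear_graph_lap: "linear (graph_lap E)"
  using linear_compose[OF linear_edge_diff linear_edge_div, of E E]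
  by (simp add: o_def flip: graph_lap_eq_div_diff)

lemma edge_diff_adjoint: "edge_diff E y \<bullet> w = y \<bullet> edge_div E w"
proof -
  have "edge_diff E y \<bullet> w = (\<Sum>e\<in>UNIV. if e \<in> E then (y $ snd e - y $ fst e) \<bullet> w $ e else 0)"
    unfolding inner_vec_def by (intro sum.cong) (auto simp: edge_diff_def)
  also have "\<dots> = (\<Sum>e\<in>E. (y $ snd e - y $ fst e) \<bullet> w $ e)" by (simp flip: sum.inter_filter)
  also have "\<dots> = (\<Sum>e\<in>E. y $ snd e \<bullet> w $ e) - (\<Sum>e\<in>E. y $ fst e \<bullet> w $ e)"
    by (simp add: inner_diff_left sum_subtractf)
  also have "\<dots> = (\<Sum>i\<in>UNIV. y $ i \<bullet> (\<Sum>j\<in>nbr_in E i. w $ (j, i))) -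
      (\<Sum>i\<in>UNIV. y $ i \<bullet> (\<Sum>j\<in>nbr_out E i. w $ (i, j)))"
    by (simp add: sum_edges_in[of "\<lambda>e. y $ snd e \<bullet> w $ e"] sum_edges_out[of "\<lambda>e. y $ fst e \<bullet> w $ e"]
        inner_sum_right)
  also have "\<dots> = y \<bullet> edge_div E w"
    by (simp add: inner_vec_def[of y] edge_div_def edge_balance_def inner_diff_right sum_subtractf)
  finally show ?thesis .
qed

lemma graph_lap_selfadjoint: "graph_lap E y \<bullet> z = y \<bullet> graph_lap E z"
  by (metis graph_lap_eq_div_diff edge_diff_adjoint inner_commute)

lemma graph_lap_energy: "graph_lap E y \<bullet> y = (norm (edge_diff E y))\<^sup>2"
  by (metis graph_lap_eq_div_diff edge_diff_adjoint inner_commute power2_norm_eq_inner)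

lemma laplacian_n_eq_graph_lap:
  assumes "irrefl E"
  shows "laplacian_n E y = graph_lap E y"
proof -
  have "laplacian_n E y $ i = graph_lap E y $ i" for i
  proof -
    have inc: "(\<Sum>j\<in>UNIV. incidence j e *\<^sub>R y $ j) = y $ snd e - y $ fst e" if "e \<in> E" for e
    proof -
      have "fst e \<noteq> snd e" using assms that by (metis irreflD prod.collapse)
      then have "(\<Sum>j\<in>UNIV. incidence j e *\<^sub>R y $ j) =
          (\<Sum>j\<in>UNIV. (if snd e = j then y $ j else 0) - (if fst e = j then y $ j else 0))"
        by (intro sum.cong) (auto simp: incidence_def)
      then show ?thesis by (simp add: sum_subtractf)
    qed
    have "laplacian_n E y $ i = (\<Sum>j\<in>UNIV. \<Sum>e\<in>E. incidence i e *\<^sub>R incidence j e *\<^sub>R y $ j)"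
      by (simp add: laplacian_n_def laplacian_def scaleR_sum_left)
    also have "\<dots> = (\<Sum>e\<in>E. incidence i e *\<^sub>R (\<Sum>j\<in>UNIV. incidence j e *\<^sub>R y $ j))"
      by (subst sum.swap) (simp add: scaleR_sum_right)
    also have "\<dots> = (\<Sum>e\<in>E. incidence i e *\<^sub>R edge_diff E y $ e)"
      by (intro sum.cong refl) (simp add: inc edge_diff_def)
    also have "\<dots> = (\<Sum>e\<in>E. (if snd e = i then edge_diff E y $ e else 0) -
        (if fst e = i then edge_diff E y $ e else 0))"
      using assms by (intro sum.cong) (auto simp: incidence_def irrefl_def)
    also have "\<dots> = (\<Sum>e\<in>E. if snd e = i then edge_diff E y $ e else 0) -
        (\<Sum>e\<in>E. if fst e = i then edge_diff E y $ e else 0)" by (rule sum_subtractf)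
    also have "(\<Sum>e\<in>E. if snd e = i then edge_diff E y $ e else 0) =
        (\<Sum>l\<in>UNIV. if l = i then \<Sum>j\<in>nbr_in E l. edge_diff E y $ (j, l) else 0)"
      by (subst sum_edges_in) (intro sum.cong refl, simp)
    also have "(\<Sum>e\<in>E. if fst e = i then edge_diff E y $ e else 0) =
        (\<Sum>l\<in>UNIV. if l = i then \<Sum>j\<in>nbr_out E l. edge_diff E y $ (l, j) else 0)"
      by (subst sum_edges_out) (intro sum.cong refl, simp)
    finally show ?thesis
      by (simp add: graph_lap_eq_div_diff edge_div_def edge_balance_def)
  qed
  then show ?thesis by (simp add: vec_eq_iff)
qed

text \<open>The hypothesis excludes loops, which \<open>deg\<close> would count only once.\<close>

lemma handshake:
  fixes f :: "'p::finite \<Rightarrow> real"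
  assumes "irrefl E"
  shows "(\<Sum>e\<in>E. f (snd e) + f (fst e)) = (\<Sum>i\<in>UNIV. real (deg E i) * f i)"
proof -
  have deg: "deg E i = card (nbr_in E i) + card (nbr_out E i)" for i
  proof -
    have "{e \<in> E. fst e = i \<or> snd e = i} = (\<lambda>j. (j, i)) ` nbr_in E i \<union> (\<lambda>j. (i, j)) ` nbr_out E i"
      by (auto simp: nbr_in_def nbr_out_def)
    moreover have "(\<lambda>j. (j, i)) ` nbr_in E i \<inter> (\<lambda>j. (i, j)) ` nbr_out E i = {}"
      using assms by (auto simp: nbr_in_def irrefl_def)
    ultimately show ?thesis
      unfolding deg_def by (simp add: card_Un_disjoint card_image inj_on_def)
  qed
  have "(\<Sum>e\<in>E. f (snd e) + f (fst e)) = (\<Sum>e\<in>E. f (snd e)) + (\<Sum>e\<in>E. f (fst e))"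
    by (rule sum.distrib)
  also have "\<dots> = (\<Sum>i\<in>UNIV. real (card (nbr_in E i)) * f i) + (\<Sum>i\<in>UNIV. real (card (nbr_out E i)) * f i)"
    by (simp add: sum_edges_in[of "\<lambda>e. f (snd e)"] sum_edges_out[of "\<lambda>e. f (fst e)"])
  finally show ?thesis by (simp add: deg sum.distrib algebra_simps)
qed

lemma consensus_if_edge_diff_0:
  assumes "weakly_connected E" and "edge_diff E y = 0"
  shows "y $ i = y $ j"
proof -
  have edge: "y $ i = y $ j" if "(i, j) \<in> E" for i j
    using arg_cong[OF assms(2), of "\<lambda>w. w $ (i, j)"] that by (simp add: edge_diff_def)
  have "(i, j) \<in> (E \<union> E\<inverse>)\<^sup>*" using assms(1) by (simp add: weakly_connected_def)
  then show ?thesis by induction (auto dest: edge)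
qed

lemma edge_diff_const: "edge_diff E (\<chi> i. x) = 0"
  by (simp add: edge_diff_def vec_eq_iff)

lemma sum_edge_div: "(\<Sum>i\<in>UNIV. edge_div E w $ i) = 0"
proof (rule vector_eq_ldot[THEN iffD1, rule_format])
  fix x
  have "x \<bullet> (\<Sum>i\<in>UNIV. edge_div E w $ i) = (\<chi> i. x) \<bullet> edge_div E w"
    by (simp add: inner_vec_def inner_sum_right)
  then show "x \<bullet> (\<Sum>i\<in>UNIV. edge_div E w $ i) = x \<bullet> 0"
    by (simp add: edge_diff_const flip: edge_diff_adjoint)
qed

text \<open>The orthogonal complement of the range consists of vectors with zero differences along
  the edges, hence of constant vectors, and these are orthogonal to \<open>t\<close>.\<close>

lemma range_edge_div:
  fixes t :: "'a::euclidean_space^'p::finite"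
  assumes conn: "weakly_connected E" and t: "(\<Sum>i\<in>UNIV. t $ i) = 0"
  shows "\<exists>w. edge_div E w = t"
proof -
  obtain a b where a: "a \<in> span (range (edge_div E))"
    and b: "\<And>w. w \<in> span (range (edge_div E)) \<Longrightarrow> orthogonal b w" and ab: "t = a + b"
    using orthogonal_subspace_decomp_exists[of "range (edge_div E)" t] by blast
  have span: "span (range (edge_div E :: 'a^('p \<times> 'p) \<Rightarrow> _)) = range (edge_div E)"
    by (simp add: linear_subspace_image[OF linear_edge_div])
  have "edge_diff E b \<bullet> edge_diff E b = 0"
    unfolding edge_diff_adjoint using b by (simp add: span orthogonal_def)
  then have "edge_diff E b = 0" by simp
  then have const: "b $ i = b $ j" for i j using consensus_if_edge_diff_0[OF conn] by blast
  define i0 :: 'p where "i0 = undefined"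
  have "b \<bullet> b = b \<bullet> t" using b[OF a] by (simp add: ab inner_add_right orthogonal_def)
  also have "\<dots> = b $ i0 \<bullet> (\<Sum>i\<in>UNIV. t $ i)"
    unfolding inner_vec_def[of b] inner_sum_right by (intro sum.cong refl) (metis const)
  finally have "b = 0" using t by simp
  then show ?thesis using a ab span by auto
qed

section \<open>Blocks of the decision space\<close>

lemma linear_blk: "linear (blk G i)"
  by (rule linearI) (auto simp: blk_def vec_eq_iff)

text \<open>Elements of \<open>dspace G i\<close> see only the block of player \<open>i\<close>; this translates between inner
  products of full vectors and of blocks.\<close>

lemma inner_dspace: "u \<in> dspace G i \<Longrightarrow> u \<bullet> x = u \<bullet> blk G i x"
  by (auto simp: dspace_def blk_def inner_vec_def intro!: sum.cong)

text \<open>Block vectors of different players have disjoint supports, so their sum recovers each of them.\<close>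

lemma blk_sum_dspace:
  fixes G :: "('p::finite, 'n::finite, 'm::finite) game"
  assumes "\<And>i. g i \<in> dspace G i"
  shows "blk G j (\<Sum>i\<in>UNIV. g i) = g j"
proof -
  have "blk G j (g i) = (if i = j then g j else 0)" for i
    using assms[of i] by (auto simp: blk_def dspace_def vec_eq_iff)
  then show ?thesis by (simp add: linear_sum[OF linear_blk])
qed

lemma blk_join: "v \<in> dspace G i \<Longrightarrow> blk G i (join G i v x) = v"
  by (auto simp: blk_def join_def dspace_def vec_eq_iff)

lemma own_cost_join: "own_cost G i (join G i v x) = own_cost G i x"
proof -
  have "join G i u (join G i v x) = join G i u x" for u by (simp add: join_def vec_eq_iff)
  then show ?thesis by (simp add: own_cost_def)
qed

lemma partial_subdiff_join:
  "v \<in> dspace G i \<Longrightarrow> partial_subdiff G i (join G i v x) = subdifferential (dspace G i) (own_cost G i x) v"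
  by (simp add: partial_subdiff_def own_cost_join blk_join)

lemma partial_subdiff_dspace: "g \<in> partial_subdiff G i x \<Longrightarrow> g \<in> dspace G i"
  by (simp add: partial_subdiff_def subdifferential_def)

lemma cmat_blk_mult_blk: "cmat_blk G i *v blk G i x = cmat_blk G i *v x"
  by (auto simp: cmat_blk_def blk_def matrix_vector_mult_def vec_eq_iff intro!: sum.cong)

lemma transpose_cmat_blk_dspace: "transpose (cmat_blk G i) *v l \<in> dspace G i"
  by (simp add: dspace_def cmat_blk_def transpose_def matrix_vector_mult_def)

lemma sum_cmat_blk:
  fixes G :: "('p::finite, 'n::finite, 'm::finite) game"
  shows "(\<Sum>i\<in>UNIV. cmat_blk G i *v x) = cmat G *v x"
proof -
  have "(\<Sum>i\<in>UNIV. cmat_blk G i *v x) $ r = (cmat G *v x) $ r" for r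
  proof -
    have "(\<Sum>i\<in>UNIV. cmat_blk G i *v x) $ r =
        (\<Sum>c\<in>UNIV. \<Sum>i\<in>UNIV. if owner G c = i then cmat G $ r $ c * x $ c else 0)"
      by (subst sum.swap)
         (auto simp: cmat_blk_def matrix_vector_mult_def intro!: sum.cong)
    then show ?thesis by (simp add: matrix_vector_mult_def)
  qed
  then show ?thesis by (simp add: vec_eq_iff)
qed

section \<open>Domains of the own costs\<close>

text \<open>Subgradients chosen separately by the players form, stacked, an element of the extended
  pseudogradient, so the monotonicity of the operator can be used blockwise.\<close>

lemma reg_pseudograd_monotone:
  fixes G :: "('p::finite, 'n::finite, 'm::finite) game"
  assumes mono: "monotone_op (reg_pseudograd G E \<rho>)" and E: "irrefl E"
    and g: "\<And>i. g i \<in> partial_subdiff G i (y $ i)"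
    and g': "\<And>i. g' i \<in> partial_subdiff G i (y' $ i)"
  shows "0 \<le> ((\<chi> i. g i - g' i) + (\<rho> / 2) *\<^sub>R graph_lap E (y - y')) \<bullet> (y - y')"
proof -
  have in_op: "(\<chi> i. g i) + (\<rho> / 2) *\<^sub>R graph_lap E y \<in> reg_pseudograd G E \<rho> y"
    if g: "\<And>i. g i \<in> partial_subdiff G i (y $ i)" for g :: "'p \<Rightarrow> real^'n" and y
  proof -
    have blk: "blk G i (\<Sum>i\<in>UNIV. g i) = g i" for i
      by (rule blk_sum_dspace) (rule partial_subdiff_dspace[OF g])
    then have "(\<Sum>i\<in>UNIV. g i) \<in> ext_pseudograd G y" using g by (simp add: ext_pseudograd_def)
    moreover have "adjoint (selection G) (\<Sum>i\<in>UNIV. g i) = (\<chi> i. g i)"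
      by (simp add: adjoint_selection blk)
    ultimately show ?thesis
      unfolding reg_pseudograd_def laplacian_n_eq_graph_lap[OF E] by force
  qed
  have "0 \<le> (((\<chi> i. g i) + (\<rho> / 2) *\<^sub>R graph_lap E y) - ((\<chi> i. g' i) + (\<rho> / 2) *\<^sub>R graph_lap E y')) \<bullet> (y - y')"
    using mono in_op[of g y, OF g] in_op[of g' y', OF g'] unfolding monotone_op_def by blast
  also have "((\<chi> i. g i) + (\<rho> / 2) *\<^sub>R graph_lap E y) - ((\<chi> i. g' i) + (\<rho> / 2) *\<^sub>R graph_lap E y')
      = (\<chi> i. g i - g' i) + (\<rho> / 2) *\<^sub>R graph_lap E (y - y')"
    by (simp add: linear_diff[OF linear_graph_lap] scaleR_diff_right vec_eq_iff)
  finally show ?thesis .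
qed

definition convex_costs :: "('p, 'n::finite, 'm::finite) game \<Rightarrow> bool" where
  "convex_costs G \<longleftrightarrow> (\<forall>i x. proper_on (dspace G i) (own_cost G i x) \<and>
     lsc_on (dspace G i) (own_cost G i x) \<and> econvex_on (dspace G i) (own_cost G i x))"

lemma convex_costsD:
  assumes "convex_costs G"
  shows "proper_on (dspace G i) (own_cost G i x)" "lsc_on (dspace G i) (own_cost G i x)"
    "econvex_on (dspace G i) (own_cost G i x)"
  using assms by (auto simp: convex_costs_def)

lemma norm_join_diff_le:
  assumes "q \<in> dspace G i" "v \<in> dspace G i"
  shows "norm (join G i q x - join G i v w) \<le> norm (q - v) + norm (x - w)"
proof -
  have "join G i q x - join G i v w = (q - v) + ((x - w) - blk G i (x - w))"
    using assms by (auto simp: join_def blk_def dspace_def vec_eq_iff)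
  moreover have "norm ((x - w) - blk G i (x - w)) \<le> norm (x - w)"
    by (rule norm_le_componentwise_cart) (simp add: blk_def)
  ultimately show ?thesis by (metis add_left_mono norm_triangle_le)
qed

text \<open>Let \<open>v\<close> be the proximal point of \<open>q\<close> for \<open>J_i(\<cdot>; w)\<close> with step \<open>t\<close>; it has the subgradient
  \<open>(q - v) / t\<close>. Monotonicity is applied to two stacked vectors that differ only in the component of
  player \<open>i\<close>, which is \<open>(q; x)\<close> in one and \<open>(v; w)\<close> in the other, while the rivals use the same
  point and the same subgradient in both. It bounds \<open>norm (q - v) ^ 2 / t\<close> by a fixed quadratic
  polynomial in \<open>norm (q - v)\<close>, the Laplacian contributing the constant that depends on \<open>x - w\<close>.
  This forces \<open>v\<close> to be close to \<open>q\<close> for some \<open>t\<close>.\<close>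

lemma own_cost_domain_approx:
  fixes G :: "('p::finite, 'n::finite, 'm::finite) game"
  assumes costs: "convex_costs G" and mono: "monotone_op (reg_pseudograd G E \<rho>)" and E: "irrefl E"
    and \<rho>: "0 \<le> \<rho>"
    and q: "q \<in> dspace G i" and g: "g \<in> subdifferential (dspace G i) (own_cost G i x) q" and e: "0 < e"
  shows "\<exists>v\<in>dspace G i. own_cost G i w v < \<infinity> \<and> norm (q - v) < e"
proof -
  note cc = convex_costsD[OF costs]
  have "\<exists>v\<in>dspace G j. (1 / 1) *\<^sub>R (0 - v) \<in> subdifferential (dspace G j) (own_cost G j 0) v" for j
    by (rule proximal_point_exists[OF subspace_dspace cc subspace_0[OF subspace_dspace] zero_less_one])
  then obtain b where b: "\<And>j. b j \<in> dspace G j"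
    "\<And>j. (1 / 1) *\<^sub>R (0 - b j) \<in> subdifferential (dspace G j) (own_cost G j 0) (b j)"
    by metis
  have "\<exists>v\<in>dspace G i. (1 / t) *\<^sub>R (q - v) \<in> subdifferential (dspace G i) (own_cost G i w) v"
    if "0 < t" for t
    by (rule proximal_point_exists[OF subspace_dspace cc q that])
  then obtain prox where prox: "\<And>t. 0 < t \<Longrightarrow> prox t \<in> dspace G i"
    "\<And>t. 0 < t \<Longrightarrow> (1 / t) *\<^sub>R (q - prox t) \<in> subdifferential (dspace G i) (own_cost G i w) (prox t)"
    by metis
  obtain K where K: "0 < K" "\<And>y :: real^'n^'p. norm (edge_diff E y) \<le> K * norm y"
    using linear_bounded_pos[OF linear_edge_diff] by blast
  define N where "N = norm (x - w)"
  have "\<exists>t>0. norm (q - prox t) < e"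
  proof (rule small_step_near[OF e, of "\<rho> * K\<^sup>2 * N\<^sup>2" "norm g" "\<rho> * K\<^sup>2"])
    fix t :: real assume t: "0 < t"
    define v where "v = prox t"
    define s where "s = norm (q - v)"
    have vV: "v \<in> dspace G i" using prox t by (simp add: v_def)
    define y where "y = (\<chi> j. if j = i then join G i q x else join G j (b j) 0)"
    define y' where "y' = (\<chi> j. if j = i then join G i v w else join G j (b j) 0)"
    define h where "h j = (if j = i then g else (1 / 1) *\<^sub>R (0 - b j))" for j
    define h' where "h' j = (if j = i then (1 / t) *\<^sub>R (q - v) else (1 / 1) *\<^sub>R (0 - b j))" for j
    have h: "h j \<in> partial_subdiff G j (y $ j)" for j
      using b(1)[of j] b(2)[of j] q g by (simp add: h_def y_def partial_subdiff_join)
    have h': "h' j \<in> partial_subdiff G j (y' $ j)" for j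
      using b(1)[of j] b(2)[of j] vV prox(2)[OF t] by (simp add: h'_def y'_def v_def partial_subdiff_join)
    define \<delta> where "\<delta> = join G i q x - join G i v w"
    have y: "y - y' = (\<chi> j. if j = i then \<delta> else 0)" by (simp add: y_def y'_def \<delta>_def vec_eq_iff)
    have norm_y: "norm (y - y') = norm \<delta>"
      by (simp add: norm_eq_sqrt_inner y inner_vec_def[where 'b = 'p] if_distrib cong: if_cong)
    have "norm (edge_diff E (y - y')) \<le> K * (s + N)"
      using K(2)[of "y - y'"] norm_join_diff_le[OF q vV, of x w] K(1)
      by (smt (verit) N_def \<delta>_def mult_left_mono norm_y s_def)
    then have "(norm (edge_diff E (y - y')))\<^sup>2 \<le> (K * (s + N))\<^sup>2" by (rule power_mono) simp
    also have "\<dots> \<le> K\<^sup>2 * (2 * s\<^sup>2 + 2 * N\<^sup>2)"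
      using sum_squares_bound[of s N] by (simp add: power_mult_distrib power2_sum mult_left_mono)
    finally have "(\<rho> / 2) * (norm (edge_diff E (y - y')))\<^sup>2 \<le> (\<rho> / 2) * (K\<^sup>2 * (2 * s\<^sup>2 + 2 * N\<^sup>2))"
      using \<rho> by (intro mult_left_mono) auto
    also have "\<dots> = \<rho> * K\<^sup>2 * N\<^sup>2 + \<rho> * K\<^sup>2 * s\<^sup>2" by (simp add: algebra_simps)
    finally have lap: "(\<rho> / 2) * (norm (edge_diff E (y - y')))\<^sup>2 \<le> \<rho> * K\<^sup>2 * N\<^sup>2 + \<rho> * K\<^sup>2 * s\<^sup>2" .
    have gV: "g - (1 / t) *\<^sub>R (q - v) \<in> dspace G i"
      using g q vV subspace_dspace[of G i]
      by (auto simp: subdifferential_def intro!: subspace_diff subspace_scale)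
    have blk\<delta>: "blk G i \<delta> = q - v" by (simp add: \<delta>_def linear_diff[OF linear_blk] blk_join q vV)
    have "(\<chi> j. h j - h' j) \<bullet> (y - y') = (g - (1 / t) *\<^sub>R (q - v)) \<bullet> \<delta>"
      by (simp add: y inner_vec_def[where 'b = 'p] h_def h'_def if_distrib cong: if_cong)
    also have "\<dots> = (g - (1 / t) *\<^sub>R (q - v)) \<bullet> (q - v)"
      using inner_dspace[OF gV, of \<delta>] unfolding blk\<delta> .
    also have "\<dots> = g \<bullet> (q - v) - s\<^sup>2 / t"
      by (simp add: inner_diff_left s_def power2_norm_eq_inner)
    finally have eq: "(\<chi> j. h j - h' j) \<bullet> (y - y') = g \<bullet> (q - v) - s\<^sup>2 / t" .
    have "0 \<le> ((\<chi> j. h j - h' j) + (\<rho> / 2) *\<^sub>R graph_lap E (y - y')) \<bullet> (y - y')"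
      by (rule reg_pseudograd_monotone[OF mono E h h'])
    also have "\<dots> = g \<bullet> (q - v) - s\<^sup>2 / t + (\<rho> / 2) * (norm (edge_diff E (y - y')))\<^sup>2"
      by (simp add: inner_add_left eq graph_lap_energy)
    finally have "s\<^sup>2 / t \<le> g \<bullet> (q - v) + (\<rho> * K\<^sup>2 * N\<^sup>2 + \<rho> * K\<^sup>2 * s\<^sup>2)" using lap by linarith
    moreover have "g \<bullet> (q - v) \<le> norm g * s" unfolding s_def by (rule norm_cauchy_schwarz)
    ultimately show "(norm (q - prox t))\<^sup>2 / t \<le>
        \<rho> * K\<^sup>2 * N\<^sup>2 + norm g * norm (q - prox t) + \<rho> * K\<^sup>2 * (norm (q - prox t))\<^sup>2"
      unfolding s_def v_def by linarith
  qed (use \<rho> in auto)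
  then obtain t where t: "0 < t" "norm (q - prox t) < e" by blast
  have "own_cost G i w (prox t) < \<infinity>" using prox(2)[OF t(1)] by (auto simp: subdifferential_def)
  with t prox(1)[OF t(1)] show ?thesis by blast
qed

lemma own_cost_domain_closure_mono:
  fixes G :: "('p::finite, 'n::finite, 'm::finite) game"
  assumes costs: "convex_costs G" and mono: "monotone_op (reg_pseudograd G E \<rho>)" and E: "irrefl E"
    and \<rho>: "0 \<le> \<rho>"
  shows "{v \<in> dspace G i. own_cost G i x v < \<infinity>} \<subseteq> closure {v \<in> dspace G i. own_cost G i w v < \<infinity>}"
proof
  note cc = convex_costsD[OF costs]
  fix p assume "p \<in> {v \<in> dspace G i. own_cost G i x v < \<infinity>}"
  then have p: "p \<in> dspace G i" "own_cost G i x p < \<infinity>" by auto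
  show "p \<in> closure {v \<in> dspace G i. own_cost G i w v < \<infinity>}"
    unfolding closure_approachable
  proof (intro allI impI)
    fix e :: real assume "0 < e"
    then have e: "0 < e / 2" by simp
    obtain q g where q: "q \<in> dspace G i" "g \<in> subdifferential (dspace G i) (own_cost G i x) q" "norm (p - q) < e / 2"
      using subdifferentiable_dense[OF subspace_dspace cc p e] by blast
    obtain v where v: "v \<in> dspace G i" "own_cost G i w v < \<infinity>" "norm (q - v) < e / 2"
      using own_cost_domain_approx[OF costs mono E \<rho> q(1,2) e] by blast
    have "dist v p < e" using q(3) v(3) by norm
    then show "\<exists>y\<in>{v \<in> dspace G i. own_cost G i w v < \<infinity>}. dist y p < e" using v by blast
  qed
qed

text \<open>By symmetry in \<open>x\<close> and \<open>w\<close>, the two convex domains have the same closure.\<close>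

lemma rel_interior_own_cost_domain:
  fixes G :: "('p::finite, 'n::finite, 'm::finite) game"
  assumes costs: "convex_costs G" and mono: "monotone_op (reg_pseudograd G E \<rho>)" and E: "irrefl E"
    and \<rho>: "0 \<le> \<rho>"
  shows "rel_interior {v \<in> dspace G i. own_cost G i x v < \<infinity>} =
    rel_interior {v \<in> dspace G i. own_cost G i w v < \<infinity>}"
proof -
  define D where "D z = {v \<in> dspace G i. own_cost G i z v < \<infinity>}" for z
  have ri: "rel_interior (closure (D z)) = rel_interior (D z)" for z
    unfolding D_def
    by (intro convex_rel_interior_closure econvex_domain_convex subspace_dspace convex_costsD(3) costs)
  have sub: "D z \<subseteq> closure (D z')" for z z'
    unfolding D_def by (rule own_cost_domain_closure_mono[OF assms])
  have "closure (D x) = closure (D w)"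
    by (intro subset_antisym closure_minimal sub closed_closure)
  then have "rel_interior (closure (D x)) = rel_interior (closure (D w))" by simp
  then have "rel_interior (D x) = rel_interior (D w)" by (simp only: ri)
  then show ?thesis by (simp only: D_def)
qed

section \<open>The proximal step of a player\<close>

text \<open>On the block of player \<open>i\<close> the equation is the optimality condition of the minimization, on the
  other blocks it is the explicit update, where \<open>g\<close>, \<open>n\<close> and the transposed constraint block
  vanish. In this form both cases are one inclusion for the whole vector.\<close>

lemma y_new_inclusion:
  fixes G :: "('p::finite, 'n::finite, 'm::finite) game" and P :: "('p, 'm) network"
  assumes costs: "convex_costs G"
    and feas: "closed (feas G i)" "convex (feas G i)" "feas G i \<subseteq> dspace G i"
    and p: "p \<in> rel_interior (feas G i)"
      "\<And>w. p \<in> rel_interior {v \<in> dspace G i. own_cost G i w v < \<infinity>}"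
    and \<tau>: "0 < tau1 P i"
  shows "\<exists>g\<in>partial_subdiff G i (y_new G P s $ i).
         \<exists>n\<in>normal_cone (dspace G i) (feas G i) (blk G i (y_new G P s $ i)).
    (1 / tau1 P i) *\<^sub>R (y_t s $ i - y_new G P s $ i) - (rho_mu P / 2) *\<^sub>R graph_lap (edges P) (y_t s) $ i
      - (1/2) *\<^sub>R (transpose (cmat_blk G i) *v (lam_t s $ i))
      - (1/2) *\<^sub>R edge_balance (edges P) i (mu_t s) = g + n"
proof -
  note cc = convex_costsD[OF costs]
  define q where "q = blk G i (y_t s $ i)"
  \<comment> \<open>The objective is the own cost plus a quadratic function with linear part \<open>c\<close> and centre \<open>q\<close>.\<close>
  define c where "c = (1/2) *\<^sub>R (transpose (cmat_blk G i) *v (lam_t s $ i))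
      + (rho_mu P / 2) *\<^sub>R blk G i (graph_lap (edges P) (y_t s) $ i)
      + (1/2) *\<^sub>R blk G i (edge_balance (edges P) i (mu_t s))"
  define h where "h v = c \<bullet> v + 1 / (2 * tau1 P i) * (norm (v - q))\<^sup>2" for v
  define grad where "grad u = c + (1 / tau1 P i) *\<^sub>R (u - q)" for u
  have h: "h v = h u + grad u \<bullet> (v - u) + 1 / (2 * tau1 P i) * (norm (v - u))\<^sup>2" for u v
  proof -
    have sq: "(norm (a + b))\<^sup>2 = (norm a)\<^sup>2 + 2 * (b \<bullet> a) + (norm b)\<^sup>2" for a b :: "real^'n"
      by (simp add: power2_norm_eq_inner inner_add_left inner_add_right inner_commute[of a b])
    have "c \<bullet> v = c \<bullet> u + c \<bullet> (v - u)" by (simp add: inner_diff_right)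
    then show ?thesis
      using sq[of "v - u" "u - q"] \<tau> unfolding h_def grad_def inner_scaleR_left inner_add_left
      by (simp add: divide_simps) (simp add: algebra_simps)
  qed
  have cV: "c \<in> dspace G i"
    unfolding c_def
    by (intro subspace_add[OF subspace_dspace] subspace_scale[OF subspace_dspace]
        transpose_cmat_blk_dspace blk_in_dspace)
  have gradV: "grad v \<in> dspace G i" if "v \<in> dspace G i" for v
    unfolding grad_def q_def using that cV
    by (intro subspace_add[OF subspace_dspace] subspace_scale[OF subspace_dspace]
        subspace_diff[OF subspace_dspace] blk_in_dspace)
  have "nbr_sum (edges P) i (\<lambda>j. blk G i (y_t s $ i) - blk G i (y_t s $ j)) =
      blk G i (graph_lap (edges P) (y_t s) $ i)"
    by (simp add: graph_lap_def nbr_sum_def linear_add[OF linear_blk] linear_sum[OF linear_blk]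
        linear_diff[OF linear_blk])
  then have objective: "y_objective G P s i = (\<lambda>v. own_cost G i (y_explicit P s i) v + ereal (h v))"
    unfolding y_objective_def h_def c_def q_def
    by (intro ext) (simp add: inner_add_left dot_lmul_matrix[symmetric] transpose_matrix_vector algebra_simps)
  define v where "v = arg_min (\<lambda>v. own_cost G i (y_explicit P s i) v + ereal (h v)) (\<lambda>v. v \<in> feas G i)"
  have \<kappa>: "0 < 1 / (2 * tau1 P i)" using \<tau> by simp
  note step = proximal_step_inclusion[OF subspace_dspace cc feas p h \<kappa> gradV v_def]
  have vV: "v \<in> dspace G i" using step(1) feas by blast
  have y: "y_new G P s $ i = join G i v (y_explicit P s i)"
    by (simp add: y_new_def objective v_def)
  obtain g n where g: "g \<in> subdifferential (dspace G i) (own_cost G i (y_explicit P s i)) v"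
    and n: "n \<in> normal_cone (dspace G i) (feas G i) v" and eq: "g + n + grad v = 0"
    using step(2) by blast
  have "g \<in> partial_subdiff G i (y_new G P s $ i)" using g by (simp add: y partial_subdiff_join vV)
  moreover have "n \<in> normal_cone (dspace G i) (feas G i) (blk G i (y_new G P s $ i))"
    using n by (simp add: y blk_join vV)
  moreover have "(1 / tau1 P i) *\<^sub>R (y_t s $ i - y_new G P s $ i) - (rho_mu P / 2) *\<^sub>R graph_lap (edges P) (y_t s) $ i
      - (1/2) *\<^sub>R (transpose (cmat_blk G i) *v (lam_t s $ i))
      - (1/2) *\<^sub>R edge_balance (edges P) i (mu_t s) = - grad v" (is "?L = _")
  proof -
    have "?L $ c' = (- grad v) $ c'" for c'
    proof (cases "owner G c' = i")
      case True
      then show ?thesis by (simp add: y grad_def q_def c_def join_def blk_def algebra_simps)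
    next
      case False
      then have "(transpose (cmat_blk G i) *v (lam_t s $ i)) $ c' = 0" "(- grad v) $ c' = 0"
        using transpose_cmat_blk_dspace[of G i] gradV[OF vV] by (auto simp: dspace_def)
      then show ?thesis using False \<tau>
        by (simp add: y join_def y_explicit_def graph_lap_def algebra_simps)
    qed
    then show ?thesis by (simp add: vec_eq_iff)
  qed
  moreover have "- grad v = g + n" using eq unfolding add_eq_0_iff by simp
  ultimately show ?thesis by metis
qed

section \<open>Estimates behind the step size conditions\<close>

definition scale_comp :: "('p::finite \<Rightarrow> real) \<Rightarrow> 'a::euclidean_space^'p \<Rightarrow> 'a^'p" where
  "scale_comp a x = (\<chi> i. a i *\<^sub>R x $ i)"

definition cblk_mult :: "('p::finite, 'n::finite, 'm::finite) game \<Rightarrow> real^'n^'p \<Rightarrow> real^'m^'p" where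
  "cblk_mult G y = (\<chi> i. cmat_blk G i *v (y $ i))"

definition cblk_tmult :: "('p::finite, 'n::finite, 'm::finite) game \<Rightarrow> real^'m^'p \<Rightarrow> real^'n^'p" where
  "cblk_tmult G l = (\<chi> i. transpose (cmat_blk G i) *v (l $ i))"

lemma linear_scale_comp: "linear (scale_comp a)"
  by (rule linearI) (simp_all add: scale_comp_def vec_eq_iff algebra_simps)

lemma linear_cblk_mult: "linear (cblk_mult G)"
  by (rule linearI)
     (simp_all add: cblk_mult_def vec_eq_iff matrix_vector_right_distrib matrix_vector_mult_scaleR)

lemma linear_cblk_tmult: "linear (cblk_tmult G)"
  by (rule linearI)
     (simp_all add: cblk_tmult_def vec_eq_iff matrix_vector_right_distrib matrix_vector_mult_scaleR)

lemma scale_comp_selfadjoint: "scale_comp a x \<bullet> y = x \<bullet> scale_comp a y"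
  by (simp add: scale_comp_def inner_vec_def[where 'b = "'c::finite"])

lemma inner_scale_comp: "scale_comp a x \<bullet> x = (\<Sum>i\<in>UNIV. a i * (norm (x $ i))\<^sup>2)"
  by (simp add: scale_comp_def inner_vec_def[of _ x] power2_norm_eq_inner)

lemma cblk_mult_adjoint: "cblk_mult G y \<bullet> l = y \<bullet> cblk_tmult G l"
proof -
  have "(cmat_blk G i *v (y $ i)) \<bullet> l $ i = y $ i \<bullet> (transpose (cmat_blk G i) *v (l $ i))" for i
    by (metis dot_lmul_matrix inner_commute transpose_matrix_vector)
  then show ?thesis by (simp add: cblk_mult_def cblk_tmult_def inner_vec_def[of _ l] inner_vec_def[of y])
qed

lemma edge_div_adjoint: "edge_div E w \<bullet> v = w \<bullet> edge_diff E v"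
  by (metis edge_diff_adjoint inner_commute)

lemmas stack_linear =
  linear_add[OF linear_scale_comp] linear_diff[OF linear_scale_comp] linear_scale[OF linear_scale_comp] linear_0[OF linear_scale_comp]
  linear_add[OF linear_cblk_mult] linear_diff[OF linear_cblk_mult] linear_scale[OF linear_cblk_mult] linear_0[OF linear_cblk_mult]
  linear_add[OF linear_cblk_tmult] linear_diff[OF linear_cblk_tmult] linear_scale[OF linear_cblk_tmult] linear_0[OF linear_cblk_tmult]
  linear_add[OF linear_edge_diff] linear_diff[OF linear_edge_diff] linear_scale[OF linear_edge_diff] linear_0[OF linear_edge_diff]
  linear_add[OF linear_edge_div] linear_diff[OF linear_edge_div] linear_scale[OF linear_edge_div] linear_0[OF linear_edge_div]
  linear_add[OF linear_graph_lap] linear_diff[OF linear_graph_lap] linear_scale[OF linear_graph_lap] linear_0[OF linear_graph_lap]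

text \<open>The largest eigenvalue of the Laplacian is at most twice the largest degree; this is the version
  with individual degrees.\<close>

lemma norm_edge_diff_bound:
  assumes "irrefl E"
  shows "(norm (edge_diff E y))\<^sup>2 \<le> 2 * (\<Sum>i\<in>UNIV. real (deg E i) * (norm (y $ i))\<^sup>2)"
proof -
  have "(norm (edge_diff E y))\<^sup>2 = edge_diff E y \<bullet> edge_diff E y" by (rule power2_norm_eq_inner)
  also have "\<dots> = (\<Sum>e\<in>UNIV. if e \<in> E then (norm (y $ snd e - y $ fst e))\<^sup>2 else 0)"
    unfolding inner_vec_def by (intro sum.cong) (auto simp: edge_diff_def power2_norm_eq_inner)
  also have "\<dots> = (\<Sum>e\<in>E. (norm (y $ snd e - y $ fst e))\<^sup>2)" by (simp flip: sum.inter_filter)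
  also have "\<dots> \<le> (\<Sum>e\<in>E. 2 * ((norm (y $ snd e))\<^sup>2 + (norm (y $ fst e))\<^sup>2))"
  proof (rule sum_mono)
    fix e
    have "0 \<le> (norm (y $ snd e + y $ fst e))\<^sup>2" by simp
    then show "(norm (y $ snd e - y $ fst e))\<^sup>2 \<le> 2 * ((norm (y $ snd e))\<^sup>2 + (norm (y $ fst e))\<^sup>2)"
      by (simp add: power2_norm_eq_inner inner_simps inner_commute)
  qed
  also have "\<dots> = 2 * (\<Sum>i\<in>UNIV. real (deg E i) * (norm (y $ i))\<^sup>2)"
    by (simp only: sum_distrib_left[symmetric] handshake[OF assms, of "\<lambda>i. (norm (y $ i))\<^sup>2"])
  finally show ?thesis .
qed

text \<open>Young's inequality on each edge, with weights \<open>1/2\<close> at the two endpoints and \<open>1\<close> on the edge: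
  the weights behind \<open>1/2 deg\<close> in the bounds for the players' step sizes and \<open>1\<close> in
  those for the edges.\<close>

lemma inner_edge_diff_bound:
  assumes "irrefl E"
  shows "edge_diff E y \<bullet> w \<le> 1/2 * (\<Sum>i\<in>UNIV. real (deg E i) * (norm (y $ i))\<^sup>2)
    + (\<Sum>e\<in>UNIV. (if e \<in> E then 1 else 0) * (norm (w $ e))\<^sup>2)"
proof -
  have "edge_diff E y \<bullet> w = (\<Sum>e\<in>UNIV. if e \<in> E then (y $ snd e - y $ fst e) \<bullet> w $ e else 0)"
    unfolding inner_vec_def by (intro sum.cong) (auto simp: edge_diff_def)
  also have "\<dots> = (\<Sum>e\<in>E. (y $ snd e - y $ fst e) \<bullet> w $ e)" by (simp flip: sum.inter_filter)
  also have "\<dots> \<le> (\<Sum>e\<in>E. 1/2 * ((norm (y $ snd e))\<^sup>2 + (norm (y $ fst e))\<^sup>2) + (norm (w $ e))\<^sup>2)"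
  proof (rule sum_mono)
    fix e
    have "0 \<le> (norm (y $ snd e - w $ e))\<^sup>2 + (norm (y $ fst e + w $ e))\<^sup>2" by simp
    then show "(y $ snd e - y $ fst e) \<bullet> w $ e
        \<le> 1/2 * ((norm (y $ snd e))\<^sup>2 + (norm (y $ fst e))\<^sup>2) + (norm (w $ e))\<^sup>2"
      by (simp add: power2_norm_eq_inner inner_simps inner_commute field_simps)
  qed
  also have "\<dots> = 1/2 * (\<Sum>i\<in>UNIV. real (deg E i) * (norm (y $ i))\<^sup>2) + (\<Sum>e\<in>E. (norm (w $ e))\<^sup>2)"
    using handshake[OF assms, of "\<lambda>i. (norm (y $ i))\<^sup>2"]
    by (simp add: sum.distrib flip: sum_distrib_left sum_divide_distrib)
  also have "(\<Sum>e\<in>E. (norm (w $ e))\<^sup>2) = (\<Sum>e\<in>UNIV. if e \<in> E then (norm (w $ e))\<^sup>2 else 0)"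
    by (simp flip: sum.inter_filter)
  also have "\<dots> = (\<Sum>e\<in>UNIV. (if e \<in> E then 1 else 0) * (norm (w $ e))\<^sup>2)"
    by (intro sum.cong) auto
  finally show ?thesis .
qed

text \<open>Young's inequality for each matrix entry, followed by summation along columns for \<open>x\<close> and along
  rows for \<open>l\<close>; hence the 1-norm appears in the condition on \<open>tau1\<close> and the maximum norm in that on
  \<open>tau2\<close>.\<close>

lemma bilinear_induced_norm_bound:
  fixes M :: "real^'n::finite^'m::finite"
  shows "(M *v x) \<bullet> l \<le> 1/2 * matrix_norm_1 M * (norm x)\<^sup>2 + 1/2 * matrix_norm_inf M * (norm l)\<^sup>2"
proof -
  have col: "(\<Sum>r\<in>UNIV. \<bar>M $ r $ c\<bar>) \<le> matrix_norm_1 M" for c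
    unfolding matrix_norm_1_def by (intro Max_ge) auto
  have row: "(\<Sum>c\<in>UNIV. \<bar>M $ r $ c\<bar>) \<le> matrix_norm_inf M" for r
    unfolding matrix_norm_inf_def by (intro Max_ge) auto
  have nx: "(norm v)\<^sup>2 = (\<Sum>c\<in>UNIV. (v $ c)\<^sup>2)" for v :: "real^'k::finite"
    unfolding power2_norm_eq_inner inner_vec_def by (simp add: power2_eq_square)
  have "(M *v x) \<bullet> l = (\<Sum>r\<in>UNIV. \<Sum>c\<in>UNIV. M $ r $ c * x $ c * l $ r)"
    by (simp add: inner_vec_def matrix_vector_mult_def sum_distrib_right)
  also have "\<dots> \<le> (\<Sum>r\<in>UNIV. \<Sum>c\<in>UNIV. 1/2 * (\<bar>M $ r $ c\<bar> * (x $ c)\<^sup>2) + 1/2 * (\<bar>M $ r $ c\<bar> * (l $ r)\<^sup>2))"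
  proof (intro sum_mono)
    fix r c
    have "\<bar>x $ c * l $ r\<bar> \<le> 1/2 * ((x $ c)\<^sup>2 + (l $ r)\<^sup>2)"
      using sum_squares_bound[of "x $ c" "l $ r"] sum_squares_bound[of "x $ c" "- (l $ r)"]
      by (simp add: abs_le_iff)
    then have "\<bar>M $ r $ c\<bar> * \<bar>x $ c * l $ r\<bar> \<le> \<bar>M $ r $ c\<bar> * (1/2 * ((x $ c)\<^sup>2 + (l $ r)\<^sup>2))"
      by (intro mult_left_mono) auto
    moreover have "M $ r $ c * x $ c * l $ r \<le> \<bar>M $ r $ c\<bar> * \<bar>x $ c * l $ r\<bar>"
      by (metis abs_ge_self abs_mult mult.assoc)
    ultimately show "M $ r $ c * x $ c * l $ r
        \<le> 1/2 * (\<bar>M $ r $ c\<bar> * (x $ c)\<^sup>2) + 1/2 * (\<bar>M $ r $ c\<bar> * (l $ r)\<^sup>2)"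
      by (simp add: algebra_simps)
  qed
  also have "\<dots> = 1/2 * (\<Sum>r\<in>UNIV. \<Sum>c\<in>UNIV. \<bar>M $ r $ c\<bar> * (x $ c)\<^sup>2)
      + 1/2 * (\<Sum>r\<in>UNIV. \<Sum>c\<in>UNIV. \<bar>M $ r $ c\<bar> * (l $ r)\<^sup>2)"
    by (simp only: sum.distrib sum_distrib_left)
  also have "(\<Sum>r\<in>UNIV. \<Sum>c\<in>UNIV. \<bar>M $ r $ c\<bar> * (x $ c)\<^sup>2)
      = (\<Sum>c\<in>UNIV. (\<Sum>r\<in>UNIV. \<bar>M $ r $ c\<bar>) * (x $ c)\<^sup>2)"
    by (subst sum.swap) (simp add: sum_distrib_right)
  also have "(\<Sum>r\<in>UNIV. \<Sum>c\<in>UNIV. \<bar>M $ r $ c\<bar> * (l $ r)\<^sup>2)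
      = (\<Sum>r\<in>UNIV. (\<Sum>c\<in>UNIV. \<bar>M $ r $ c\<bar>) * (l $ r)\<^sup>2)"
    by (simp add: sum_distrib_right)
  finally have "(M *v x) \<bullet> l \<le> 1/2 * (\<Sum>c\<in>UNIV. (\<Sum>r\<in>UNIV. \<bar>M $ r $ c\<bar>) * (x $ c)\<^sup>2)
      + 1/2 * (\<Sum>r\<in>UNIV. (\<Sum>c\<in>UNIV. \<bar>M $ r $ c\<bar>) * (l $ r)\<^sup>2)" .
  moreover have "(\<Sum>c\<in>UNIV. (\<Sum>r\<in>UNIV. \<bar>M $ r $ c\<bar>) * (x $ c)\<^sup>2) \<le> matrix_norm_1 M * (norm x)\<^sup>2"
    unfolding nx sum_distrib_left by (intro sum_mono mult_right_mono col) auto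
  moreover have "(\<Sum>r\<in>UNIV. (\<Sum>c\<in>UNIV. \<bar>M $ r $ c\<bar>) * (l $ r)\<^sup>2) \<le> matrix_norm_inf M * (norm l)\<^sup>2"
    unfolding nx sum_distrib_left by (intro sum_mono mult_right_mono row) auto
  ultimately show ?thesis by linarith
qed

lemma weighted_norm_sum_pos:
  fixes x :: "'a::euclidean_space^'k::finite"
  assumes "\<And>i. 0 < a i" "x \<noteq> 0"
  shows "0 < (\<Sum>i\<in>UNIV. a i * (norm (x $ i))\<^sup>2)"
proof -
  obtain i where "x $ i \<noteq> 0" using assms(2) by (auto simp: vec_eq_iff)
  then have "0 < a i * (norm (x $ i))\<^sup>2" using assms(1) by simp
  then show ?thesis
    using less_imp_le[OF assms(1)] by (intro sum_pos2[of _ i]) auto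
qed

section \<open>Preconditioner and operators\<close>

text \<open>The value \<open>1\<close> off the edge set keeps the preconditioner definite on the inert components.\<close>

definition edge_weight :: "('p \<times> 'p) set \<Rightarrow> ('p \<times> 'p \<Rightarrow> real) \<Rightarrow> 'p \<times> 'p \<Rightarrow> real" where
  "edge_weight E \<tau> e = (if e \<in> E then 1 / \<tau> e else 1)"

definition precond ::
    "('p::finite, 'n::finite, 'm::finite) game \<Rightarrow> ('p, 'm) network \<Rightarrow>
     (real^'n^'p) \<times> (real^'m^'p) \<times> (real^'n^('p \<times> 'p)) \<times> (real^'m^('p \<times> 'p)) \<Rightarrow>
     (real^'n^'p) \<times> (real^'m^'p) \<times> (real^'n^('p \<times> 'p)) \<times> (real^'m^('p \<times> 'p))" where
  "precond G P = (\<lambda>(y, l, m, z).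
    (scale_comp (\<lambda>i. 1 / tau1 P i) y - (rho_mu P / 2) *\<^sub>R graph_lap (edges P) y
       - (1/2) *\<^sub>R cblk_tmult G l - (1/2) *\<^sub>R edge_div (edges P) m,
     scale_comp (\<lambda>i. 1 / tau2 P i) l - (rho_z P / 2) *\<^sub>R graph_lap (edges P) l
       - (1/2) *\<^sub>R cblk_mult G y - (1/2) *\<^sub>R edge_div (edges P) z,
     scale_comp (edge_weight (edges P) (tau3 P)) m - (1/2) *\<^sub>R edge_diff (edges P) y,
     scale_comp (edge_weight (edges P) (tau4 P)) z - (1/2) *\<^sub>R edge_diff (edges P) l))"

lemma linear_precond: "linear (precond G P)"
  by (rule linearI) (auto simp: precond_def stack_linear algebra_simps split: prod.splits)

lemma precond_selfadjoint: "precond G P x \<bullet> x' = x \<bullet> precond G P x'"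
proof -
  obtain y l m z where x: "x = (y, l, m, z)" by (cases x) auto
  obtain y' l' m' z' where x': "x' = (y', l', m', z')" by (cases x') auto
  have "cblk_tmult G l \<bullet> y' = l \<bullet> cblk_mult G y'" by (metis cblk_mult_adjoint inner_commute)
  then show ?thesis
    by (simp add: x x' edge_div_adjoint precond_def inner_diff_left inner_diff_right cblk_mult_adjoint edge_diff_adjoint
        graph_lap_selfadjoint scale_comp_selfadjoint)
qed


text \<open>The KKT conditions with a copy of \<open>(x, \<lambda>)\<close> for every player, consensus being enforced by
  the edge variables \<open>m\<close> and \<open>z\<close>, but with only half of the couplings and half of the Laplacians;
  \<open>coupling_op\<close> is the other half.\<close>

definition kkt_op ::
    "('p::finite, 'n::finite, 'm::finite) game \<Rightarrow> ('p, 'm) network \<Rightarrow>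
     (real^'n^'p) \<times> (real^'m^'p) \<times> (real^'n^('p \<times> 'p)) \<times> (real^'m^('p \<times> 'p)) \<Rightarrow>
     ((real^'n^'p) \<times> (real^'m^'p) \<times> (real^'n^('p \<times> 'p)) \<times> (real^'m^('p \<times> 'p))) set" where
  "kkt_op G P = (\<lambda>(y, l, m, z). {
     ((\<chi> i. g i + n i) + (rho_mu P / 2) *\<^sub>R graph_lap (edges P) y
        + (1/2) *\<^sub>R cblk_tmult G l + (1/2) *\<^sub>R edge_div (edges P) m,
      \<nu> + (\<chi> i. rhs_share P i) + (rho_z P / 2) *\<^sub>R graph_lap (edges P) l
        - (1/2) *\<^sub>R cblk_mult G y + (1/2) *\<^sub>R edge_div (edges P) z,
      - ((1/2) *\<^sub>R edge_diff (edges P) y),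
      - ((1/2) *\<^sub>R edge_diff (edges P) l)) | g n \<nu>.
     (\<forall>i. g i \<in> partial_subdiff G i (y $ i)) \<and>
     (\<forall>i. n i \<in> normal_cone (dspace G i) (feas G i) (blk G i (y $ i))) \<and>
     (\<forall>i. \<nu> $ i \<in> normal_cone UNIV nonneg_orthant (l $ i))})"

definition coupling_op ::
    "('p::finite, 'n::finite, 'm::finite) game \<Rightarrow> ('p, 'm) network \<Rightarrow>
     (real^'n^'p) \<times> (real^'m^'p) \<times> (real^'n^('p \<times> 'p)) \<times> (real^'m^('p \<times> 'p)) \<Rightarrow>
     (real^'n^'p) \<times> (real^'m^'p) \<times> (real^'n^('p \<times> 'p)) \<times> (real^'m^('p \<times> 'p))" where
  "coupling_op G P = (\<lambda>(y, l, m, z).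
     ((rho_mu P / 2) *\<^sub>R graph_lap (edges P) y
        + (1/2) *\<^sub>R cblk_tmult G l + (1/2) *\<^sub>R edge_div (edges P) m,
      (rho_z P / 2) *\<^sub>R graph_lap (edges P) l
        - (1/2) *\<^sub>R cblk_mult G y + (1/2) *\<^sub>R edge_div (edges P) z,
      - ((1/2) *\<^sub>R edge_diff (edges P) y),
      - ((1/2) *\<^sub>R edge_diff (edges P) l)))"

lemma linear_coupling_op: "linear (coupling_op G P)"
  by (rule linearI) (auto simp: coupling_op_def stack_linear algebra_simps split: prod.splits)

text \<open>The constraint and incidence blocks are skew and cancel; the energies of the Laplacians remain.\<close>

lemma coupling_op_nonneg:
  assumes "0 \<le> rho_mu P" "0 \<le> rho_z P"
  shows "0 \<le> coupling_op G P x \<bullet> x"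
proof -
  obtain y l m z where x: "x = (y, l, m, z)" by (cases x) auto
  have "cblk_tmult G l \<bullet> y = y \<bullet> cblk_tmult G l" "edge_div (edges P) m \<bullet> y = y \<bullet> edge_div (edges P) m"
    "edge_div (edges P) z \<bullet> l = l \<bullet> edge_div (edges P) z" by (simp_all add: inner_commute)
  then have "coupling_op G P x \<bullet> x = (rho_mu P / 2) * (norm (edge_diff (edges P) y))\<^sup>2
      + (rho_z P / 2) * (norm (edge_diff (edges P) l))\<^sup>2"
    by (simp add: x coupling_op_def inner_add_left inner_diff_left graph_lap_energy cblk_mult_adjoint
        edge_diff_adjoint)
  then show ?thesis using assms by simp
qed

lemma normal_cone_monotone:
  assumes "u \<in> normal_cone V S x" "v \<in> normal_cone V S y"
  shows "0 \<le> (u - v) \<bullet> (x - y)"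
proof -
  have "u \<bullet> (y - x) \<le> 0" "v \<bullet> (x - y) \<le> 0" using assms by (auto simp: normal_cone_def)
  then show ?thesis by (simp add: inner_simps)
qed

lemma normal_cone_scale:
  assumes "subspace V" "u \<in> normal_cone V S x" "0 \<le> c"
  shows "c *\<^sub>R u \<in> normal_cone V S x"
  using assms by (auto simp: normal_cone_def subspace_scale intro: mult_nonneg_nonpos)

lemma normal_cone_sum:
  assumes "subspace V" "finite I" "I \<noteq> {}" "\<And>i. i \<in> I \<Longrightarrow> u i \<in> normal_cone V S x"
  shows "(\<Sum>i\<in>I. u i) \<in> normal_cone V S x"
  using assms by (auto simp: normal_cone_def inner_sum_left intro!: subspace_sum sum_nonpos)

lemma kkt_iff:
  "kkt G x l \<longleftrightarrow>
     (\<forall>i. \<exists>g\<in>partial_subdiff G i x. \<exists>n\<in>normal_cone (dspace G i) (feas G i) (blk G i x).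
        g + n + transpose (cmat_blk G i) *v l = 0) \<and>
     cmat G *v x - crhs G \<in> normal_cone UNIV nonneg_orthant l"
proof -
  have "0 \<in> {g + transpose (cmat_blk G i) *v l + v | g v.
       g \<in> partial_subdiff G i x \<and> v \<in> normal_cone (dspace G i) (feas G i) (blk G i x)} \<longleftrightarrow>
     (\<exists>g\<in>partial_subdiff G i x. \<exists>n\<in>normal_cone (dspace G i) (feas G i) (blk G i x).
        g + n + transpose (cmat_blk G i) *v l = 0)" for i
    by (auto simp: algebra_simps)
  moreover have eq: "0 = - c + v \<longleftrightarrow> v = c" for c v :: "real^'c"
    by (simp add: eq_commute[of 0] add_eq_0_iff)
  have "0 \<in> {- (cmat G *v x - crhs G) + v | v. v \<in> normal_cone UNIV nonneg_orthant l} \<longleftrightarrow>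
      cmat G *v x - crhs G \<in> normal_cone UNIV nonneg_orthant l"
    unfolding mem_Collect_eq eq by simp
  ultimately show ?thesis unfolding kkt_def by simp
qed

section \<open>The algorithm as a Douglas--Rachford iteration\<close>

text \<open>The values outside the edge set are discarded, since the algorithm updates them with
  uncontrolled step sizes without ever using them.\<close>

definition edge_vec :: "('p::finite \<times> 'p) set \<Rightarrow> ('p \<times> 'p \<Rightarrow> 'a::euclidean_space) \<Rightarrow> 'a^('p \<times> 'p)" where
  "edge_vec E f = (\<chi> e. if e \<in> E then f e else 0)"

lemma edge_div_edge_vec: "edge_div E (edge_vec E f) $ i = edge_balance E i f"
  by (simp add: edge_div_def edge_balance_def edge_vec_def nbr_in_def nbr_out_def)

lemma edge_vec_diff_scale: "edge_vec E (\<lambda>e. f e - c *\<^sub>R g e) = edge_vec E f - c *\<^sub>R edge_vec E g"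
  by (auto simp: edge_vec_def vec_eq_iff)

definition stacked ::
    "('p::finite, 'm::finite) network \<Rightarrow> ('p, 'n::finite, 'm) alg_state \<Rightarrow>
     (real^'n^'p) \<times> (real^'m^'p) \<times> (real^'n^('p \<times> 'p)) \<times> (real^'m^('p \<times> 'p))" where
  "stacked P s = (y_t s, lam_t s, edge_vec (edges P) (mu_t s), edge_vec (edges P) (z_t s))"

definition stacked_new ::
    "('p::finite, 'n::finite, 'm::finite) game \<Rightarrow> ('p, 'm) network \<Rightarrow> ('p, 'n, 'm) alg_state \<Rightarrow>
     (real^'n^'p) \<times> (real^'m^'p) \<times> (real^'n^('p \<times> 'p)) \<times> (real^'m^('p \<times> 'p))" where
  "stacked_new G P s =
     (y_new G P s, lam_new G P s, edge_vec (edges P) (mu_new G P s), edge_vec (edges P) (z_new G P s))"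

lemma closed_range_stacked:
  "closed (range (stacked P :: ('p::finite, 'n::finite, 'm::finite) alg_state \<Rightarrow> _))"
proof -
  let ?S = "{x :: (real^'n^'p) \<times> (real^'m^'p) \<times> (real^'n^('p \<times> 'p)) \<times> (real^'m^('p \<times> 'p)).
     \<forall>e. e \<notin> edges P \<longrightarrow> fst (snd (snd x)) $ e = 0 \<and> snd (snd (snd x)) $ e = 0}"
  have "range (stacked P) = ?S"
  proof (intro subset_antisym subsetI)
    fix x assume x: "x \<in> ?S"
    obtain y l m z where "x = (y, l, m, z)" by (cases x) auto
    with x have "x = stacked P \<lparr>y_t = y, lam_t = l, mu_t = ($) m, z_t = ($) z\<rparr>"
      by (auto simp: stacked_def edge_vec_def vec_eq_iff)
    then show "x \<in> range (stacked P)" by (rule range_eqI)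
  qed (auto simp: stacked_def edge_vec_def)
  moreover have "subspace ?S" by (auto simp: subspace_def)
  ultimately show ?thesis by (simp add: closed_subspace)
qed

lemma convex_nonneg_orthant: "convex (nonneg_orthant :: (real^'m::finite) set)"
  by (auto simp: convex_def nonneg_orthant_def)

lemma closed_nonneg_orthant: "closed (nonneg_orthant :: (real^'m::finite) set)"
  unfolding nonneg_orthant_def Collect_all_eq
  by (intro closed_INT ballI closed_halfspace_component_ge_cart)

lemma projection_residual_normal:
  fixes p :: "'a::euclidean_space"
  assumes "convex S" "closed S" "S \<noteq> {}"
  shows "p - closest_point S p \<in> normal_cone UNIV S (closest_point S p)"
  using assms closest_point_dot[OF assms(1,2)] closest_point_in_set by (auto simp: normal_cone_def)

text \<open>All updates of edge variables have this form, where \<open>d\<close> is an edge difference; off the edge set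
  both sides are \<open>0\<close>.\<close>

lemma edge_step_scaled:
  assumes "\<And>e. e \<in> E \<Longrightarrow> 0 < \<tau> e" "\<And>e. e \<in> E \<Longrightarrow> f' e = f e + \<tau> e *\<^sub>R d $ e" "\<And>e. e \<notin> E \<Longrightarrow> d $ e = 0"
  shows "scale_comp (edge_weight E \<tau>) (edge_vec E f - edge_vec E f') = - d"
proof -
  have "scale_comp (edge_weight E \<tau>) (edge_vec E f - edge_vec E f') $ e = (- d) $ e" for e
    using assms(1)[of e] assms(2)[of e] assms(3)[of e]
    by (cases "e \<in> E") (simp_all add: scale_comp_def edge_weight_def edge_vec_def)
  then show ?thesis by (simp add: vec_eq_iff)
qed

text \<open>The lemmas in this context share one set of assumptions: convexity of the game,
  connectivity of the network, monotonicity, and the step size conditions, which are used in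
  \<open>precond_pos\<close>.\<close>

locale gne_algorithm =
  fixes G :: "('p::finite, 'n::finite, 'm::finite) game"
    and P :: "('p, 'm) network"
  assumes costs: "convex_costs G"
    and feas_dspace: "\<And>i. feas G i \<subseteq> dspace G i"
    and feas_closed: "\<And>i. closed (feas G i)"
    and feas_convex: "\<And>i. convex (feas G i)"
    and slater: "slater G"
    and graph_connected: "weakly_connected (edges P)"
    and graph_loopfree: "irrefl (edges P)"
    and v_gne_exists: "\<exists>x. v_gne G x"
    and mono: "monotone_op (reg_pseudograd G (edges P) (rho_mu P))"
    and rho_mu_nonneg: "0 \<le> rho_mu P"
    and rho_z_nonneg: "0 \<le> rho_z P"
    and rhs_shares: "(\<Sum>i\<in>UNIV. rhs_share P i) = crhs G"
    and tau1_pos: "\<And>i. 0 < tau1 P i"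
    and tau2_pos: "\<And>i. 0 < tau2 P i"
    and tau3_pos: "\<And>e. e \<in> edges P \<Longrightarrow> 0 < tau3 P e"
    and tau4_pos: "\<And>e. e \<in> edges P \<Longrightarrow> 0 < tau4 P e"
    and tau1_bound: "\<And>i. inverse (tau1 P i) >
          1/2 * matrix_norm_1 (cmat_blk G i) + (1/2 + rho_mu P) * real (deg (edges P) i)"
    and tau2_bound: "\<And>i. inverse (tau2 P i) >
          1/2 * matrix_norm_inf (cmat_blk G i) + (1/2 + rho_z P) * real (deg (edges P) i)"
    and tau3_bound: "\<And>e. e \<in> edges P \<Longrightarrow> inverse (tau3 P e) > 1"
    and tau4_bound: "\<And>e. e \<in> edges P \<Longrightarrow> inverse (tau4 P e) > 1"
begin

text \<open>The quadratic form dominates the weighted sum of squares whose coefficients \<open>a\<close>, \<open>b\<close>, \<open>c3\<close>, \<open>c4\<close>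
  are the gaps in the step size conditions, that is, in the diagonal dominance of the rows.\<close>

lemma precond_pos:
  assumes "x \<noteq> 0"
  shows "0 < precond G P x \<bullet> x"
proof -
  obtain y l m z where x: "x = (y, l, m, z)" by (cases x) auto
  let ?E = "edges P"
  let ?d = "\<lambda>i. real (deg ?E i)"
  define a where "a i = 1 / tau1 P i - 1/2 * matrix_norm_1 (cmat_blk G i) - (1/2 + rho_mu P) * ?d i" for i
  define b where "b i = 1 / tau2 P i - 1/2 * matrix_norm_inf (cmat_blk G i) - (1/2 + rho_z P) * ?d i" for i
  define c3 where "c3 e = edge_weight ?E (tau3 P) e - (if e \<in> ?E then 1 else 0)" for e
  define c4 where "c4 e = edge_weight ?E (tau4 P) e - (if e \<in> ?E then 1 else 0)" for e
  define Sy where "Sy f = (\<Sum>i\<in>UNIV. f i * (norm (y $ i))\<^sup>2)" for f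
  define Sl where "Sl f = (\<Sum>i\<in>UNIV. f i * (norm (l $ i))\<^sup>2)" for f
  define Sm where "Sm f = (\<Sum>e\<in>UNIV. f e * (norm (m $ e))\<^sup>2)" for f
  define Sz where "Sz f = (\<Sum>e\<in>UNIV. f e * (norm (z $ e))\<^sup>2)" for f
  have pos: "\<And>i. 0 < a i" "\<And>i. 0 < b i" "\<And>e. 0 < c3 e" "\<And>e. 0 < c4 e"
    using tau1_bound tau2_bound tau3_bound tau4_bound
    by (auto simp: a_def b_def c3_def c4_def edge_weight_def inverse_eq_divide algebra_simps)
  have comm: "cblk_tmult G l \<bullet> y = cblk_mult G y \<bullet> l" "edge_div ?E m \<bullet> y = edge_diff ?E y \<bullet> m"
    "edge_div ?E z \<bullet> l = edge_diff ?E l \<bullet> z"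
    by (metis cblk_mult_adjoint inner_commute, (metis edge_div_adjoint inner_commute)+)
  have form: "precond G P x \<bullet> x = Sy (\<lambda>i. 1 / tau1 P i) + Sl (\<lambda>i. 1 / tau2 P i)
      + Sm (edge_weight ?E (tau3 P)) + Sz (edge_weight ?E (tau4 P))
      - (rho_mu P / 2) * (norm (edge_diff ?E y))\<^sup>2 - (rho_z P / 2) * (norm (edge_diff ?E l))\<^sup>2
      - cblk_mult G y \<bullet> l - edge_diff ?E y \<bullet> m - edge_diff ?E l \<bullet> z"
    by (simp add: x precond_def inner_diff_left graph_lap_energy inner_scale_comp comm
        Sy_def Sl_def Sm_def Sz_def)
  have lapy: "(rho_mu P / 2) * (norm (edge_diff ?E y))\<^sup>2 \<le> rho_mu P * Sy ?d"
    using mult_left_mono[OF norm_edge_diff_bound[OF graph_loopfree, of y], of "rho_mu P / 2"] rho_mu_nonneg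
    by (simp add: Sy_def)
  have lapl: "(rho_z P / 2) * (norm (edge_diff ?E l))\<^sup>2 \<le> rho_z P * Sl ?d"
    using mult_left_mono[OF norm_edge_diff_bound[OF graph_loopfree, of l], of "rho_z P / 2"] rho_z_nonneg
    by (simp add: Sl_def)
  have my: "edge_diff ?E y \<bullet> m \<le> 1/2 * Sy ?d + Sm (\<lambda>e. if e \<in> ?E then 1 else 0)"
    using inner_edge_diff_bound[OF graph_loopfree, of y m] by (simp add: Sy_def Sm_def)
  have zl: "edge_diff ?E l \<bullet> z \<le> 1/2 * Sl ?d + Sz (\<lambda>e. if e \<in> ?E then 1 else 0)"
    using inner_edge_diff_bound[OF graph_loopfree, of l z] by (simp add: Sl_def Sz_def)
  have "cblk_mult G y \<bullet> l = (\<Sum>i\<in>UNIV. (cmat_blk G i *v (y $ i)) \<bullet> l $ i)"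
    by (simp add: cblk_mult_def inner_vec_def[of _ l])
  also have "\<dots> \<le> (\<Sum>i\<in>UNIV. 1/2 * matrix_norm_1 (cmat_blk G i) * (norm (y $ i))\<^sup>2
      + 1/2 * matrix_norm_inf (cmat_blk G i) * (norm (l $ i))\<^sup>2)"
    by (intro sum_mono bilinear_induced_norm_bound)
  finally have yl: "cblk_mult G y \<bullet> l \<le> Sy (\<lambda>i. 1/2 * matrix_norm_1 (cmat_blk G i))
      + Sl (\<lambda>i. 1/2 * matrix_norm_inf (cmat_blk G i))"
    unfolding Sy_def Sl_def sum.distrib .
  have "Sy a = Sy (\<lambda>i. 1 / tau1 P i) - Sy (\<lambda>i. 1/2 * matrix_norm_1 (cmat_blk G i)) - 1/2 * Sy ?d - rho_mu P * Sy ?d"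
    by (simp add: Sy_def a_def sum_subtractf[symmetric] sum_distrib_left algebra_simps)
  moreover have "Sl b = Sl (\<lambda>i. 1 / tau2 P i) - Sl (\<lambda>i. 1/2 * matrix_norm_inf (cmat_blk G i)) - 1/2 * Sl ?d - rho_z P * Sl ?d"
    by (simp add: Sl_def b_def sum_subtractf[symmetric] sum_distrib_left algebra_simps)
  moreover have "Sm c3 = Sm (edge_weight ?E (tau3 P)) - Sm (\<lambda>e. if e \<in> ?E then 1 else 0)"
    by (simp add: Sm_def c3_def sum_subtractf[symmetric] left_diff_distrib)
  moreover have "Sz c4 = Sz (edge_weight ?E (tau4 P)) - Sz (\<lambda>e. if e \<in> ?E then 1 else 0)"
    by (simp add: Sz_def c4_def sum_subtractf[symmetric] left_diff_distrib)
  ultimately have "Sy a + Sl b + Sm c3 + Sz c4 \<le> precond G P x \<bullet> x"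
    unfolding form using lapy lapl my zl yl by linarith
  moreover have "0 < Sy a + Sl b + Sm c3 + Sz c4"
  proof -
    have nonneg: "0 \<le> Sy a" "0 \<le> Sl b" "0 \<le> Sm c3" "0 \<le> Sz c4"
      unfolding Sy_def Sl_def Sm_def Sz_def using pos[THEN less_imp_le]
      by (auto intro!: sum_nonneg mult_nonneg_nonneg)
    have "y \<noteq> 0 \<or> l \<noteq> 0 \<or> m \<noteq> 0 \<or> z \<noteq> 0" using assms by (auto simp: x zero_prod_def)
    then have "0 < Sy a \<or> 0 < Sl b \<or> 0 < Sm c3 \<or> 0 < Sz c4"
      unfolding Sy_def Sl_def Sm_def Sz_def
      using weighted_norm_sum_pos[of a y, OF pos(1)] weighted_norm_sum_pos[of b l, OF pos(2)]
        weighted_norm_sum_pos[of c3 m, OF pos(3)] weighted_norm_sum_pos[of c4 z, OF pos(4)] by argo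
    with nonneg show ?thesis by linarith
  qed
  ultimately show ?thesis by linarith
qed

text \<open>The skew couplings cancel, which leaves the regularized pseudogradient, the two kinds of normal
  cones and the energy of the Laplacian of the multipliers.\<close>

lemma kkt_op_monotone: "monotone_op (kkt_op G P)"
  unfolding monotone_op_def
proof (intro allI ballI)
  fix x x' u u' assume u: "u \<in> kkt_op G P x" and u': "u' \<in> kkt_op G P x'"
  let ?E = "edges P"
  obtain y l m z where x: "x = (y, l, m, z)" by (cases x) auto
  obtain y' l' m' z' where x': "x' = (y', l', m', z')" by (cases x') auto
  obtain g n \<nu> where g: "\<And>i. g i \<in> partial_subdiff G i (y $ i)"
    "\<And>i. n i \<in> normal_cone (dspace G i) (feas G i) (blk G i (y $ i))"
    "\<And>i. \<nu> $ i \<in> normal_cone UNIV nonneg_orthant (l $ i)"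
    and u_eq: "u = ((\<chi> i. g i + n i) + (rho_mu P / 2) *\<^sub>R graph_lap ?E y
        + (1/2) *\<^sub>R cblk_tmult G l + (1/2) *\<^sub>R edge_div ?E m,
      \<nu> + (\<chi> i. rhs_share P i) + (rho_z P / 2) *\<^sub>R graph_lap ?E l
        - (1/2) *\<^sub>R cblk_mult G y + (1/2) *\<^sub>R edge_div ?E z,
      - ((1/2) *\<^sub>R edge_diff ?E y), - ((1/2) *\<^sub>R edge_diff ?E l))"
    using u unfolding kkt_op_def x by auto
  obtain g' n' \<nu>' where g': "\<And>i. g' i \<in> partial_subdiff G i (y' $ i)"
    "\<And>i. n' i \<in> normal_cone (dspace G i) (feas G i) (blk G i (y' $ i))"
    "\<And>i. \<nu>' $ i \<in> normal_cone UNIV nonneg_orthant (l' $ i)"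
    and u'_eq: "u' = ((\<chi> i. g' i + n' i) + (rho_mu P / 2) *\<^sub>R graph_lap ?E y'
        + (1/2) *\<^sub>R cblk_tmult G l' + (1/2) *\<^sub>R edge_div ?E m',
      \<nu>' + (\<chi> i. rhs_share P i) + (rho_z P / 2) *\<^sub>R graph_lap ?E l'
        - (1/2) *\<^sub>R cblk_mult G y' + (1/2) *\<^sub>R edge_div ?E z',
      - ((1/2) *\<^sub>R edge_diff ?E y'), - ((1/2) *\<^sub>R edge_diff ?E l'))"
    using u' unfolding kkt_op_def x' by auto
  define dy dl dm dz where d: "dy = y - y'" "dl = l - l'" "dm = m - m'" "dz = z - z'"
  have eq: "u - u' = ((\<chi> i. g i - g' i) + (rho_mu P / 2) *\<^sub>R graph_lap ?E dy + (\<chi> i. n i - n' i)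
        + (1/2) *\<^sub>R cblk_tmult G dl + (1/2) *\<^sub>R edge_div ?E dm,
      (\<nu> - \<nu>') + (rho_z P / 2) *\<^sub>R graph_lap ?E dl - (1/2) *\<^sub>R cblk_mult G dy + (1/2) *\<^sub>R edge_div ?E dz,
      - ((1/2) *\<^sub>R edge_diff ?E dy), - ((1/2) *\<^sub>R edge_diff ?E dl))"
    by (simp add: u_eq u'_eq d stack_linear vec_eq_iff algebra_simps)
  have dx: "x - x' = (dy, dl, dm, dz)" by (simp add: x x' d)
  have comm: "cblk_tmult G dl \<bullet> dy = dy \<bullet> cblk_tmult G dl" "edge_div ?E dm \<bullet> dy = dy \<bullet> edge_div ?E dm"
    "edge_div ?E dz \<bullet> dl = dl \<bullet> edge_div ?E dz" by (simp_all add: inner_commute)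
  have "(u - u') \<bullet> (x - x') = ((\<chi> i. g i - g' i) + (rho_mu P / 2) *\<^sub>R graph_lap ?E dy) \<bullet> dy
      + (\<chi> i. n i - n' i) \<bullet> dy + (\<nu> - \<nu>') \<bullet> dl + (rho_z P / 2) * (norm (edge_diff ?E dl))\<^sup>2"
    by (simp add: eq dx inner_add_left inner_diff_left graph_lap_energy cblk_mult_adjoint
        edge_diff_adjoint comm)
  moreover have "0 \<le> ((\<chi> i. g i - g' i) + (rho_mu P / 2) *\<^sub>R graph_lap ?E dy) \<bullet> dy"
    unfolding d by (rule reg_pseudograd_monotone[OF mono graph_loopfree g(1) g'(1)])
  moreover have "0 \<le> (\<chi> i. n i - n' i) \<bullet> dy"
  proof -
    have "0 \<le> (n i - n' i) \<bullet> dy $ i" for i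
    proof -
      have "n i - n' i \<in> dspace G i"
        using g(2)[of i] g'(2)[of i] by (auto simp: normal_cone_def intro: subspace_diff[OF subspace_dspace])
      then have "(n i - n' i) \<bullet> dy $ i = (n i - n' i) \<bullet> (blk G i (y $ i) - blk G i (y' $ i))"
        using inner_dspace[of "n i - n' i" G i "dy $ i"] by (simp add: d linear_diff[OF linear_blk])
      then show ?thesis using normal_cone_monotone[OF g(2)[of i] g'(2)[of i]] by simp
    qed
    then show ?thesis by (simp add: inner_vec_def[of _ dy] sum_nonneg)
  qed
  moreover have "0 \<le> (\<nu> - \<nu>') \<bullet> dl"
  proof -
    have "0 \<le> (\<nu> $ i - \<nu>' $ i) \<bullet> (l $ i - l' $ i)" for i
      by (rule normal_cone_monotone[OF g(3) g'(3)])
    then show ?thesis unfolding d by (subst inner_vec_def) (simp add: sum_nonneg)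
  qed
  ultimately show "0 \<le> (u - u') \<bullet> (x - x')" using rho_z_nonneg by simp
qed

text \<open>Slater's point serves for the explicit parts produced by any state, because the
  relative interiors of the domains of the own costs do not depend on the rivals.\<close>

lemma y_new_row:
  "\<exists>g n. (\<forall>i. g i \<in> partial_subdiff G i (y_new G P s $ i)) \<and>
    (\<forall>i. n i \<in> normal_cone (dspace G i) (feas G i) (blk G i (y_new G P s $ i))) \<and>
    scale_comp (\<lambda>i. 1 / tau1 P i) (y_t s - y_new G P s) - (rho_mu P / 2) *\<^sub>R graph_lap (edges P) (y_t s)
       - (1/2) *\<^sub>R cblk_tmult G (lam_t s) - (1/2) *\<^sub>R edge_div (edges P) (edge_vec (edges P) (mu_t s))
     = (\<chi> i. g i + n i)"
proof -
  obtain x where x: "\<And>i. blk G i x \<in> rel_interior (feas G i)"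
    "\<And>i. blk G i x \<in> rel_interior {v \<in> dspace G i. own_cost G i x v < \<infinity>}"
    using slater by (auto simp: slater_def)
  have x': "blk G i x \<in> rel_interior {v \<in> dspace G i. own_cost G i w v < \<infinity>}" for i w
    using x(2)[of i] rel_interior_own_cost_domain[OF costs mono graph_loopfree rho_mu_nonneg, of i x w] by simp
  have "\<forall>i. \<exists>g n. g \<in> partial_subdiff G i (y_new G P s $ i) \<and>
      n \<in> normal_cone (dspace G i) (feas G i) (blk G i (y_new G P s $ i)) \<and>
    (1 / tau1 P i) *\<^sub>R (y_t s $ i - y_new G P s $ i) - (rho_mu P / 2) *\<^sub>R graph_lap (edges P) (y_t s) $ i
      - (1/2) *\<^sub>R (transpose (cmat_blk G i) *v (lam_t s $ i))
      - (1/2) *\<^sub>R edge_balance (edges P) i (mu_t s) = g + n"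
    using y_new_inclusion[OF costs feas_closed feas_convex feas_dspace x(1) x' tau1_pos] by blast
  then obtain g n where gn: "\<And>i. g i \<in> partial_subdiff G i (y_new G P s $ i)"
    "\<And>i. n i \<in> normal_cone (dspace G i) (feas G i) (blk G i (y_new G P s $ i))"
    "\<And>i. (1 / tau1 P i) *\<^sub>R (y_t s $ i - y_new G P s $ i) - (rho_mu P / 2) *\<^sub>R graph_lap (edges P) (y_t s) $ i
      - (1/2) *\<^sub>R (transpose (cmat_blk G i) *v (lam_t s $ i))
      - (1/2) *\<^sub>R edge_balance (edges P) i (mu_t s) = g i + n i"
    by metis
  have "scale_comp (\<lambda>i. 1 / tau1 P i) (y_t s - y_new G P s) - (rho_mu P / 2) *\<^sub>R graph_lap (edges P) (y_t s)
       - (1/2) *\<^sub>R cblk_tmult G (lam_t s) - (1/2) *\<^sub>R edge_div (edges P) (edge_vec (edges P) (mu_t s))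
     = (\<chi> i. g i + n i)"
    using gn(3) by (simp add: vec_eq_iff[where 'b = 'p] scale_comp_def cblk_tmult_def edge_div_edge_vec)
  with gn(1,2) show ?thesis by blast
qed

lemma lam_new_row:
  fixes s :: "('p, 'n, 'm) alg_state"
  defines "\<nu> \<equiv> scale_comp (\<lambda>i. 1 / tau2 P i) (lam_t s - lam_new G P s)
       - (rho_z P / 2) *\<^sub>R graph_lap (edges P) (lam_t s)
       + cblk_mult G (y_new G P s) - (1/2) *\<^sub>R cblk_mult G (y_t s)
       - (1/2) *\<^sub>R edge_div (edges P) (edge_vec (edges P) (z_t s)) - (\<chi> i. rhs_share P i)"
  shows "\<nu> $ i \<in> normal_cone UNIV nonneg_orthant (lam_new G P s $ i)"
proof -
  define p where "p = lam_t s $ i + tau2 P i *\<^sub>R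
     (cmat_blk G i *v blk G i (y_new G P s $ i)
      - (1/2) *\<^sub>R (cmat_blk G i *v blk G i (y_t s $ i))
      - (rho_z P / 2) *\<^sub>R nbr_sum (edges P) i (\<lambda>j. lam_t s $ i - lam_t s $ j)
      - (1/2) *\<^sub>R edge_balance (edges P) i (z_t s)
      - rhs_share P i)"
  have new: "lam_new G P s $ i = closest_point nonneg_orthant p"
    by (simp add: lam_new_def p_def)
  have "(0 :: real^'m) \<in> nonneg_orthant" by (simp add: nonneg_orthant_def)
  then have "p - lam_new G P s $ i \<in> normal_cone UNIV nonneg_orthant (lam_new G P s $ i)"
    unfolding new
    by (intro projection_residual_normal convex_nonneg_orthant closed_nonneg_orthant) auto
  then have "(1 / tau2 P i) *\<^sub>R (p - lam_new G P s $ i) \<in> normal_cone UNIV nonneg_orthant (lam_new G P s $ i)"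
    using tau2_pos[of i] by (intro normal_cone_scale) auto
  moreover have "\<nu> $ i = (1 / tau2 P i) *\<^sub>R (p - lam_new G P s $ i)"
    using tau2_pos[of i]
    by (simp add: \<nu>_def p_def scale_comp_def cblk_mult_def graph_lap_def edge_div_edge_vec cmat_blk_mult_blk
        algebra_simps)
  ultimately show ?thesis by simp
qed

lemma mu_z_new_rows:
  "scale_comp (edge_weight (edges P) (tau3 P)) (edge_vec (edges P) (mu_t s) - edge_vec (edges P) (mu_new G P s))
     = - (edge_diff (edges P) (y_new G P s)) + (1/2) *\<^sub>R edge_diff (edges P) (y_t s)"
  "scale_comp (edge_weight (edges P) (tau4 P)) (edge_vec (edges P) (z_t s) - edge_vec (edges P) (z_new G P s))
     = - (edge_diff (edges P) (lam_new G P s)) + (1/2) *\<^sub>R edge_diff (edges P) (lam_t s)"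
proof -
  have "scale_comp (edge_weight (edges P) (tau3 P)) (edge_vec (edges P) (mu_t s) - edge_vec (edges P) (mu_new G P s))
     = - (edge_diff (edges P) (y_new G P s) - (1/2) *\<^sub>R edge_diff (edges P) (y_t s))"
    by (rule edge_step_scaled[OF tau3_pos]) (auto simp: mu_new_def edge_diff_def)
  then show "scale_comp (edge_weight (edges P) (tau3 P)) (edge_vec (edges P) (mu_t s) - edge_vec (edges P) (mu_new G P s))
     = - (edge_diff (edges P) (y_new G P s)) + (1/2) *\<^sub>R edge_diff (edges P) (y_t s)" by simp
  have "scale_comp (edge_weight (edges P) (tau4 P)) (edge_vec (edges P) (z_t s) - edge_vec (edges P) (z_new G P s))
     = - (edge_diff (edges P) (lam_new G P s) - (1/2) *\<^sub>R edge_diff (edges P) (lam_t s))"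
    by (rule edge_step_scaled[OF tau4_pos]) (auto simp: z_new_def edge_diff_def)
  then show "scale_comp (edge_weight (edges P) (tau4 P)) (edge_vec (edges P) (z_t s) - edge_vec (edges P) (z_new G P s))
     = - (edge_diff (edges P) (lam_new G P s)) + (1/2) *\<^sub>R edge_diff (edges P) (lam_t s)" by simp
qed

text \<open>The multiplier update uses the new \<open>y\<close> with weight \<open>1\<close> and the old \<open>y\<close> with weight \<open>- 1/2\<close>.
  This is what the preconditioner block \<open>- 1/2 A\<close> and the term \<open>- 1/2 A y\<close> of \<open>kkt_op\<close> combine to;
  the edge updates have the same pattern.\<close>

lemma first_half_step:
  "precond G P (stacked P s - stacked_new G P s) \<in> kkt_op G P (stacked_new G P s)"
proof -
  let ?E = "edges P"
  obtain g n where gn: "\<And>i. g i \<in> partial_subdiff G i (y_new G P s $ i)"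
    "\<And>i. n i \<in> normal_cone (dspace G i) (feas G i) (blk G i (y_new G P s $ i))"
    and y: "scale_comp (\<lambda>i. 1 / tau1 P i) (y_t s - y_new G P s) - (rho_mu P / 2) *\<^sub>R graph_lap ?E (y_t s)
       - (1/2) *\<^sub>R cblk_tmult G (lam_t s) - (1/2) *\<^sub>R edge_div ?E (edge_vec ?E (mu_t s))
     = (\<chi> i. g i + n i)"
    using y_new_row[of s] by blast
  define \<nu> where "\<nu> = scale_comp (\<lambda>i. 1 / tau2 P i) (lam_t s - lam_new G P s)
       - (rho_z P / 2) *\<^sub>R graph_lap ?E (lam_t s)
       + cblk_mult G (y_new G P s) - (1/2) *\<^sub>R cblk_mult G (y_t s)
       - (1/2) *\<^sub>R edge_div ?E (edge_vec ?E (z_t s)) - (\<chi> i. rhs_share P i)"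
  have \<nu>: "\<nu> $ i \<in> normal_cone UNIV nonneg_orthant (lam_new G P s $ i)" for i
    unfolding \<nu>_def by (rule lam_new_row)
  have "precond G P (stacked P s - stacked_new G P s) =
     ((\<chi> i. g i + n i) + (rho_mu P / 2) *\<^sub>R graph_lap ?E (y_new G P s)
        + (1/2) *\<^sub>R cblk_tmult G (lam_new G P s) + (1/2) *\<^sub>R edge_div ?E (edge_vec ?E (mu_new G P s)),
      \<nu> + (\<chi> i. rhs_share P i) + (rho_z P / 2) *\<^sub>R graph_lap ?E (lam_new G P s)
        - (1/2) *\<^sub>R cblk_mult G (y_new G P s) + (1/2) *\<^sub>R edge_div ?E (edge_vec ?E (z_new G P s)),
      - ((1/2) *\<^sub>R edge_diff ?E (y_new G P s)),
      - ((1/2) *\<^sub>R edge_diff ?E (lam_new G P s)))"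
    unfolding precond_def stacked_def stacked_new_def \<nu>_def y[symmetric]
    by (simp add: mu_z_new_rows linear_diff[OF linear_graph_lap] linear_diff[OF linear_cblk_mult]
        linear_diff[OF linear_cblk_tmult] linear_diff[OF linear_edge_div] linear_diff[OF linear_edge_diff])
       (simp add: vec_eq_iff field_simps)
  then show ?thesis
    using gn \<nu> unfolding kkt_op_def stacked_new_def by auto
qed

text \<open>The second half of the algorithm solved for the differences between the variables with and
  without a tilde. Each row uses only tilde variables updated before it, so the system is triangular.\<close>

lemma tilde_update_rows:
  "scale_comp (\<lambda>i. 1 / tau1 P i) (y_new G P s - y_t_new G P s) =
     cblk_tmult G (lam_new G P s - (1/2) *\<^sub>R lam_t s) + rho_mu P *\<^sub>R graph_lap (edges P) (y_new G P s - (1/2) *\<^sub>R y_t s)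
     + edge_div (edges P) (edge_vec (edges P) (mu_new G P s) - (1/2) *\<^sub>R edge_vec (edges P) (mu_t s))"
  "scale_comp (\<lambda>i. 1 / tau2 P i) (lam_new G P s - lam_t_new G P s) =
     - cblk_mult G (y_t_new G P s - (1/2) *\<^sub>R y_t s) + rho_z P *\<^sub>R graph_lap (edges P) (lam_new G P s - (1/2) *\<^sub>R lam_t s)
     + edge_div (edges P) (edge_vec (edges P) (z_new G P s) - (1/2) *\<^sub>R edge_vec (edges P) (z_t s))"
  "scale_comp (edge_weight (edges P) (tau3 P)) (edge_vec (edges P) (mu_new G P s) - edge_vec (edges P) (mu_t_new G P s))
     = - edge_diff (edges P) (y_t_new G P s - (1/2) *\<^sub>R y_t s)"
  "scale_comp (edge_weight (edges P) (tau4 P)) (edge_vec (edges P) (z_new G P s) - edge_vec (edges P) (z_t_new G P s))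
     = - edge_diff (edges P) (lam_t_new G P s - (1/2) *\<^sub>R lam_t s)"
proof -
  let ?E = "edges P"
  have nbr: "nbr_sum ?E i (\<lambda>j. (v $ i - v $ j) - (1/2) *\<^sub>R (w $ i - w $ j)) = graph_lap ?E (v - (1/2) *\<^sub>R w) $ i"
    for i and v w :: "(real^'k::finite)^'p"
    by (simp add: graph_lap_def nbr_sum_def scaleR_diff_right algebra_simps)
  have bal: "edge_balance ?E i (\<lambda>e. f e - (1/2) *\<^sub>R f' e) = edge_div ?E (edge_vec ?E f - (1/2) *\<^sub>R edge_vec ?E f') $ i"
    for i and f f' :: "'p \<times> 'p \<Rightarrow> real^'k::finite"
    by (simp only: edge_vec_diff_scale[symmetric] edge_div_edge_vec)
  have "(1 / tau1 P i) *\<^sub>R (y_new G P s $ i - y_t_new G P s $ i) =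
     transpose (cmat_blk G i) *v (lam_new G P s $ i - (1/2) *\<^sub>R lam_t s $ i)
      + rho_mu P *\<^sub>R graph_lap ?E (y_new G P s - (1/2) *\<^sub>R y_t s) $ i
      + edge_div ?E (edge_vec ?E (mu_new G P s) - (1/2) *\<^sub>R edge_vec ?E (mu_t s)) $ i" for i
    using tau1_pos[of i] by (simp add: y_t_new_def nbr bal)
  then show "scale_comp (\<lambda>i. 1 / tau1 P i) (y_new G P s - y_t_new G P s) =
     cblk_tmult G (lam_new G P s - (1/2) *\<^sub>R lam_t s) + rho_mu P *\<^sub>R graph_lap (edges P) (y_new G P s - (1/2) *\<^sub>R y_t s)
     + edge_div (edges P) (edge_vec (edges P) (mu_new G P s) - (1/2) *\<^sub>R edge_vec (edges P) (mu_t s))"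
    by (simp add: vec_eq_iff[where 'b = 'p] scale_comp_def cblk_tmult_def)
  have "(1 / tau2 P i) *\<^sub>R (lam_new G P s $ i - lam_t_new G P s $ i) =
     - (cmat_blk G i *v (y_t_new G P s $ i - (1/2) *\<^sub>R y_t s $ i))
      + rho_z P *\<^sub>R graph_lap ?E (lam_new G P s - (1/2) *\<^sub>R lam_t s) $ i
      + edge_div ?E (edge_vec ?E (z_new G P s) - (1/2) *\<^sub>R edge_vec ?E (z_t s)) $ i" for i
  proof -
    define X where "X = cmat_blk G i *v (y_t_new G P s $ i - (1/2) *\<^sub>R y_t s $ i)
      - rho_z P *\<^sub>R graph_lap ?E (lam_new G P s - (1/2) *\<^sub>R lam_t s) $ i
      - edge_div ?E (edge_vec ?E (z_new G P s) - (1/2) *\<^sub>R edge_vec ?E (z_t s)) $ i"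
    have "lam_t_new G P s $ i = lam_new G P s $ i + tau2 P i *\<^sub>R X"
      by (simp only: lam_t_new_def vec_lambda_beta nbr bal cmat_blk_mult_blk X_def)
    then have "(1 / tau2 P i) *\<^sub>R (lam_new G P s $ i - lam_t_new G P s $ i) = - X"
      using tau2_pos[of i] by simp
    then show ?thesis by (simp add: X_def)
  qed
  then show "scale_comp (\<lambda>i. 1 / tau2 P i) (lam_new G P s - lam_t_new G P s) =
     - cblk_mult G (y_t_new G P s - (1/2) *\<^sub>R y_t s) + rho_z P *\<^sub>R graph_lap (edges P) (lam_new G P s - (1/2) *\<^sub>R lam_t s)
     + edge_div (edges P) (edge_vec (edges P) (z_new G P s) - (1/2) *\<^sub>R edge_vec (edges P) (z_t s))"
    by (simp add: vec_eq_iff[where 'b = 'p] scale_comp_def cblk_mult_def)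
  show "scale_comp (edge_weight (edges P) (tau3 P)) (edge_vec (edges P) (mu_new G P s) - edge_vec (edges P) (mu_t_new G P s))
     = - edge_diff (edges P) (y_t_new G P s - (1/2) *\<^sub>R y_t s)"
    by (rule edge_step_scaled[OF tau3_pos]) (auto simp: mu_t_new_def edge_diff_def algebra_simps)
  show "scale_comp (edge_weight (edges P) (tau4 P)) (edge_vec (edges P) (z_new G P s) - edge_vec (edges P) (z_t_new G P s))
     = - edge_diff (edges P) (lam_t_new G P s - (1/2) *\<^sub>R lam_t s)"
    by (rule edge_step_scaled[OF tau4_pos]) (auto simp: z_t_new_def edge_diff_def algebra_simps)
qed

text \<open>With \<open>u\<close> the \<open>coupling_op\<close>-resolvent at the reflected point \<open>2 w - x\<close> and the
  Douglas--Rachford update \<open>x' = x + u - w\<close>, the resolvent equation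
  \<open>precond (2 w - x - u) = coupling_op u\<close> turns into this one by eliminating \<open>u\<close>.\<close>

lemma second_half_step:
  "precond G P (stacked_new G P s - stacked P (alg_next G P s)) =
   coupling_op G P (stacked P (alg_next G P s) - stacked P s + stacked_new G P s)"
  unfolding precond_def coupling_op_def stacked_def stacked_new_def alg_next_def
  by (simp add: tilde_update_rows linear_diff[OF linear_graph_lap] linear_diff[OF linear_cblk_mult]
      linear_diff[OF linear_cblk_tmult] linear_diff[OF linear_edge_div] linear_diff[OF linear_edge_diff]
      linear_add[OF linear_graph_lap] linear_add[OF linear_cblk_mult]
      linear_add[OF linear_cblk_tmult] linear_add[OF linear_edge_div] linear_add[OF linear_edge_diff]
      linear_scale[OF linear_graph_lap] linear_scale[OF linear_cblk_mult]
      linear_scale[OF linear_cblk_tmult] linear_scale[OF linear_edge_div] linear_scale[OF linear_edge_diff])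
     (simp add: vec_eq_iff field_simps)

text \<open>All copies are equal and the edge variables \<open>m\<close> are \<open>0\<close>, because the first block row holds for
  every player. The normal vector of the multiplier is divided equally among the players; the
  mismatch with the individual shares of the constraint sums to \<open>0\<close>, so it is the divergence of some \<open>z\<close>.\<close>

lemma zero_of_kkt:
  assumes "kkt G x l"
  shows "\<exists>w. \<exists>a\<in>kkt_op G P w. - a = coupling_op G P w"
proof -
  let ?E = "edges P"
  obtain g n where g: "\<And>i. g i \<in> partial_subdiff G i x" "\<And>i. n i \<in> normal_cone (dspace G i) (feas G i) (blk G i x)"
    "\<And>i. g i + n i + transpose (cmat_blk G i) *v l = 0"
    using assms unfolding kkt_iff by metis
  define N where "N = real CARD('p)"
  have N: "0 < N" by (simp add: N_def)
  define \<nu> where "\<nu> = (1 / N) *\<^sub>R (cmat G *v x - crhs G)"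
  have \<nu>: "\<nu> \<in> normal_cone UNIV nonneg_orthant l"
    unfolding \<nu>_def using assms N by (intro normal_cone_scale) (auto simp: kkt_iff)
  define t where "t = (\<chi> i::'p. cmat_blk G i *v x - rhs_share P i - \<nu>)"
  have "(\<Sum>i\<in>(UNIV :: 'p set). \<nu>) = cmat G *v x - crhs G"
    unfolding sum_constant_scaleR by (simp add: \<nu>_def N_def)
  then have "(\<Sum>i\<in>UNIV. t $ i) = 0"
    by (simp add: t_def sum_subtractf sum_cmat_blk rhs_shares del: sum_constant)
  then obtain z where z: "edge_div ?E z = t" using range_edge_div[OF graph_connected] by blast
  define y where "y = (\<chi> i::'p. x)"
  define lv where "lv = (\<chi> i::'p. l)"
  have cons: "edge_diff ?E y = 0" "edge_diff ?E lv = 0" by (simp_all add: y_def lv_def edge_diff_const)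
  then have lap: "graph_lap ?E y = 0" "graph_lap ?E lv = 0"
    by (simp_all add: graph_lap_eq_div_diff linear_0[OF linear_edge_div])
  define a where "a = ((\<chi> i. g i + n i) + (rho_mu P / 2) *\<^sub>R graph_lap ?E y
        + (1/2) *\<^sub>R cblk_tmult G lv + (1/2) *\<^sub>R edge_div ?E 0,
      (\<chi> i. \<nu>) + (\<chi> i. rhs_share P i) + (rho_z P / 2) *\<^sub>R graph_lap ?E lv
        - (1/2) *\<^sub>R cblk_mult G y + (1/2) *\<^sub>R edge_div ?E z,
      - ((1/2) *\<^sub>R edge_diff ?E y),
      - ((1/2) *\<^sub>R edge_diff ?E lv))"
  have "a \<in> kkt_op G P (y, lv, 0, z)"
    unfolding kkt_op_def a_def using g(1,2) \<nu> by (auto simp: y_def lv_def)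
  moreover have "- a = coupling_op G P (y, lv, 0, z)"
  proof -
    have gn: "(\<chi> i. g i + n i) = - cblk_tmult G lv"
      using g(3) by (simp add: cblk_tmult_def lv_def vec_eq_iff[where 'b = 'p] eq_neg_iff_add_eq_0)
    have "edge_div ?E z = cblk_mult G y - (\<chi> i. rhs_share P i) - (\<chi> i. \<nu>)"
      by (simp add: z t_def cblk_mult_def y_def vec_eq_iff[where 'b = 'p])
    then have nu: "(\<chi> i. \<nu>) = cblk_mult G y - (\<chi> i. rhs_share P i) - edge_div ?E z" by simp
    show ?thesis
      unfolding a_def coupling_op_def gn nu
      by (simp add: cons lap linear_0[OF linear_edge_div] vec_eq_iff)
  qed
  ultimately show ?thesis by blast
qed

text \<open>In both rows the sum over the players removes the divergence. The summed first row still
  determines each player's condition, since the contributions of different players live on different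
  coordinates; in the second row the normal vectors add up inside the normal cone.\<close>

lemma kkt_of_zero:
  assumes a: "a \<in> kkt_op G P (y, l, m, z)" and zero: "- a = coupling_op G P (y, l, m, z)"
  obtains x k where "y = (\<chi> i. x)" "l = (\<chi> i. k)" "kkt G x k"
proof -
  let ?E = "edges P"
  obtain g n \<nu> where g: "\<And>i. g i \<in> partial_subdiff G i (y $ i)"
    "\<And>i. n i \<in> normal_cone (dspace G i) (feas G i) (blk G i (y $ i))"
    "\<And>i. \<nu> $ i \<in> normal_cone UNIV nonneg_orthant (l $ i)"
    and a_eq: "a = ((\<chi> i. g i + n i) + (rho_mu P / 2) *\<^sub>R graph_lap ?E y
        + (1/2) *\<^sub>R cblk_tmult G l + (1/2) *\<^sub>R edge_div ?E m,
      \<nu> + (\<chi> i. rhs_share P i) + (rho_z P / 2) *\<^sub>R graph_lap ?E l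
        - (1/2) *\<^sub>R cblk_mult G y + (1/2) *\<^sub>R edge_div ?E z,
      - ((1/2) *\<^sub>R edge_diff ?E y), - ((1/2) *\<^sub>R edge_diff ?E l))"
    using a unfolding kkt_op_def by auto
  have sum0: "a + coupling_op G P (y, l, m, z) = 0" using zero by (simp flip: zero)
  have "- edge_diff ?E y = fst (snd (snd (a + coupling_op G P (y, l, m, z))))"
    "- edge_diff ?E l = snd (snd (snd (a + coupling_op G P (y, l, m, z))))"
    by (simp_all add: a_eq coupling_op_def vec_eq_iff)
  then have "edge_diff ?E y = 0" "edge_diff ?E l = 0" by (simp_all add: sum0)
  then have lap: "graph_lap ?E y = 0" "graph_lap ?E l = 0"
    by (simp_all add: graph_lap_eq_div_diff linear_0[OF linear_edge_div])
  \<comment> \<open>By consensus, the copies of an arbitrary player serve for all.\<close>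
  define x where "x = y $ undefined"
  define k where "k = l $ undefined"
  have x: "y = (\<chi> i. x)"
    unfolding x_def vec_eq_iff[where 'b = 'p] vec_lambda_beta
    using consensus_if_edge_diff_0[OF graph_connected \<open>edge_diff ?E y = 0\<close>] by blast
  have k: "l = (\<chi> i. k)"
    unfolding k_def vec_eq_iff[where 'b = 'p] vec_lambda_beta
    using consensus_if_edge_diff_0[OF graph_connected \<open>edge_diff ?E l = 0\<close>] by blast
  have row_y: "(\<chi> i. g i + n i) + cblk_tmult G l + edge_div ?E m = 0"
    and row_l: "\<nu> + (\<chi> i. rhs_share P i) - cblk_mult G y + edge_div ?E z = 0"
  proof -
    have "(\<chi> i. g i + n i) + cblk_tmult G l + edge_div ?E m = fst (a + coupling_op G P (y, l, m, z))"
      "\<nu> + (\<chi> i. rhs_share P i) - cblk_mult G y + edge_div ?E z = fst (snd (a + coupling_op G P (y, l, m, z)))"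
      by (simp_all add: a_eq coupling_op_def lap vec_eq_iff field_simps)
    then show "(\<chi> i. g i + n i) + cblk_tmult G l + edge_div ?E m = 0"
      "\<nu> + (\<chi> i. rhs_share P i) - cblk_mult G y + edge_div ?E z = 0" by (simp_all add: sum0)
  qed
  have gi: "g i + n i + transpose (cmat_blk G i) *v k + edge_div ?E m $ i = 0" for i
    using arg_cong[OF row_y, of "\<lambda>v. v $ i"] by (simp add: cblk_tmult_def k)
  define r where "r i = g i + n i + transpose (cmat_blk G i) *v k" for i
  have r: "r i \<in> dspace G i" for i
    unfolding r_def using partial_subdiff_dspace[OF g(1)[of i]] g(2)[of i]
    by (intro subspace_add[OF subspace_dspace] transpose_cmat_blk_dspace) (auto simp: normal_cone_def)
  have "(\<Sum>i\<in>UNIV. r i + edge_div ?E m $ i) = 0"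
    unfolding r_def by (simp only: gi) simp
  then have "(\<Sum>i\<in>UNIV. r i) = 0" by (simp add: sum.distrib sum_edge_div)
  then have "r i = 0" for i
    using blk_sum_dspace[of r G i, OF r] linear_0[OF linear_blk, of G i] by simp
  then have "g i + n i + transpose (cmat_blk G i) *v k = 0" for i by (simp only: r_def)
  moreover have "cmat G *v x - crhs G \<in> normal_cone UNIV nonneg_orthant k"
  proof -
    have "\<nu> $ i + rhs_share P i - cmat_blk G i *v x + edge_div ?E z $ i = 0" for i
      using arg_cong[OF row_l, of "\<lambda>v. v $ i"] by (simp add: cblk_mult_def x)
    then have "(\<Sum>i\<in>UNIV. \<nu> $ i + rhs_share P i - cmat_blk G i *v x + edge_div ?E z $ i) = 0" by simp
    then have "(\<Sum>i\<in>UNIV. \<nu> $ i) = cmat G *v x - crhs G"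
      by (simp add: sum.distrib sum_subtractf sum_edge_div rhs_shares sum_cmat_blk algebra_simps)
    moreover have "(\<Sum>i\<in>UNIV. \<nu> $ i) \<in> normal_cone UNIV nonneg_orthant k"
      using g(3) by (intro normal_cone_sum) (auto simp: k)
    ultimately show ?thesis by simp
  qed
  moreover have "g i \<in> partial_subdiff G i x" "n i \<in> normal_cone (dspace G i) (feas G i) (blk G i x)" for i
    using g(1)[of i] g(2)[of i] by (simp_all add: x)
  ultimately have "kkt G x k" unfolding kkt_iff by blast
  with x k show thesis by (rule that)
qed

theorem iterates_converge:
  "\<exists>x l. y_seq G P s0 \<longlonglongrightarrow> (\<chi> i. x) \<and> lam_seq G P s0 \<longlonglongrightarrow> (\<chi> i. l) \<and> kkt G x l"
proof -
  have "\<exists>w. (\<exists>a\<in>kkt_op G P w. - a \<in> {coupling_op G P w}) \<and>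
      (\<lambda>k. stacked_new G P ((alg_next G P ^^ k) s0)) \<longlonglongrightarrow> w"
  proof (rule douglas_rachford_convergence[OF linear_precond precond_selfadjoint precond_pos kkt_op_monotone
        _ closed_range_stacked first_half_step])
    show "monotone_op (\<lambda>w. {coupling_op G P w})"
      unfolding monotone_op_def
    proof (intro allI ballI)
      fix x x' u u' assume "u \<in> {coupling_op G P x}" "u' \<in> {coupling_op G P x'}"
      then have "u - u' = coupling_op G P (x - x')" by (simp add: linear_diff[OF linear_coupling_op])
      then show "0 \<le> (u - u') \<bullet> (x - x')"
        using coupling_op_nonneg[OF rho_mu_nonneg rho_z_nonneg] by metis
    qed
    define U where "U s = stacked P (alg_next G P s) - stacked P s + stacked_new G P s" for s
    show "precond G P (2 *\<^sub>R stacked_new G P s - stacked P s - U s) \<in> {coupling_op G P (U s)}" for s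
      using second_half_step[of s] by (simp add: U_def scaleR_2)
    show "stacked P (alg_next G P s) = stacked P s + U s - stacked_new G P s" for s
      by (simp add: U_def)
    show "\<exists>w. \<exists>a\<in>kkt_op G P w. - a \<in> {coupling_op G P w}"
      using v_gne_exists zero_of_kkt by (auto simp: v_gne_def)
  qed
  then obtain w a where w: "a \<in> kkt_op G P w" "- a = coupling_op G P w"
    and lim: "(\<lambda>k. stacked_new G P ((alg_next G P ^^ k) s0)) \<longlonglongrightarrow> w" by auto
  obtain y l m z where w_eq: "w = (y, l, m, z)" by (cases w) auto
  obtain x k where xk: "y = (\<chi> i. x)" "l = (\<chi> i. k)" "kkt G x k"
    using kkt_of_zero w unfolding w_eq by blast
  have "y_seq G P s0 \<longlonglongrightarrow> y"
    using tendsto_fst[OF lim] by (simp add: w_eq stacked_new_def y_seq_def[abs_def])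
  moreover have "lam_seq G P s0 \<longlonglongrightarrow> l"
    using tendsto_fst[OF tendsto_snd[OF lim]] by (simp add: w_eq stacked_new_def lam_seq_def[abs_def])
  ultimately show ?thesis using xk by blast
qed

end

theorem theorem2:
  fixes G :: "('p::finite, 'n::finite, 'm::finite) game"
    and P :: "('p, 'm) network"
    and s0 :: "('p, 'n, 'm) alg_state"
  assumes cost_proper: "\<And>i x. proper_on (dspace G i) (own_cost G i x)"
    and cost_lsc: "\<And>i x. lsc_on (dspace G i) (own_cost G i x)"
    and cost_convex: "\<And>i x. econvex_on (dspace G i) (own_cost G i x)"
    and feas_dspace: "\<And>i. feas G i \<subseteq> dspace G i"
    and feas_nonempty: "\<And>i. feas G i \<noteq> {}"
    and feas_closed: "\<And>i. closed (feas G i)"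
    and feas_convex: "\<And>i. convex (feas G i)"
    and feasible_nonempty: "feasible_set G \<noteq> {}"
    and slater: "slater G"
    and graph_connected: "weakly_connected (edges P)"
    and graph_loopfree: "irrefl (edges P)"
    and v_gne_exists: "\<exists>x. v_gne G x"
    and max_mono: "maximally_monotone_op (reg_pseudograd G (edges P) (rho_mu P))"
    and rho_mu_nonneg: "0 \<le> rho_mu P"
    and rho_z_nonneg: "0 \<le> rho_z P"
    and rhs_shares: "(\<Sum>i\<in>UNIV. rhs_share P i) = crhs G"
    and tau1_pos: "\<And>i. 0 < tau1 P i"
    and tau2_pos: "\<And>i. 0 < tau2 P i"
    and tau3_pos: "\<And>e. e \<in> edges P \<Longrightarrow> 0 < tau3 P e"
    and tau4_pos: "\<And>e. e \<in> edges P \<Longrightarrow> 0 < tau4 P e"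
    and tau1_bound: "\<And>i. inverse (tau1 P i) >
          1/2 * matrix_norm_1 (cmat_blk G i) + (1/2 + rho_mu P) * real (deg (edges P) i)"
    and tau2_bound: "\<And>i. inverse (tau2 P i) >
          1/2 * matrix_norm_inf (cmat_blk G i) + (1/2 + rho_z P) * real (deg (edges P) i)"
    and tau3_bound: "\<And>e. e \<in> edges P \<Longrightarrow> inverse (tau3 P e) > 1"
    and tau4_bound: "\<And>e. e \<in> edges P \<Longrightarrow> inverse (tau4 P e) > 1"
  shows "\<exists>ystar lstar.
           y_seq G P s0 \<longlonglongrightarrow> (\<chi> i. ystar) \<and>
           lam_seq G P s0 \<longlonglongrightarrow> (\<chi> i. lstar) \<and>
           v_gne G ystar \<and> kkt G ystar lstar"
proof -
  interpret gne_algorithm G P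
    using assms by unfold_locales (auto simp: convex_costs_def maximally_monotone_op_def)
  show ?thesis
    using iterates_converge[of s0] by (auto simp: v_gne_def)
qed

end
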